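(* Let $I$ be a tropical ideal in $\overline{\mathbb R}[x_1^{\pm1},\dots,x_n^{\pm1}]$ of dimension $d$. Then $V(I)\subseteq\mathbb R^n$ is (the support of) a $d$-dimensional polyhedral complex, i.e. its cells have dimension at most $d$ and some cell has dimension $d$.
   Context: $\overline{\mathbb R}=(\mathbb R\cup\{\infty\},\min,+)$. $[f]_{\mathbf x^{\mathbf u}}$ is the coefficient of $\mathbf x^{\mathbf u}$, $f(\mathbf w)=\min_{\mathbf u}([f]_{\mathbf x^{\mathbf u}}+\mathbf u\cdot\mathbf w)$. Tropical ideal: for $f,g\in I$ and $\mathbf x^{\mathbf u}$ with $[f]_{\mathbf x^{\mathbf u}}=[g]_{\mathbf x^{\mathbf u}}\ne\infty$ there is $h\in I$ with $[h]_{\mathbf x^{\mathbf u}}=\infty$ and $[h]_{\mathbf x^{\mathbf v}}\ge\min([f]_{\mathbf x^{\mathbf v}},[g]_{\mathbf x^{\mathbf v}})$ for all $\mathbf v$, with equality when $[f]_{\mathbf x^{\mathbf v}}\ne[g]_{\mathbf x^{\mathbf v}}$. $V(I)=\{\mathbf w\in\mathbb R^n:$ for every $f\in I$, $f\ne\infty$, the minimum in $f(\mathbf w)$ is attained at least twice$\}$; it is known to be the support of a finite polyhedral complex. Dimension: for homogeneous $J\subseteq\overline{\mathbb R}[x_0,\dots,x_n]$, $H_J(e)$ is the maximum size of a set of degree-$e$ monomials containing the support of no element $\ne\infty$ of $J$; for homogeneous tropical ideals $H_J(e)$ agrees with a polynomial for $e\gg0$, and $\dim J$ is its degree. For $I'\subseteq\overline{\mathbb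 R}[x_1,\dots,x_n]$, $\dim I'=\dim I'^h$, where $I'^h$ is generated by homogenizations $\bigoplus c_{\mathbf u}x_0^{D-|\mathbf u|}\mathbf x^{\mathbf u}$ ($D=\max\{|\mathbf u|:c_{\mathbf u}\ne\infty\}$); for Laurent $I$, $\dim I=\dim(I\cap\overline{\mathbb R}[x_1,\dots,x_n])$. *)

theory Defs
  imports "HOL-Analysis.Analysis" "HOL-Computational_Algebra.Polynomial"
begin

section \<open>Tropical semiring (R union {infinity}, min, +): None represents infinity\<close>

type_synonym trop = "real option"

fun tmin :: "trop \<Rightarrow> trop \<Rightarrow> trop" where
  "tmin None y = y"
| "tmin x None = x"
| "tmin (Some a) (Some b) = Some (min a b)"

fun tle :: "trop \<Rightarrow> trop \<Rightarrow> bool" where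
  "tle _ None = True"
| "tle None (Some _) = False"
| "tle (Some a) (Some b) = (a \<le> b)"

type_synonym 'm tpoly = "'m \<Rightarrow> trop"

definition tsupp :: "'m tpoly \<Rightarrow> 'm set" where
  "tsupp f = {u. f u \<noteq> None}"

definition tzero :: "'m tpoly" where
  "tzero = (\<lambda>_. None)"

definition tadd :: "'m tpoly \<Rightarrow> 'm tpoly \<Rightarrow> 'm tpoly" where
  "tadd f g = (\<lambda>u. tmin (f u) (g u))"

definition tmult :: "('m::comm_monoid_add) tpoly \<Rightarrow> 'm tpoly \<Rightarrow> 'm tpoly" where
  "tmult f g = (\<lambda>u. let S = {(v, w). v \<in> tsupp f \<and> w \<in> tsupp g \<and> v + w = u} in
     if S = {} then None
     else Some (Min ((\<lambda>(v, w). the (f v) + the (g w)) ` S)))"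

text \<open>Polynomials whose monomial exponents lie in the set M (M is a submonoid).\<close>
definition tpolys :: "'m set \<Rightarrow> 'm tpoly set" where
  "tpolys M = {f. finite (tsupp f) \<and> tsupp f \<subseteq> M}"

definition semiring_ideal :: "('m::comm_monoid_add) set \<Rightarrow> 'm tpoly set \<Rightarrow> bool" where
  "semiring_ideal M J \<longleftrightarrow> J \<subseteq> tpolys M \<and> tzero \<in> J
     \<and> (\<forall>f\<in>J. \<forall>g\<in>J. tadd f g \<in> J)
     \<and> (\<forall>p\<in>tpolys M. \<forall>f\<in>J. tmult p f \<in> J)"

definition tropical_ideal :: "('m::comm_monoid_add) set \<Rightarrow> 'm tpoly set \<Rightarrow> bool" where
  "tropical_ideal M I \<longleftrightarrow> semiring_ideal M I \<and>
     (\<forall>f\<in>I. \<forall>g\<in>I. \<forall>u. f u = g u \<and> f u \<noteq> None \<longrightarrow>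
        (\<exists>h\<in>I. h u = None \<and>
           (\<forall>v. tle (tmin (f v) (g v)) (h v) \<and>
                (f v \<noteq> g v \<longrightarrow> h v = tmin (f v) (g v)))))"

definition ideal_generated :: "('m::comm_monoid_add) set \<Rightarrow> 'm tpoly set \<Rightarrow> 'm tpoly set" where
  "ideal_generated M G = \<Inter> {J. semiring_ideal M J \<and> G \<subseteq> J}"

abbreviation laurent_exps :: "(int ^ 'n) set" where
  "laurent_exps \<equiv> UNIV"

definition poly_exps :: "(int ^ 'n) set" where
  "poly_exps = {u. \<forall>i. 0 \<le> u $ i}"

text \<open>Polynomial ring in x_0, x_1..x_n: exponent (a, u) of x_0^a x^u.\<close>
definition hpoly_exps :: "(int \<times> (int ^ 'n)) set" where
  "hpoly_exps = {(a, u). 0 \<le> a \<and> (\<forall>i. 0 \<le> u $ i)}"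

definition total_deg :: "int ^ 'n \<Rightarrow> int" where
  "total_deg u = (\<Sum>i\<in>UNIV. u $ i)"

definition homogenize :: "(int ^ 'n) tpoly \<Rightarrow> (int \<times> (int ^ 'n)) tpoly" where
  "homogenize f = (let D = Max (total_deg ` tsupp f) in
      (\<lambda>(a, u). if a = D - total_deg u then f u else None))"

definition homogenization_ideal :: "(int ^ 'n) tpoly set \<Rightarrow> (int \<times> (int ^ 'n)) tpoly set" where
  "homogenization_ideal I' = ideal_generated hpoly_exps (homogenize ` I')"

definition hmonomials :: "nat \<Rightarrow> (int \<times> (int ^ 'n)) set" where
  "hmonomials e = {(a, u). (a, u) \<in> hpoly_exps \<and> a + total_deg u = int e}"

definition hilbert_fun :: "(int \<times> (int ^ 'n)) tpoly set \<Rightarrow> nat \<Rightarrow> nat" where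
  "hilbert_fun J e = Max {card S | S. S \<subseteq> hmonomials e \<and>
       \<not> (\<exists>f\<in>J. f \<noteq> tzero \<and> tsupp f \<subseteq> S)}"

definition hom_ideal_dim :: "(int \<times> (int ^ 'n)) tpoly set \<Rightarrow> nat \<Rightarrow> bool" where
  "hom_ideal_dim J d \<longleftrightarrow> (\<exists>p :: real poly. p \<noteq> 0 \<and> degree p = d \<and>
       (\<forall>\<^sub>F e in sequentially. real (hilbert_fun J e) = poly p (real e)))"

definition laurent_ideal_dim :: "(int ^ 'n) tpoly set \<Rightarrow> nat \<Rightarrow> bool" where
  "laurent_ideal_dim I d \<longleftrightarrow>
     hom_ideal_dim (homogenization_ideal (I \<inter> tpolys poly_exps)) d"

definition expdot :: "int ^ 'n \<Rightarrow> real ^ 'n \<Rightarrow> real" where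
  "expdot u w = (\<Sum>i\<in>UNIV. real_of_int (u $ i) * w $ i)"

definition min_attained_twice :: "(int ^ 'n) tpoly \<Rightarrow> real ^ 'n \<Rightarrow> bool" where
  "min_attained_twice f w \<longleftrightarrow> (\<exists>u v. u \<noteq> v \<and> u \<in> tsupp f \<and> v \<in> tsupp f \<and>
      the (f u) + expdot u w = the (f v) + expdot v w \<and>
      (\<forall>z\<in>tsupp f. the (f u) + expdot u w \<le> the (f z) + expdot z w))"

definition trop_variety :: "(int ^ 'n) tpoly set \<Rightarrow> (real ^ 'n) set" where
  "trop_variety I = {w. \<forall>f\<in>I. f \<noteq> tzero \<longrightarrow> min_attained_twice f w}"

definition polyhedral_complex :: "('a::euclidean_space) set set \<Rightarrow> bool" where
  "polyhedral_complex C \<longleftrightarrow> finite C \<and>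
     (\<forall>P\<in>C. polyhedron P \<and> P \<noteq> {}) \<and>
     (\<forall>P\<in>C. \<forall>F. F face_of P \<and> F \<noteq> {} \<longrightarrow> F \<in> C) \<and>
     (\<forall>P\<in>C. \<forall>Q\<in>C. (P \<inter> Q) face_of P \<and> (P \<inter> Q) face_of Q)"

end

theory Submission
  imports Defs
begin

text \<open>
  Call a set of exponents independent if it contains the support of no nonzero element of \<open>I\<close>. This
  is a translation invariant matroid on \<open>\<int>\<^sup>n\<close>, and the Hilbert function at \<open>e\<close> is the rank of the set
  of exponents of polynomials of degree at most \<open>e\<close>. For a weight \<open>w\<close>, with ties broken by a generic
  functional, the leading exponents in degree \<open>e\<close> form the complement of a basis; they are the graded
  pieces of a monomial ideal whose Hilbert function does not depend on \<open>w\<close>. By Dickson's lemma and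
  compactness such ideals are generated in bounded degree, so one degree determines the Groebner cell
  of \<open>w\<close> in all degrees, and \<open>V(I)\<close> is a union of cells of a finite hyperplane arrangement.

  If the Hilbert polynomial has degree \<open>d\<close>, some coordinate sublattice \<open>\<int>\<^sup>A\<close> with \<open>card A = d\<close> is
  independent and none with \<open>card A = d + 1\<close> is. A relation in \<open>d + 1\<close> coordinates confines \<open>V(I)\<close> to
  finitely many hyperplanes transversal to any given \<open>(d + 1)\<close>-dimensional cell. For the lower bound,
  \<open>V(I)\<close> meets every fibre of the projection to \<open>\<real>\<^sup>A\<close> over a generic point \<open>\<omega>\<close>: otherwise, for the
  weight \<open>\<omega> \<bullet> u\<^sub>A - \<epsilon> \<Sum>\<^bsub>i \<notin> A\<^esub> u\<^sub>i\<^sup>2\<close>, every element of a tube around \<open>\<int>\<^sup>A\<close> would be a loop of the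
  initial matroid, so that the rank of a box of side \<open>N\<close> in the tube would be \<open>O(N\<^bsup>d-1\<^esup>)\<close> although the
  box contains about \<open>N\<^sup>d\<close> independent elements.
\<close>

section \<open>Valuated linear systems\<close>

text \<open>The ideal is known only through closure properties and elimination, so there is no
  finite list of generators from which to read off \<open>V(I)\<close>. Fundamental circuits of a
  basis take that role: whether some element has a monomial initial form is visible on them alone,
  even for a weight on the boundary of the Groebner cell that belongs to the basis. The tie-break
  keeps the leading exponents complementary to a basis at every special weight, so all these
  monomial ideals have equally many elements in each degree, and inclusions between them become
  equalities.

  In the lower bound a linear weight would not do. One point of the fibre supplies a single relation
  for all exponents, and its support may leave every tube around \<open>\<int>^A\<close>. A concave
  quadratic weight looks near \<open>u\<close> like a linear one of slope
  \<open>-2 \<epsilon> u_i\<close>: as \<open>u\<close> crosses the tube, the slopes sweep a compact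
  part of the fibre, so emptiness of the whole fibre is exploited. Further out the weight rises so
  steeply inwards that relations pointing inwards have their unique minimum at \<open>u\<close>, and
  the tube closes up.\<close>

definition tscale :: "real \<Rightarrow> 'm tpoly \<Rightarrow> 'm tpoly" where
  "tscale c f = (\<lambda>u. map_option ((+) c) (f u))"

lemma tsupp_tscale [simp]: "tsupp (tscale c f) = tsupp f"
  by (auto simp: tsupp_def tscale_def)

lemma the_tscale: "u \<in> tsupp f \<Longrightarrow> the (tscale c f u) = c + the (f u)"
  by (auto simp: tsupp_def tscale_def)

lemma tsupp_empty_iff: "tsupp f = {} \<longleftrightarrow> f = tzero"
  by (auto simp: tsupp_def tzero_def fun_eq_iff)

lemma tsupp_nonzero: "u \<in> tsupp f \<Longrightarrow> f \<noteq> tzero"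
  by (auto simp: tsupp_def tzero_def)

text \<open>The initial form at weight \<open>\<theta>\<close> is a monomial, so \<open>z\<close> is
  a loop of the initial matroid. Weights are arbitrary functions of the exponent because the
  projection argument uses a quadratic one.\<close>

definition umin :: "('m \<Rightarrow> real) \<Rightarrow> 'm tpoly \<Rightarrow> 'm \<Rightarrow> bool" where
  "umin \<theta> f z \<longleftrightarrow> z \<in> tsupp f \<and> (\<forall>v\<in>tsupp f. v \<noteq> z \<longrightarrow> the (f z) + \<theta> z < the (f v) + \<theta> v)"

definition lead :: "('m \<Rightarrow> real) \<Rightarrow> ('m \<Rightarrow> real) \<Rightarrow> 'm tpoly \<Rightarrow> 'm \<Rightarrow> bool" where
  "lead \<theta> \<tau> f u \<longleftrightarrow> u \<in> tsupp f \<and> (\<forall>v\<in>tsupp f. v \<noteq> u \<longrightarrow>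
     the (f u) + \<theta> u < the (f v) + \<theta> v \<or> the (f u) + \<theta> u = the (f v) + \<theta> v \<and> \<tau> u < \<tau> v)"

lemma umin_imp_lead: "umin \<theta> f u \<Longrightarrow> lead \<theta> \<tau> f u"
  by (auto simp: umin_def lead_def)

lemma lead_imp_le: "lead \<theta> \<tau> f u \<Longrightarrow> v \<in> tsupp f \<Longrightarrow> the (f u) + \<theta> u \<le> the (f v) + \<theta> v"
  unfolding lead_def by (cases "v = u") (auto intro: less_imp_le)

lemma lead_exists:
  assumes "finite (tsupp f)" "f \<noteq> tzero" "inj_on \<tau> (tsupp f)"
  obtains u where "lead \<theta> \<tau> f u"
proof -
  define m where "m = Min ((\<lambda>v. the (f v) + \<theta> v) ` tsupp f)"
  define X where "X = {v \<in> tsupp f. the (f v) + \<theta> v = m}"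
  have ne: "tsupp f \<noteq> {}" using assms(2) by (simp add: tsupp_empty_iff)
  have "m \<in> (\<lambda>v. the (f v) + \<theta> v) ` tsupp f"
    unfolding m_def using assms(1) ne by (intro Min_in) auto
  then have X: "X \<noteq> {}" "finite X" using assms(1) by (auto simp: X_def)
  define u where "u = arg_min_on \<tau> X"
  have u: "u \<in> X" "\<And>v. v \<in> X \<Longrightarrow> \<tau> u \<le> \<tau> v"
    using arg_min_if_finite[OF X(2,1), of \<tau>] unfolding u_def by force+
  have m: "m \<le> the (f v) + \<theta> v" if "v \<in> tsupp f" for v
    unfolding m_def using assms(1) that by (intro Min_le) auto
  have "lead \<theta> \<tau> f u"
    unfolding lead_def
  proof (intro conjI ballI impI)
    show "u \<in> tsupp f" using u(1) by (simp add: X_def)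
    fix v assume v: "v \<in> tsupp f" "v \<noteq> u"
    show "the (f u) + \<theta> u < the (f v) + \<theta> v \<or> the (f u) + \<theta> u = the (f v) + \<theta> v \<and> \<tau> u < \<tau> v"
    proof (cases "the (f v) + \<theta> v = m")
      case True
      then have "\<tau> u \<le> \<tau> v" using u(2) v by (simp add: X_def)
      moreover have "\<tau> u \<noteq> \<tau> v" using assms(3) v u(1) by (auto simp: X_def inj_on_def)
      ultimately show ?thesis using True u(1) by (simp add: X_def)
    next
      case False
      then show ?thesis using m[OF v(1)] u(1) by (simp add: X_def)
    qed
  qed
  then show thesis by (rule that)
qed

text \<open>The elimination axiom in real coefficients, \<open>g\<close> being scaled by
  \<open>c\<close> to agree with \<open>f\<close> at \<open>u\<close>. At an exponent where the two
  coefficients tie only the lower bound is recorded: the exponent may stay or vanish.\<close>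

definition elimination :: "'m tpoly \<Rightarrow> 'm tpoly \<Rightarrow> 'm \<Rightarrow> real \<Rightarrow> 'm tpoly \<Rightarrow> bool" where
  "elimination f g u c h \<longleftrightarrow> u \<notin> tsupp h \<and> tsupp h \<subseteq> tsupp f \<union> tsupp g \<and>
     the (f u) = c + the (g u) \<and>
     (\<forall>v\<in>tsupp h. (v \<in> tsupp f \<and> the (f v) \<le> the (h v)) \<or>
                   (v \<in> tsupp g \<and> c + the (g v) \<le> the (h v))) \<and>
     (\<forall>v\<in>tsupp f. (v \<in> tsupp g \<longrightarrow> the (f v) < c + the (g v)) \<longrightarrow>
                   v \<in> tsupp h \<and> the (h v) = the (f v)) \<and>
     (\<forall>v\<in>tsupp g. (v \<in> tsupp f \<longrightarrow> c + the (g v) < the (f v)) \<longrightarrow>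
                   v \<in> tsupp h \<and> the (h v) = c + the (g v))"

lemma eliminationD:
  assumes "elimination f g u c h"
  shows "u \<notin> tsupp h" "tsupp h \<subseteq> tsupp f \<union> tsupp g" "the (f u) = c + the (g u)"
    "\<And>v. v \<in> tsupp h \<Longrightarrow> (v \<in> tsupp f \<and> the (f v) \<le> the (h v)) \<or>
                           (v \<in> tsupp g \<and> c + the (g v) \<le> the (h v))"
    "\<And>v. \<lbrakk>v \<in> tsupp f; v \<in> tsupp g \<Longrightarrow> the (f v) < c + the (g v)\<rbrakk> \<Longrightarrow>
          v \<in> tsupp h \<and> the (h v) = the (f v)"
    "\<And>v. \<lbrakk>v \<in> tsupp g; v \<in> tsupp f \<Longrightarrow> c + the (g v) < the (f v)\<rbrakk> \<Longrightarrow>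
          v \<in> tsupp h \<and> the (h v) = c + the (g v)"
  using assms unfolding elimination_def by blast+

text \<open>Separated from ideals because the matroid arguments are applied to two systems: the
  ideal itself and its constant-coefficient version.\<close>

locale trop_lin =
  fixes V :: "'m tpoly set"
  assumes finite_supp: "f \<in> V \<Longrightarrow> finite (tsupp f)"
    and scale: "f \<in> V \<Longrightarrow> tscale c f \<in> V"
    and elim_ax: "\<lbrakk>f \<in> V; g \<in> V; f u = g u; f u \<noteq> None\<rbrakk> \<Longrightarrow>
       \<exists>h\<in>V. h u = None \<and> (\<forall>v. tle (tmin (f v) (g v)) (h v) \<and>
              (f v \<noteq> g v \<longrightarrow> h v = tmin (f v) (g v)))"
begin

definition indep :: "'m set \<Rightarrow> bool" where
  "indep T \<longleftrightarrow> (\<forall>f\<in>V. tsupp f \<subseteq> T \<longrightarrow> f = tzero)"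

lemma indep_mono: "indep T \<Longrightarrow> S \<subseteq> T \<Longrightarrow> indep S"
  unfolding indep_def by blast

lemma eliminate:
  assumes f: "f \<in> V" and g: "g \<in> V" and uf: "u \<in> tsupp f" and ug: "u \<in> tsupp g"
  obtains h c where "h \<in> V" "elimination f g u c h"
proof -
  define c where "c = the (f u) - the (g u)"
  define k where "k = tscale c g"
  have k: "k \<in> V" using scale g by (simp add: k_def)
  have eq: "f u = k u" "f u \<noteq> None"
    using uf ug by (auto simp: k_def tscale_def tsupp_def c_def)
  obtain h where h: "h \<in> V" "h u = None"
    "\<And>v. tle (tmin (f v) (k v)) (h v)" "\<And>v. f v \<noteq> k v \<Longrightarrow> h v = tmin (f v) (k v)"
    using elim_ax[OF f k eq] by metis
  have kv: "k v = None \<longleftrightarrow> v \<notin> tsupp g" "v \<in> tsupp g \<Longrightarrow> k v = Some (c + the (g v))" for v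
    by (auto simp: k_def tscale_def tsupp_def)
  have fv: "f v = None \<longleftrightarrow> v \<notin> tsupp f" "v \<in> tsupp f \<Longrightarrow> f v = Some (the (f v))" for v
    by (auto simp: tsupp_def)
  have hv: "h v = None \<longleftrightarrow> v \<notin> tsupp h" "v \<in> tsupp h \<Longrightarrow> h v = Some (the (h v))" for v
    by (auto simp: tsupp_def)
  have low: "(v \<in> tsupp f \<and> the (f v) \<le> the (h v)) \<or> (v \<in> tsupp g \<and> c + the (g v) \<le> the (h v))"
    if "v \<in> tsupp h" for v
  proof -
    have le: "tle (tmin (f v) (k v)) (Some (the (h v)))" using h(3)[of v] hv(2)[OF that] by simp
    show ?thesis
      using le kv[of v] fv[of v]
      by (cases "v \<in> tsupp f"; cases "v \<in> tsupp g") (auto simp: min_def split: if_splits)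
  qed
  have left: "v \<in> tsupp h \<and> the (h v) = the (f v)"
    if "v \<in> tsupp f" "v \<in> tsupp g \<Longrightarrow> the (f v) < c + the (g v)" for v
  proof -
    have "h v = Some (the (f v))"
    proof (cases "v \<in> tsupp g")
      case True
      then have e: "f v = Some (the (f v))" "k v = Some (c + the (g v))" "the (f v) < c + the (g v)"
        using that kv fv by auto
      then have "f v \<noteq> k v" by (metis less_irrefl option.sel)
      then have "h v = tmin (Some (the (f v))) (Some (c + the (g v)))" using h(4) e by metis
      then show ?thesis using e(3) by simp
    next
      case False
      then have e: "f v = Some (the (f v))" "k v = None" using that kv fv by auto
      then have "h v = tmin (Some (the (f v))) None" using h(4) by (metis option.distinct(1))
      then show ?thesis by simp
    qed
    then show ?thesis by (simp add: tsupp_def)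
  qed
  have right: "v \<in> tsupp h \<and> the (h v) = c + the (g v)"
    if "v \<in> tsupp g" "v \<in> tsupp f \<Longrightarrow> c + the (g v) < the (f v)" for v
  proof -
    have "h v = Some (c + the (g v))"
    proof (cases "v \<in> tsupp f")
      case True
      then have e: "f v = Some (the (f v))" "k v = Some (c + the (g v))" "c + the (g v) < the (f v)"
        using that kv fv by auto
      then have "f v \<noteq> k v" by (metis less_irrefl option.sel)
      then have "h v = tmin (Some (the (f v))) (Some (c + the (g v)))" using h(4) e by metis
      then show ?thesis using e(3) by simp
    next
      case False
      then have e: "f v = None" "k v = Some (c + the (g v))" using that kv fv by auto
      then have "h v = tmin None (Some (c + the (g v)))" using h(4) by (metis option.distinct(1))
      then show ?thesis by simp
    qed
    then show ?thesis by (simp add: tsupp_def)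
  qed
  have "elimination f g u c h"
    unfolding elimination_def
  proof (intro conjI)
    show "u \<notin> tsupp h" using h(2) by (simp add: tsupp_def)
    show "tsupp h \<subseteq> tsupp f \<union> tsupp g" using low by blast
    show "the (f u) = c + the (g u)" by (simp add: c_def)
  qed (use low left right in blast)+
  then show thesis using that h(1) by blast
qed

text \<open>Once \<open>g\<close> is scaled to agree with \<open>f\<close> at \<open>u'\<close>, its
  other terms come after the term of \<open>u'\<close>, which comes after the leading term of
  \<open>f\<close>. Hence the elimination cannot disturb the lead at \<open>u\<close>.\<close>

lemma lead_eliminate:
  assumes f: "f \<in> V" and g: "g \<in> V" and lf: "lead \<theta> \<tau> f u" and lg: "lead \<theta> \<tau> g u'"
    and u': "u' \<in> tsupp f" "u' \<noteq> u"
  obtains h where "h \<in> V" "lead \<theta> \<tau> h u" "tsupp h \<subseteq> tsupp f \<union> tsupp g - {u'}"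
proof -
  have u'g: "u' \<in> tsupp g" using lg by (simp add: lead_def)
  obtain h c where hV: "h \<in> V" and hel: "elimination f g u' c h" using eliminate[OF f g u'(1) u'g] by blast
  note h = hV eliminationD[OF hel]
  have lgv: "the (g u') + \<theta> u' < the (g v) + \<theta> v \<or> the (g u') + \<theta> u' = the (g v) + \<theta> v \<and> \<tau> u' < \<tau> v"
    if "v \<in> tsupp g" "v \<noteq> u'" for v using lg that unfolding lead_def by blast
  have lfv: "the (f u) + \<theta> u < the (f v) + \<theta> v \<or> the (f u) + \<theta> u = the (f v) + \<theta> v \<and> \<tau> u < \<tau> v"
    if "v \<in> tsupp f" "v \<noteq> u" for v using lf that unfolding lead_def by blast
  have uf: "u \<in> tsupp f" using lf by (simp add: lead_def)
  have hu: "u \<in> tsupp h \<and> the (h u) = the (f u)"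
    using lgv[of u] lfv[OF u'] h(4) u'(2) by (intro h(6)[OF uf]) auto
  have "lead \<theta> \<tau> h u"
    unfolding lead_def
  proof (intro conjI ballI impI)
    show "u \<in> tsupp h" using hu by blast
    fix v assume v: "v \<in> tsupp h" "v \<noteq> u"
    have "v \<noteq> u'" using v h(2) by blast
    then show "the (h u) + \<theta> u < the (h v) + \<theta> v \<or> the (h u) + \<theta> u = the (h v) + \<theta> v \<and> \<tau> u < \<tau> v"
      using h(5)[OF v(1)] lfv[OF _ v(2)] lgv[of v] lfv[OF u'] h(4) hu by auto
  qed
  then show thesis using that h(1,2,3) by blast
qed

text \<open>Steinitz exchange: replacing an element of \<open>B - T\<close> by one of \<open>T - B\<close> keeps \<open>B\<close> spanning.\<close>

lemma card_indep_le_spanning: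
  assumes "finite B" "finite T" "indep T" "T \<subseteq> S"
    and "\<And>u. u \<in> S - B \<Longrightarrow> \<exists>f\<in>V. u \<in> tsupp f \<and> tsupp f \<subseteq> insert u B"
  shows "card T \<le> card B"
  using assms(1,5)
proof (induction "card (T - B)" arbitrary: B rule: less_induct)
  case less
  show ?case
  proof (cases "T \<subseteq> B")
    case True
    then show ?thesis using card_mono less.prems(1) by blast
  next
    case False
    then obtain t where t: "t \<in> T" "t \<notin> B" by blast
    obtain f where f: "f \<in> V" "t \<in> tsupp f" "tsupp f \<subseteq> insert t B"
      using less.prems(2)[of t] t assms(4) by blast
    have "\<not> tsupp f \<subseteq> T" using assms(3) f(1) tsupp_nonzero[OF f(2)] unfolding indep_def by blast
    then obtain b where b: "b \<in> tsupp f" "b \<notin> T" by blast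
    then have bB: "b \<in> B" "b \<noteq> t" using f(3) t by auto
    define B' where "B' = insert t (B - {b})"
    have fB': "finite B'" using less.prems(1) by (simp add: B'_def)
    have cB': "card B' = card B"
      using bB t less.prems(1) unfolding B'_def
      by (metis DiffD1 card_Suc_Diff1 card_insert_disjoint finite_Diff)
    have "T - B' \<subset> T - B" using t b by (auto simp: B'_def)
    then have "card (T - B') < card (T - B)" using assms(2) by (meson finite_Diff psubset_card_mono)
    moreover have "\<exists>g\<in>V. u \<in> tsupp g \<and> tsupp g \<subseteq> insert u B'" if u: "u \<in> S - B'" for u
    proof (cases "u = b")
      case True
      then show ?thesis using f b by (intro bexI[of _ f]) (auto simp: B'_def)
    next
      case False
      then have uB: "u \<in> S - B" "u \<noteq> t" using u by (auto simp: B'_def)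
      then obtain g where g: "g \<in> V" "u \<in> tsupp g" "tsupp g \<subseteq> insert u B"
        using less.prems(2) by blast
      show ?thesis
      proof (cases "b \<in> tsupp g")
        case False
        then show ?thesis using g by (intro bexI[of _ g]) (auto simp: B'_def)
      next
        case True
        obtain h c where hV: "h \<in> V" and hel: "elimination g f b c h" using eliminate[OF g(1) f(1) True b(1)] by blast
        note h = hV eliminationD[OF hel]
        have "u \<notin> tsupp f" using f(3) uB by auto
        then have "u \<in> tsupp h" using h(6)[OF g(2)] by blast
        moreover have "tsupp h \<subseteq> insert u B'" using h(2,3) g(3) f(3) by (auto simp: B'_def)
        ultimately show ?thesis using h(1) by blast
      qed
    qed
    ultimately have "card T \<le> card B'" using less.hyps fB' by blast
    then show ?thesis using cB' by simp
  qed
qed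

section \<open>Leading exponents and their complementary bases\<close>

definition leads :: "('m \<Rightarrow> real) \<Rightarrow> ('m \<Rightarrow> real) \<Rightarrow> 'm set \<Rightarrow> 'm set" where
  "leads \<theta> \<tau> S = {u. \<exists>f\<in>V. tsupp f \<subseteq> S \<and> lead \<theta> \<tau> f u}"

lemma leads_subset: "leads \<theta> \<tau> S \<subseteq> S"
  unfolding leads_def lead_def by blast

lemma indep_nonleads:
  assumes "inj_on \<tau> S"
  shows "indep (S - leads \<theta> \<tau> S)"
  unfolding indep_def
proof (intro ballI impI)
  fix f assume f: "f \<in> V" "tsupp f \<subseteq> S - leads \<theta> \<tau> S"
  show "f = tzero"
  proof (rule ccontr)
    assume "f \<noteq> tzero"
    then obtain u where "lead \<theta> \<tau> f u"
      using lead_exists[OF finite_supp[OF f(1)]] inj_on_subset[OF assms] f(2) by (metis Diff_subset subset_trans)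
    then have "u \<in> leads \<theta> \<tau> S" "u \<in> tsupp f" using f unfolding leads_def lead_def by blast+
    then show False using f by blast
  qed
qed

text \<open>This is the reduced form of Gaussian elimination: all leading exponents other than
  \<open>u\<close> are cleared from a vector with lead \<open>u\<close>.\<close>

lemma fundamental_lead:
  assumes S: "finite S" and u: "u \<in> leads \<theta> \<tau> S"
  obtains f where "f \<in> V" "lead \<theta> \<tau> f u" "tsupp f \<subseteq> insert u (S - leads \<theta> \<tau> S)"
proof -
  let ?L = "leads \<theta> \<tau> S"
  \<comment> \<open>The claim is made for all \<open>u\<close> at once, since the vector that
    removes \<open>k\<close> must itself be free of the exponents in \<open>K\<close> removed
    before; otherwise these would come back.\<close>
  have "\<forall>u\<in>?L. \<exists>f\<in>V. lead \<theta> \<tau> f u \<and> tsupp f \<subseteq> S \<and> tsupp f \<inter> K \<subseteq> {u}"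
    if "finite K" "K \<subseteq> ?L" for K
    using that
  proof (induction K)
    case empty
    then show ?case unfolding leads_def by auto
  next
    case (insert k K)
    then obtain g where g: "g \<in> V" "lead \<theta> \<tau> g k" "tsupp g \<subseteq> S" "tsupp g \<inter> K \<subseteq> {k}"
      by blast
    show ?case
    proof
      fix u assume "u \<in> ?L"
      then obtain f where f: "f \<in> V" "lead \<theta> \<tau> f u" "tsupp f \<subseteq> S" "tsupp f \<inter> K \<subseteq> {u}"
        using insert by blast
      show "\<exists>f\<in>V. lead \<theta> \<tau> f u \<and> tsupp f \<subseteq> S \<and> tsupp f \<inter> insert k K \<subseteq> {u}"
      proof (cases "k \<in> tsupp f \<and> k \<noteq> u")
        case True
        then obtain h where h: "h \<in> V" "lead \<theta> \<tau> h u" "tsupp h \<subseteq> tsupp f \<union> tsupp g - {k}"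
          using lead_eliminate[OF f(1) g(1) f(2) g(2)] by blast
        then show ?thesis using f g insert.hyps by (intro bexI[of _ h]) auto
      next
        case False
        then show ?thesis using f by (intro bexI[of _ f]) auto
      qed
    qed
  qed
  from this[of ?L] obtain f where "f \<in> V" "lead \<theta> \<tau> f u" "tsupp f \<subseteq> S" "tsupp f \<inter> ?L \<subseteq> {u}"
    using u S leads_subset finite_subset by (metis subset_refl)
  then show thesis by (intro that[of f]) auto
qed

text \<open>The reduced vectors show that the exponents that do not lead span \<open>S\<close>.
  Together with \<open>indep_nonleads\<close> they form a basis when \<open>\<tau>\<close> is
  injective on \<open>S\<close>.\<close>

lemma card_indep_le_nonleads:
  assumes "finite S" "indep T" "T \<subseteq> S"
  shows "card T \<le> card (S - leads \<theta> \<tau> S)"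
proof (rule card_indep_le_spanning[OF _ _ assms(2,3)])
  show "finite (S - leads \<theta> \<tau> S)" "finite T" using assms finite_subset by auto
  fix u assume "u \<in> S - (S - leads \<theta> \<tau> S)"
  then have "u \<in> leads \<theta> \<tau> S" by blast
  then obtain f where "f \<in> V" "lead \<theta> \<tau> f u" "tsupp f \<subseteq> insert u (S - leads \<theta> \<tau> S)"
    using fundamental_lead[OF assms(1)] by blast
  then show "\<exists>f\<in>V. u \<in> tsupp f \<and> tsupp f \<subseteq> insert u (S - leads \<theta> \<tau> S)"
    unfolding lead_def by blast
qed

lemma card_nonleads_eq:
  assumes "finite S" "inj_on \<tau> S" "inj_on \<tau>' S"
  shows "card (S - leads \<theta> \<tau> S) = card (S - leads \<theta>' \<tau>' S)"
  using card_indep_le_nonleads[OF assms(1) indep_nonleads[OF assms(2)]]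
    card_indep_le_nonleads[OF assms(1) indep_nonleads[OF assms(3)]]
  by (meson Diff_subset antisym)

text \<open>Loops of the initial matroid do not contribute to the rank. A unique minimum leads under
  any tie-break, so the zero one is taken. The witnesses must be supported in \<open>S\<close>,
  which later costs a boundary layer.\<close>

lemma card_indep_le_diff_umin:
  assumes S: "finite S" and T: "indep T" "T \<subseteq> S"
    and loops: "\<And>u. u \<in> S0 \<Longrightarrow> \<exists>f\<in>V. tsupp f \<subseteq> S \<and> umin \<theta> f u"
  shows "card T \<le> card (S - S0)"
proof -
  have "S0 \<subseteq> leads \<theta> (\<lambda>_. 0) S"
  proof
    fix u assume "u \<in> S0"
    then obtain f where "f \<in> V" "tsupp f \<subseteq> S" "umin \<theta> f u" using loops by metis
    then show "u \<in> leads \<theta> (\<lambda>_. 0) S" using umin_imp_lead[of \<theta> f u "\<lambda>_. 0"] by (auto simp: leads_def)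
  qed
  then have "card (S - leads \<theta> (\<lambda>_. 0) S) \<le> card (S - S0)"
    using S by (intro card_mono) auto
  then show ?thesis using card_indep_le_nonleads[OF S T] order_trans by blast
qed

section \<open>Fundamental circuits and initial forms\<close>

lemma fundamental_unique:
  assumes f: "f \<in> V" "u \<in> tsupp f" "tsupp f \<subseteq> insert u B"
    and g: "g \<in> V" "u \<in> tsupp g" "tsupp g \<subseteq> insert u B" and B: "indep B"
  obtains c where "tsupp f = tsupp g" "\<And>v. v \<in> tsupp g \<Longrightarrow> the (f v) = c + the (g v)"
proof -
  obtain h c where hV: "h \<in> V" and hel: "elimination f g u c h" using eliminate[OF f(1) g(1) f(2) g(2)] by blast
  note h = hV eliminationD[OF hel]
  \<comment> \<open>Being supported in an independent set, \<open>h\<close> is zero; but any strict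
    difference between the scaled coefficients would have survived in it.\<close>
  have "tsupp h \<subseteq> B" using h(2,3) f(3) g(3) by auto
  then have "tsupp h = {}" using B h(1) unfolding indep_def by (simp add: tsupp_empty_iff)
  then have a: "v \<in> tsupp g \<and> c + the (g v) \<le> the (f v)" if "v \<in> tsupp f" for v
    using h(6)[OF that] by (metis empty_iff not_le)
  have b: "v \<in> tsupp f \<and> the (f v) \<le> c + the (g v)" if "v \<in> tsupp g" for v
    using h(7)[OF that] \<open>tsupp h = {}\<close> by (metis empty_iff not_le)
  show thesis using a b by (intro that[of c]) (auto intro: antisym)
qed

text \<open>The inequality \<open>Fle\<close> is weak so that \<open>\<theta>\<close> may lie on the
  boundary of the Groebner cell whose basis is \<open>B\<close>.\<close>

context
  fixes B K :: "'m set" and F :: "'m \<Rightarrow> 'm tpoly" and \<theta> :: "'m \<Rightarrow> real"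
  assumes indB: "indep B" and disj: "B \<inter> K = {}"
    and F: "\<And>u. u \<in> K \<Longrightarrow> F u \<in> V \<and> u \<in> tsupp (F u) \<and> tsupp (F u) \<subseteq> insert u B"
    and Fle: "\<And>u b. \<lbrakk>u \<in> K; b \<in> tsupp (F u)\<rbrakk> \<Longrightarrow> the (F u u) + \<theta> u \<le> the (F u b) + \<theta> b"
begin

text \<open>A basis for which all fundamental circuits are weakly minimised at their own element
  stays independent in the initial matroid of the weight.\<close>

lemma no_initial_form_in_basis:
  assumes "g \<in> V" "tsupp g \<subseteq> B \<union> K" "z \<in> tsupp g"
    and "\<And>v. v \<in> tsupp g \<Longrightarrow> the (g z) + \<theta> z \<le> the (g v) + \<theta> v"
    and "\<And>v. v \<in> tsupp g \<Longrightarrow> v \<in> K \<Longrightarrow> the (g z) + \<theta> z < the (g v) + \<theta> v"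
  shows False
  using assms
proof (induction "card (tsupp g \<inter> K)" arbitrary: g rule: less_induct)
  case less
  show False
  proof (cases "tsupp g \<inter> K = {}")
    case True
    then have "tsupp g \<subseteq> B" using less.prems by blast
    then show False using indB less.prems(1) tsupp_nonzero[OF less.prems(3)] unfolding indep_def by blast
  next
    case False
    then obtain u where u: "u \<in> tsupp g" "u \<in> K" by blast
    note Fu = F[OF u(2)]
    obtain h c where hV: "h \<in> V" and hel: "elimination g (F u) u c h" using eliminate[OF less.prems(1) _ u(1), of "F u"] Fu by blast
    note h = hV eliminationD[OF hel]
    have gu: "the (g z) + \<theta> z < the (g u) + \<theta> u" using less.prems(5) u by blast
    \<comment> \<open>Scaled to agree with \<open>g\<close> at \<open>u\<close>, the circuit
      \<open>F u\<close> has its minimum at \<open>u\<close>, where \<open>g\<close> is strictly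
      above its own minimum. So all of \<open>F u\<close> lies above that minimum, and eliminating
      \<open>u\<close> leaves the terms at the minimum alone.\<close>
    have Fv: "the (g z) + \<theta> z < c + the (F u v) + \<theta> v" if "v \<in> tsupp (F u)" for v
      using Fle[OF u(2) that] gu h(4) by linarith
    have hz: "z \<in> tsupp h \<and> the (h z) = the (g z)"
      using Fv[of z] by (intro h(6)[OF less.prems(3)]) auto
    have "card (tsupp h \<inter> K) < card (tsupp g \<inter> K)"
    proof (rule psubset_card_mono)
      show "finite (tsupp g \<inter> K)" using finite_supp less.prems(1) by blast
      show "tsupp h \<inter> K \<subset> tsupp g \<inter> K" using h(2,3) Fu disj u by auto
    qed
    then show False
    proof (rule less.hyps[OF _ h(1)])
      show "tsupp h \<subseteq> B \<union> K" using h(3) less.prems(2) Fu u by auto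
      show "z \<in> tsupp h" using hz by blast
      fix v assume v: "v \<in> tsupp h"
      show "the (h z) + \<theta> z \<le> the (h v) + \<theta> v"
        using h(5)[OF v] less.prems(4)[of v] Fv[of v] hz by auto
      assume "v \<in> K"
      then show "the (h z) + \<theta> z < the (h v) + \<theta> v"
        using h(5)[OF v] less.prems(5)[of v] Fv[of v] hz by auto
    qed
  qed
qed

text \<open>A monomial initial form can be detected on fundamental circuits. If \<open>F z\<close>
  had a second minimal term \<open>b\<close>, eliminating \<open>z\<close> from \<open>g\<close>
  would discard the only minimal term of \<open>g\<close> and leave a vector whose minimal terms all
  come from \<open>F z\<close>, hence lie in \<open>B\<close>.\<close>

lemma umin_fundamental:
  assumes g: "g \<in> V" "tsupp g \<subseteq> B \<union> K" and z: "umin \<theta> g z"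
  shows "z \<in> K" "umin \<theta> (F z) z"
proof -
  have zg: "z \<in> tsupp g" "\<And>v. v \<in> tsupp g \<Longrightarrow> v \<noteq> z \<Longrightarrow> the (g z) + \<theta> z < the (g v) + \<theta> v"
    using z unfolding umin_def by blast+
  show zK: "z \<in> K"
  proof (rule ccontr)
    assume "z \<notin> K"
    then show False using no_initial_form_in_basis[OF g zg(1)] zg(2) by (metis less_imp_le order_refl)
  qed
  note Fz = F[OF zK]
  show "umin \<theta> (F z) z"
  proof (rule ccontr)
    assume "\<not> umin \<theta> (F z) z"
    then obtain b where b: "b \<in> tsupp (F z)" "b \<noteq> z" "the (F z b) + \<theta> b \<le> the (F z z) + \<theta> z"
      using Fz unfolding umin_def by (auto simp: not_less)
    then have beq: "the (F z b) + \<theta> b = the (F z z) + \<theta> z" using Fle[OF zK b(1)] by linarith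
    obtain h c where hV: "h \<in> V" and hel: "elimination g (F z) z c h" using eliminate[OF g(1) _ zg(1), of "F z"] Fz by blast
    note h = hV eliminationD[OF hel]
    have hb: "b \<in> tsupp h \<and> the (h b) = c + the (F z b)"
      using zg(2)[of b] b(2) beq h(4) by (intro h(7)[OF b(1)]) auto
    show False
    proof (rule no_initial_form_in_basis[OF h(1)])
      show "tsupp h \<subseteq> B \<union> K" using h(3) g(2) Fz zK by auto
      show "b \<in> tsupp h" using hb by blast
      fix v assume v: "v \<in> tsupp h"
      then have vz: "v \<noteq> z" using h(2) by blast
      show "the (h b) + \<theta> b \<le> the (h v) + \<theta> v"
        using h(5)[OF v] zg(2)[OF _ vz] Fle[OF zK, of v] hb beq h(4) by auto
      assume vK: "v \<in> K"
      then have "v \<notin> tsupp (F z)" using Fz vz disj by auto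
      then show "the (h b) + \<theta> b < the (h v) + \<theta> v"
        using h(5)[OF v] zg(2)[OF _ vz] hb beq h(4) by auto
    qed
  qed
qed

end

end

section \<open>Tropical ideals of Laurent polynomials\<close>

definition tshift :: "'m::ab_group_add \<Rightarrow> 'm tpoly \<Rightarrow> 'm tpoly" where
  "tshift v f = (\<lambda>u. f (u - v))"

lemma mem_tsupp_tshift: "u \<in> tsupp (tshift v f) \<longleftrightarrow> u - v \<in> tsupp f"
  by (simp add: tsupp_def tshift_def)

lemma tsupp_tshift: "tsupp (tshift v f) = (\<lambda>u. u + v) ` tsupp f"
  by (auto simp: mem_tsupp_tshift image_iff) (metis diff_add_cancel)

lemma tmult_monomial:
  fixes v :: "'m::ab_group_add"
  shows "tmult (\<lambda>x. if x = v then Some c else None) f = tscale c (tshift v f)"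
proof
  fix u
  let ?p = "\<lambda>x. if x = v then Some c else None"
  have S: "{(a, b). a \<in> tsupp ?p \<and> b \<in> tsupp f \<and> a + b = u} = (if u - v \<in> tsupp f then {(v, u - v)} else {})"
    by (auto simp: tsupp_def split: if_splits)
  show "tmult ?p f u = tscale c (tshift v f) u"
    unfolding tmult_def S by (auto simp: Let_def tscale_def tshift_def tsupp_def)
qed

lemma finite_real_min:
  fixes \<phi> :: "'a \<Rightarrow> real"
  assumes "finite S" "S \<noteq> {}"
  obtains z where "z \<in> S" "\<And>v. v \<in> S \<Longrightarrow> \<phi> z \<le> \<phi> v"
proof -
  have "Min (\<phi> ` S) \<in> \<phi> ` S" using assms by simp
  then obtain z where "z \<in> S" "\<phi> z = Min (\<phi> ` S)" by auto
  then show thesis using that[of z] assms by simp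
qed

definition rvec :: "int ^ 'n \<Rightarrow> real ^ 'n" where
  "rvec u = (\<chi> i. real_of_int (u $ i))"

lemma expdot_inner: "expdot u w = rvec u \<bullet> w"
  by (simp add: expdot_def rvec_def inner_vec_def)

lemma rvec_add: "rvec (u + v) = rvec u + rvec v"
  and rvec_diff: "rvec (u - v) = rvec u - rvec v"
  and rvec_0 [simp]: "rvec 0 = 0"
  and rvec_eq_0_iff [simp]: "rvec u = 0 \<longleftrightarrow> u = 0"
  by (simp_all add: rvec_def vec_eq_iff)

lemma expdot_add: "expdot (u + v) w = expdot u w + expdot v w"
  and expdot_diff: "expdot (u - v) w = expdot u w - expdot v w"
  and expdot_0 [simp]: "expdot 0 w = 0"
  by (simp_all add: expdot_inner rvec_add rvec_diff inner_simps)

lemma total_deg_add: "total_deg (u + v) = total_deg u + total_deg v"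
  and total_deg_diff: "total_deg (u - v) = total_deg u - total_deg v"
  and total_deg_0 [simp]: "total_deg 0 = 0"
  by (simp_all add: total_deg_def sum.distrib sum_subtractf)

text \<open>The monomials of degree \<open>e\<close> in \<open>x\<^sub>0, \<dots>, x\<^sub>n\<close>, with the exponent of \<open>x\<^sub>0\<close> omitted.\<close>

definition exps_le :: "nat \<Rightarrow> (int ^ 'n) set" where
  "exps_le e = {u. (\<forall>i. 0 \<le> u $ i) \<and> total_deg u \<le> int e}"

lemma exps_le_component:
  assumes "u \<in> exps_le e"
  shows "0 \<le> u $ i" "u $ i \<le> int e"
proof -
  have "u $ i \<le> total_deg u"
    using assms unfolding total_deg_def exps_le_def by (intro member_le_sum) auto
  then show "0 \<le> u $ i" "u $ i \<le> int e" using assms by (auto simp: exps_le_def)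
qed

lemma bij_betw_vec_nth_PiE:
  "bij_betw vec_nth {u :: 'a ^ 'n. \<forall>i. u $ i \<in> F i} (PiE UNIV F)"
  by (rule bij_betwI[where g = vec_lambda]) (auto simp: PiE_def)

lemma card_vec_box: "card {u :: 'a ^ 'n. \<forall>i. u $ i \<in> F i} = (\<Prod>i\<in>UNIV. card (F i))"
  using bij_betw_same_card[OF bij_betw_vec_nth_PiE[of F]] by (simp add: card_PiE)

lemma finite_vec_box:
  assumes "\<And>i. finite (F i)"
  shows "finite {u :: 'a ^ 'n. \<forall>i. u $ i \<in> F i}"
  using bij_betw_finite[OF bij_betw_vec_nth_PiE[of F]] assms by (simp add: finite_PiE)

lemma finite_exps_le [simp]: "finite (exps_le e)"
proof (rule finite_subset)
  show "exps_le e \<subseteq> {u. \<forall>i. u $ i \<in> {0..int e}}" using exps_le_component by fastforce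
qed (rule finite_vec_box, simp)

lemma exps_le_add: "u \<in> exps_le e \<Longrightarrow> v \<in> exps_le k \<Longrightarrow> u + v \<in> exps_le (e + k)"
  by (auto simp: exps_le_def total_deg_add)

lemma zero_in_exps_le [simp]: "0 \<in> exps_le e"
  by (simp add: exps_le_def)

lemma exps_le_mono: "e \<le> e' \<Longrightarrow> exps_le e \<subseteq> exps_le e'"
  by (auto simp: exps_le_def)

lemma shift_into_exps_le:
  assumes "finite S"
  obtains v e where "(\<lambda>u. u + v) ` S \<subseteq> exps_le e"
proof -
  define b where "b = (\<Sum>u\<in>S. \<Sum>i\<in>UNIV. \<bar>u $ i\<bar>)"
  have b: "\<bar>u $ i\<bar> \<le> b" if "u \<in> S" for u i
  proof -
    have "\<bar>u $ i\<bar> \<le> (\<Sum>i\<in>UNIV. \<bar>u $ i\<bar>)" by (rule member_le_sum) auto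
    also have "\<dots> \<le> b" unfolding b_def using assms that by (intro member_le_sum) (auto intro: sum_nonneg)
    finally show ?thesis .
  qed
  define v :: "int ^ 'a" where "v = (\<chi> i. b)"
  have "(\<lambda>u. u + v) ` S \<subseteq> exps_le (nat (Max (insert 0 ((\<lambda>u. total_deg (u + v)) ` S))))"
  proof
    fix x assume "x \<in> (\<lambda>u. u + v) ` S"
    then obtain u where u: "u \<in> S" "x = u + v" by blast
    have "total_deg (u + v) \<le> Max (insert 0 ((\<lambda>u. total_deg (u + v)) ` S))"
      using u assms by (intro Max_ge) auto
    moreover have "0 \<le> (u + v) $ i" for i using b[OF u(1), of i] by (simp add: v_def)
    ultimately show "x \<in> exps_le (nat (Max (insert 0 ((\<lambda>u. total_deg (u + v)) ` S))))"
      by (simp add: exps_le_def u(2))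
  qed
  then show thesis by (rule that)
qed

text \<open>Countably many hyperplanes do not cover the space. The functional gives a tie-break that
  is injective and compatible with translation.\<close>

lemma generic_functional:
  obtains v :: "real ^ 'n" where "\<And>u :: int ^ 'n. u \<noteq> 0 \<Longrightarrow> expdot u v \<noteq> 0"
proof -
  have "negligible (\<Union>u\<in>UNIV - {0 :: int ^ 'n}. {w. expdot u w = 0})"
    unfolding expdot_inner
    by (intro negligible_countable_Union) (auto intro!: negligible_hyperplane)
  then have "(\<Union>u\<in>UNIV - {0 :: int ^ 'n}. {w. expdot u w = 0}) \<noteq> UNIV"
    using non_negligible_UNIV by metis
  then show thesis using that by blast
qed

lemma injective_functional:
  obtains v :: "real ^ 'n" where "inj (\<lambda>u :: int ^ 'n. expdot u v)"
proof -
  obtain v :: "real ^ 'n" where v: "\<And>u :: int ^ 'n. u \<noteq> 0 \<Longrightarrow> expdot u v \<noteq> 0"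
    by (rule generic_functional) blast
  have "inj (\<lambda>u :: int ^ 'n. expdot u v)"
  proof (rule injI)
    fix u u' :: "int ^ 'n" assume "expdot u v = expdot u' v"
    then have "expdot (u - u') v = 0" by (simp add: expdot_diff)
    then show "u = u'" using v[of "u - u'"] by force
  qed
  then show thesis by (rule that)
qed

locale laurent_ideal =
  fixes I :: "(int ^ 'n) tpoly set"
  assumes tropical: "tropical_ideal laurent_exps I"
begin

lemma semiring: "semiring_ideal UNIV I"
  using tropical by (simp add: tropical_ideal_def)

lemma scale_shift: "f \<in> I \<Longrightarrow> tscale c (tshift v f) \<in> I"
proof -
  assume f: "f \<in> I"
  let ?p = "\<lambda>x. if x = v then Some c else None"
  have "tsupp ?p \<subseteq> {v}" by (auto simp: tsupp_def)
  then have "?p \<in> tpolys UNIV" by (auto simp: tpolys_def finite_subset)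
  then show ?thesis using semiring f tmult_monomial[of v c f] unfolding semiring_ideal_def by metis
qed

lemma shift: "f \<in> I \<Longrightarrow> tshift v f \<in> I"
proof -
  assume "f \<in> I"
  moreover have "tscale 0 g = g" for g :: "(int ^ 'n) tpoly"
    unfolding tscale_def by (rule ext) (metis add_0 option.map_ident option.map_cong0)
  ultimately show ?thesis using scale_shift[of f 0 v] by metis
qed

sublocale trop_lin I
proof
  show "finite (tsupp f)" if "f \<in> I" for f
    using that semiring by (auto simp: semiring_ideal_def tpolys_def)
  show "tscale c f \<in> I" if "f \<in> I" for f c
    using scale_shift[OF that, of c 0] by (simp add: tshift_def)
  show "\<exists>h\<in>I. h u = None \<and> (\<forall>v. tle (tmin (f v) (g v)) (h v) \<and> (f v \<noteq> g v \<longrightarrow> h v = tmin (f v) (g v)))"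
    if "f \<in> I" "g \<in> I" "f u = g u" "f u \<noteq> None" for f g u
    using tropical that unfolding tropical_ideal_def by blast
qed

lemma umin_tshift:
  assumes "umin (\<lambda>u. expdot u w) f z"
  shows "umin (\<lambda>u. expdot u w) (tshift v f) (z + v)"
  using assms unfolding umin_def tsupp_tshift by (auto simp: tshift_def expdot_add)

lemma lead_tshift:
  assumes "lead (\<lambda>u. expdot u w) (\<lambda>u. expdot u v0) f z"
  shows "lead (\<lambda>u. expdot u w) (\<lambda>u. expdot u v0) (tshift v f) (z + v)"
  using assms unfolding lead_def tsupp_tshift by (auto simp: tshift_def expdot_add)

lemma not_trop_variety:
  assumes "w \<notin> trop_variety I"
  obtains f z where "f \<in> I" "umin (\<lambda>u. expdot u w) f z"
proof -
  obtain f where f: "f \<in> I" "f \<noteq> tzero" "\<not> min_attained_twice f w"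
    using assms by (auto simp: trop_variety_def)
  have ne: "tsupp f \<noteq> {}" using f(2) by (simp add: tsupp_empty_iff)
  obtain z where z: "z \<in> tsupp f" "\<And>v. v \<in> tsupp f \<Longrightarrow> the (f z) + expdot z w \<le> the (f v) + expdot v w"
    using finite_real_min[OF finite_supp[OF f(1)] ne, of "\<lambda>v. the (f v) + expdot v w"] by metis
  have "umin (\<lambda>u. expdot u w) f z"
    unfolding umin_def
  proof (intro conjI ballI impI)
    fix v assume v: "v \<in> tsupp f" "v \<noteq> z"
    show "the (f z) + expdot z w < the (f v) + expdot v w"
    proof (rule ccontr)
      assume "\<not> ?thesis"
      then have "the (f z) + expdot z w = the (f v) + expdot v w" using z(2)[OF v(1)] by linarith
      then have "min_attained_twice f w" unfolding min_attained_twice_def using v z by metis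
      then show False using f(3) by blast
    qed
  qed (rule z(1))
  then show thesis using that f(1) by blast
qed

lemma trop_variety_no_umin:
  assumes "w \<in> trop_variety I" "f \<in> I"
  shows "\<not> umin (\<lambda>u. expdot u w) f z"
proof
  assume z: "umin (\<lambda>u. expdot u w) f z"
  then have zf: "z \<in> tsupp f" by (simp add: umin_def)
  then have "f \<noteq> tzero" by (rule tsupp_nonzero)
  then have "min_attained_twice f w" using assms by (auto simp: trop_variety_def)
  then obtain u v where uv: "u \<noteq> v" "u \<in> tsupp f" "v \<in> tsupp f"
    "the (f u) + expdot u w = the (f v) + expdot v w"
    "\<forall>z\<in>tsupp f. the (f u) + expdot u w \<le> the (f z) + expdot z w"
    unfolding min_attained_twice_def by blast
  have "the (f u) + expdot u w \<le> the (f z) + expdot z w" using uv(5) zf by blast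
  moreover have "the (f z) + expdot z w < the (f u) + expdot u w \<or> the (f z) + expdot z w < the (f v) + expdot v w"
    using z uv unfolding umin_def by metis
  ultimately show False using uv(4) by linarith
qed

end

section \<open>Uniform stabilisation of leading exponents\<close>

lemma nat_seq_incseq_subseq:
  fixes s :: "nat \<Rightarrow> nat"
  obtains r :: "nat \<Rightarrow> nat" where "strict_mono r" "\<And>i j. i \<le> j \<Longrightarrow> s (r i) \<le> s (r j)"
proof -
  have least: "\<exists>y>x. \<forall>j\<ge>y. s y \<le> s j" for x
  proof -
    obtain y where "y > x" "\<And>j. j > x \<Longrightarrow> s y \<le> s j"
      using ex_has_least_nat[of "\<lambda>j. j > x" "Suc x" s] by blast
    then show ?thesis by (intro exI[of _ y]) auto
  qed
  obtain r where r: "\<And>n. \<forall>j\<ge>r n. s (r n) \<le> s j" "\<And>n. r n < r (Suc n)"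
    using dependent_nat_choice[of "\<lambda>_ x. \<forall>j\<ge>x. s x \<le> s j" "\<lambda>_ x y. x < y"] least by metis
  have mono: "strict_mono r" using r(2) by (simp add: strict_mono_Suc_iff)
  have "s (r i) \<le> s (r j)" if "i \<le> j" for i j
    using r(1)[of i] strict_mono_less_eq[OF mono] that by blast
  with mono show thesis by (rule that)
qed

text \<open>Dickson's lemma in terms of subsequences, so that the coordinates can be made monotone
  one after another.\<close>

lemma dickson_subseq:
  fixes x :: "nat \<Rightarrow> 'k \<Rightarrow> nat"
  assumes "finite K"
  shows "\<exists>r :: nat \<Rightarrow> nat. strict_mono r \<and> (\<forall>k\<in>K. \<forall>i j. i \<le> j \<longrightarrow> x (r i) k \<le> x (r j) k)"
  using assms
proof (induction K)
  case empty
  then show ?case by (intro exI[of _ id]) (auto simp: strict_mono_def)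
next
  case (insert k K)
  then obtain r :: "nat \<Rightarrow> nat" where r: "strict_mono r" "\<forall>k\<in>K. \<forall>i j. i \<le> j \<longrightarrow> x (r i) k \<le> x (r j) k" by blast
  obtain q :: "nat \<Rightarrow> nat" where q: "strict_mono q" "\<And>i j. i \<le> j \<Longrightarrow> x (r (q i)) k \<le> x (r (q j)) k"
    using nat_seq_incseq_subseq[of "\<lambda>i. x (r i) k"] by blast
  have "strict_mono (r \<circ> q)" using r(1) q(1) by (simp add: strict_mono_def)
  moreover have "\<forall>l\<in>insert k K. \<forall>i j. i \<le> j \<longrightarrow> x ((r \<circ> q) i) l \<le> x ((r \<circ> q) j) l"
    using r(2) q strict_mono_less_eq[OF q(1)] by simp
  ultimately show ?case by blast
qed

text \<open>\<open>Y\<close> is an accumulation point of the sequence \<open>X\<close> in a product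
  of finite discrete spaces, found by a diagonal choice of nested infinite index sets.\<close>

lemma koenig_limit:
  fixes X :: "nat \<Rightarrow> nat \<Rightarrow> 'a"
  assumes "\<And>e. finite (range (\<lambda>D. X D e))"
  obtains Y where "\<And>E. infinite {D. \<forall>e\<le>E. X D e = Y e}"
proof -
  have refine: "\<exists>M'\<subseteq>M. infinite M' \<and> (\<exists>y. \<forall>D\<in>M'. X D e = y)" if M: "infinite M" for M e
  proof -
    have "finite ((\<lambda>D. X D e) ` M)" using assms[of e] by (rule finite_subset[rotated]) auto
    then obtain D0 where "infinite {D \<in> M. X D e = X D0 e}"
      using pigeonhole_infinite[OF M] by blast
    then show ?thesis by (intro exI[of _ "{D \<in> M. X D e = X D0 e}"]) auto
  qed
  obtain M where M: "\<And>n. infinite (M n) \<and> (\<exists>y. \<forall>D\<in>M n. X D n = y)" "\<And>n. M (Suc n) \<subseteq> M n"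
  proof (rule exE[OF dependent_nat_choice[of "\<lambda>n M. infinite M \<and> (\<exists>y. \<forall>D\<in>M. X D n = y)" "\<lambda>_ M M'. M' \<subseteq> M"]])
    show "\<exists>M. infinite M \<and> (\<exists>y. \<forall>D\<in>M. X D 0 = y)" using refine[of UNIV 0] by auto
    show "\<exists>M'. (infinite M' \<and> (\<exists>y. \<forall>D\<in>M'. X D (Suc n) = y)) \<and> M' \<subseteq> M"
      if "infinite M \<and> (\<exists>y. \<forall>D\<in>M. X D n = y)" for M n
      using refine[of M "Suc n"] that by blast
  qed blast
  have dec: "M n \<subseteq> M m" if "m \<le> n" for m n
    using that by (induction rule: dec_induct) (use M(2) in blast)+
  obtain Y where Y: "\<And>n D. D \<in> M n \<Longrightarrow> X D n = Y n" using M(1) by metis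
  have sub: "M E \<subseteq> {D. \<forall>e\<le>E. X D e = Y e}" for E
  proof
    fix D assume "D \<in> M E"
    then have "X D e = Y e" if "e \<le> E" for e using dec[OF that] Y[of D e] by blast
    then show "D \<in> {D. \<forall>e\<le>E. X D e = Y e}" by simp
  qed
  have "infinite {D. \<forall>e\<le>E. X D e = Y e}" for E
    by (rule infinite_super[OF sub]) (use M(1) in simp)
  then show thesis by (rule that)
qed

text \<open>\<open>G e\<close> stands for the degree \<open>e\<close> part of a monomial ideal in \<open>x\<^sub>0, \<dots>, x\<^sub>n\<close>.\<close>

definition graded_upset :: "(nat \<Rightarrow> (int ^ 'n) set) \<Rightarrow> bool" where
  "graded_upset G \<longleftrightarrow> (\<forall>e. G e \<subseteq> exps_le e) \<and>
     (\<forall>e k u s. u \<in> G e \<longrightarrow> s \<in> exps_le k \<longrightarrow> u + s \<in> G (e + k))"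

text \<open>Multiplication by one variable: the elements of \<open>exps_le 1\<close> are the unit
  vectors and \<open>0\<close>, the latter standing for \<open>x_0\<close>.\<close>

definition upset_step :: "(int ^ 'n) set \<Rightarrow> (int ^ 'n) set" where
  "upset_step X = {u + s | u s. u \<in> X \<and> s \<in> exps_le 1}"

lemma graded_upset_add: "graded_upset G \<Longrightarrow> u \<in> G e \<Longrightarrow> s \<in> exps_le k \<Longrightarrow> u + s \<in> G (e + k)"
  by (simp add: graded_upset_def)

lemma upset_step_subset: "graded_upset G \<Longrightarrow> upset_step (G e) \<subseteq> G (Suc e)"
  unfolding upset_step_def using graded_upset_add[of G _ e _ 1] by auto

lemma total_deg_axis: "total_deg (axis i 1 :: int ^ 'n) = 1"
  by (simp add: total_deg_def axis_def)

lemma exps_le_Suc_split: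
  assumes "s \<in> exps_le (Suc k)"
  obtains s' t where "s' \<in> exps_le k" "t \<in> exps_le 1" "s = s' + t"
proof (cases "s = 0")
  case True
  then show ?thesis using that[of 0 0] by simp
next
  case False
  then obtain i where "s $ i \<noteq> 0" by (auto simp: vec_eq_iff)
  moreover have "0 \<le> s $ i" using assms exps_le_component by blast
  ultimately have i: "1 \<le> s $ i" by simp
  have "0 \<le> (s - axis i 1) $ j" for j
    using exps_le_component(1)[OF assms, of j] i by (auto simp: axis_def)
  then have "s - axis i 1 \<in> exps_le k"
    using assms by (simp add: exps_le_def total_deg_diff total_deg_axis)
  moreover have "axis i 1 \<in> exps_le 1" using total_deg_axis[of i] by (auto simp: exps_le_def) (simp add: axis_def)
  ultimately show ?thesis using that[of "s - axis i 1" "axis i 1"] by simp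
qed

text \<open>A degree in which stability fails contributes a new minimal generator. Among infinitely
  many generators one would divide a later one, which then would not be minimal.\<close>

lemma graded_upset_stable:
  fixes G :: "nat \<Rightarrow> (int ^ 'n) set"
  assumes G: "graded_upset G"
  shows "\<exists>D. \<forall>e\<ge>D. G (Suc e) = upset_step (G e)"
proof (rule ccontr)
  assume neg: "\<not> ?thesis"
  define M where "M = {e. G (Suc e) \<noteq> upset_step (G e)}"
  have M: "infinite M" using neg unfolding M_def infinite_nat_iff_unbounded_le by blast
  have "\<forall>e\<in>M. \<exists>u. u \<in> G (Suc e) \<and> u \<notin> upset_step (G e)"
    using upset_step_subset[OF G] unfolding M_def by blast
  then obtain u where u: "\<And>e. e \<in> M \<Longrightarrow> u e \<in> G (Suc e) \<and> u e \<notin> upset_step (G e)" by metis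
  define \<epsilon> where "\<epsilon> = enumerate M"
  have \<epsilon>: "strict_mono \<epsilon>" "\<And>i. \<epsilon> i \<in> M"
    unfolding \<epsilon>_def using M by (simp_all add: strict_mono_enumerate enumerate_in_set)
  \<comment> \<open>The coordinate \<open>None\<close> holds the omitted exponent of
    \<open>x_0\<close>, so that comparing these families is divisibility in all \<open>n + 1\<close>
    variables.\<close>
  define x :: "nat \<Rightarrow> 'n option \<Rightarrow> nat" where
    "x i k = (case k of None \<Rightarrow> nat (int (Suc (\<epsilon> i)) - total_deg (u (\<epsilon> i))) | Some j \<Rightarrow> nat (u (\<epsilon> i) $ j))" for i k
  obtain r :: "nat \<Rightarrow> nat" where r: "strict_mono r" "\<forall>k\<in>UNIV. \<forall>i j. i \<le> j \<longrightarrow> x (r i) k \<le> x (r j) k"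
    using dickson_subseq[of "UNIV :: 'n option set" x] by auto
  define a b where "a = \<epsilon> (r 0)" and "b = \<epsilon> (r 1)"
  have ab: "a < b" using r(1) \<epsilon>(1) by (simp add: a_def b_def strict_mono_def)
  have aM: "a \<in> M" "b \<in> M" using \<epsilon>(2) by (auto simp: a_def b_def)
  have ua: "u a \<in> exps_le (Suc a)" "u b \<in> exps_le (Suc b)" using u aM G unfolding graded_upset_def by blast+
  have comp: "u a $ j \<le> u b $ j" for j
    using r(2)[rule_format, of "Some j" 0 1] exps_le_component(1)[OF ua(2), of j] by (auto simp: x_def a_def b_def)
  have deg: "int (Suc a) - total_deg (u a) \<le> int (Suc b) - total_deg (u b)"
    using r(2)[rule_format, of None 0 1] ua by (auto simp: x_def a_def b_def exps_le_def)
  \<comment> \<open>The quotient has degree at least one, so a variable can be split off; the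
    remaining factor carries \<open>u a\<close> into \<open>G b\<close>.\<close>
  have "u b - u a \<in> exps_le (Suc (b - a - 1))"
    using comp deg ab by (auto simp: exps_le_def total_deg_diff)
  then obtain s t where st: "s \<in> exps_le (b - a - 1)" "t \<in> exps_le 1" "u b - u a = s + t"
    by (rule exps_le_Suc_split)
  have "u a + s \<in> G (Suc a + (b - a - 1))" using graded_upset_add[OF G] u[OF aM(1)] st(1) by blast
  then have "u a + s \<in> G b" using ab by simp
  moreover have "u b = u a + s + t" using st(3) by (simp add: algebra_simps)
  ultimately have "u b \<in> upset_step (G b)" using st(2) unfolding upset_step_def by blast
  then show False using u[OF aM(2)] by blast
qed

text \<open>Suppose members \<open>X D\<close> of the family fail to be stable beyond every
  \<open>D\<close>. A limit \<open>Y\<close> is stable from some \<open>D0\<close> on. A member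
  agreeing with \<open>Y\<close> up to \<open>D0\<close> contains \<open>Y\<close> in all later
  degrees, and the common cardinalities force equality, so it is stable from \<open>D0\<close> on as
  well, against its choice.\<close>

lemma graded_upset_uniformly_stable:
  fixes \<G> :: "(nat \<Rightarrow> (int ^ 'n) set) set"
  assumes G: "\<And>G. G \<in> \<G> \<Longrightarrow> graded_upset G" and c: "\<And>G e. G \<in> \<G> \<Longrightarrow> card (G e) = c e"
  obtains D where "\<And>G e. G \<in> \<G> \<Longrightarrow> D \<le> e \<Longrightarrow> G (Suc e) = upset_step (G e)"
proof (rule ccontr)
  assume "\<not> thesis"
  then have "\<forall>D. \<exists>G. G \<in> \<G> \<and> (\<exists>e\<ge>D. G (Suc e) \<noteq> upset_step (G e))" using that by metis
  then obtain X where X: "\<And>D. X D \<in> \<G>" "\<And>D. \<exists>e\<ge>D. X D (Suc e) \<noteq> upset_step (X D e)" by metis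
  have sub: "X D e \<subseteq> exps_le e" for D e using G[OF X(1)] by (simp add: graded_upset_def)
  have "finite (range (\<lambda>D. X D e))" for e
    by (rule finite_subset[of _ "Pow (exps_le e)"]) (use sub in auto)
  then obtain Y where Y: "\<And>E. infinite {D. \<forall>e\<le>E. X D e = Y e}" using koenig_limit[of X] by blast
  have agree: "\<exists>D\<ge>N. \<forall>e\<le>E. X D e = Y e" for E N
    using Y[of E] unfolding infinite_nat_iff_unbounded_le by blast
  have "graded_upset Y"
    unfolding graded_upset_def
  proof (intro conjI allI impI)
    show "Y e \<subseteq> exps_le e" for e using agree[of 0 e] sub by (metis order_refl)
    fix e k u and s :: "int ^ 'n" assume "u \<in> Y e" "s \<in> exps_le k"
    moreover obtain D where "\<forall>i\<le>e + k. X D i = Y i" using agree by blast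
    ultimately show "u + s \<in> Y (e + k)"
      using graded_upset_add[OF G[OF X(1)[of D]], of u e s k] by simp
  qed
  then obtain D0 where D0: "\<And>e. D0 \<le> e \<Longrightarrow> Y (Suc e) = upset_step (Y e)"
    using graded_upset_stable by blast
  obtain D where D: "D0 \<le> D" "\<forall>e\<le>D0. X D e = Y e" using agree by blast
  have eq: "X D e = Y e" if "D0 \<le> e" for e
    using that
  proof (induction rule: dec_induct)
    case base
    then show ?case using D(2) by simp
  next
    case (step e)
    have "Y (Suc e) \<subseteq> X D (Suc e)"
      using D0[OF step(1)] step.IH upset_step_subset[OF G[OF X(1)], of D e] by simp
    \<comment> \<open>In each single degree \<open>Y\<close> coincides with some member of the
      family, so it has the prescribed size too.\<close>
    moreover have "card (Y (Suc e)) = card (X D (Suc e))"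
      using agree[of 0 "Suc e"] c[OF X(1)] by (metis order_refl)
    moreover have "finite (X D (Suc e))" by (rule finite_subset[OF sub finite_exps_le])
    ultimately show ?case using card_subset_eq[of "X D (Suc e)" "Y (Suc e)"] by simp
  qed
  obtain e where "D \<le> e" "X D (Suc e) \<noteq> upset_step (X D e)" using X(2) by blast
  then show False using eq[of e] eq[of "Suc e"] D0[of e] D(1) by simp
qed

context laurent_ideal
begin

abbreviation init_exps :: "real ^ 'n \<Rightarrow> real ^ 'n \<Rightarrow> nat \<Rightarrow> (int ^ 'n) set" where
  "init_exps v w e \<equiv> leads (\<lambda>u. expdot u w) (\<lambda>u. expdot u v) (exps_le e)"

lemma graded_upset_init_exps: "graded_upset (init_exps v w)"
  unfolding graded_upset_def
proof (intro conjI allI impI)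
  show "init_exps v w e \<subseteq> exps_le e" for e by (rule leads_subset)
  fix e k u and s :: "int ^ 'n" assume u: "u \<in> init_exps v w e" and s: "s \<in> exps_le k"
  then obtain f where f: "f \<in> I" "tsupp f \<subseteq> exps_le e" "lead (\<lambda>u. expdot u w) (\<lambda>u. expdot u v) f u"
    unfolding leads_def by blast
  have "tsupp (tshift s f) \<subseteq> exps_le (e + k)" using f(2) s by (auto simp: tsupp_tshift intro!: exps_le_add)
  then show "u + s \<in> init_exps v w (e + k)"
    unfolding leads_def using lead_tshift[OF f(3)] shift[OF f(1)] by blast
qed

lemma card_init_exps_eq:
  assumes "inj (\<lambda>u :: int ^ 'n. expdot u v)"
  shows "card (init_exps v w e) = card (init_exps v w' e)"
proof -
  have inj: "inj_on (\<lambda>u. expdot u v) (exps_le e)" using assms inj_on_subset by blast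
  have "card (exps_le e - init_exps v w e) = card (exps_le e - init_exps v w' e)"
    by (rule card_nonleads_eq[OF finite_exps_le inj inj])
  moreover have "card (exps_le e :: (int ^ 'n) set) = card (init_exps v x e) + card (exps_le e - init_exps v x e)" for x
  proof -
    have "init_exps v x e \<inter> (exps_le e - init_exps v x e) = {}"
      "init_exps v x e \<union> (exps_le e - init_exps v x e) = exps_le e"
      using leads_subset[of "\<lambda>u. expdot u x" "\<lambda>u. expdot u v" "exps_le e"] by auto
    then show ?thesis
      using card_Un_disjoint[of "init_exps v x e" "exps_le e - init_exps v x e"]
        finite_subset[OF leads_subset finite_exps_le] by simp
  qed
  ultimately show ?thesis by (metis add_right_cancel)
qed

text \<open>The bound holds for all weights at once. There are only finitely many sets of exponents
  in degree \<open>D\<close>, hence only finitely many families of initial exponents from there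
  on.\<close>

lemma init_exps_determined:
  assumes "inj (\<lambda>u :: int ^ 'n. expdot u v)"
  obtains D where "\<And>w w' e. init_exps v w D = init_exps v w' D \<Longrightarrow> D \<le> e \<Longrightarrow> init_exps v w e = init_exps v w' e"
proof -
  obtain D where D: "\<And>G e. G \<in> range (init_exps v) \<Longrightarrow> D \<le> e \<Longrightarrow> G (Suc e) = upset_step (G e)"
  proof (rule graded_upset_uniformly_stable[of "range (init_exps v)" "\<lambda>e. card (init_exps v 0 e)"])
    show "graded_upset G" if "G \<in> range (init_exps v)" for G using that graded_upset_init_exps by auto
    show "card (G e) = card (init_exps v 0 e)" if "G \<in> range (init_exps v)" for G e
      using that card_init_exps_eq[OF assms] by auto
  qed blast
  show thesis
  proof (rule that[of D])
    fix w w' e assume eq: "init_exps v w D = init_exps v w' D" and "D \<le> e"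
    from this(2) show "init_exps v w e = init_exps v w' e"
    proof (induction rule: dec_induct)
      case base
      show ?case by (rule eq)
    next
      case (step e)
      show ?case using D[OF rangeI step(1), of w] D[OF rangeI step(1), of w'] step.IH by simp
    qed
  qed
qed

end

section \<open>Polyhedral complexes from hyperplane arrangements\<close>

definition aval :: "'a::euclidean_space \<times> real \<Rightarrow> 'a \<Rightarrow> real" where
  "aval a w = fst a \<bullet> w + snd a"

lemma aval_combine: "aval a (s *\<^sub>R x + t *\<^sub>R y) = s * aval a x + t * aval a y" if "s + t = 1"
proof -
  have "snd a = s * snd a + t * snd a" using that by (metis distrib_right mult_1)
  then show ?thesis unfolding aval_def inner_add_right inner_scaleR_right
    by (simp only: distrib_left)
qed

text \<open>The closed cell having \<open>w\<close> in its relative interior; forms that vanish at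
  \<open>w\<close> vanish on it. Cells are indexed by points because every face is then the cell of
  one of its own relative interior points.\<close>

definition arr_cell :: "('a::euclidean_space \<times> real) set \<Rightarrow> 'a \<Rightarrow> 'a set" where
  "arr_cell H w = {x. \<forall>a\<in>H. (0 \<le> aval a w \<longrightarrow> 0 \<le> aval a x) \<and> (aval a w \<le> 0 \<longrightarrow> aval a x \<le> 0)}"

lemma arr_cellD:
  assumes "x \<in> arr_cell H w" "a \<in> H"
  shows "0 \<le> aval a w \<Longrightarrow> 0 \<le> aval a x" "aval a w \<le> 0 \<Longrightarrow> aval a x \<le> 0"
  using assms by (auto simp: arr_cell_def)

lemma arr_cell_refl: "w \<in> arr_cell H w"
  by (simp add: arr_cell_def)

lemma arr_cell_subset: "x \<in> arr_cell H w \<Longrightarrow> arr_cell H x \<subseteq> arr_cell H w"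
  by (auto simp: arr_cell_def)

lemma finite_small_step:
  fixes p q :: "'b \<Rightarrow> real"
  assumes "finite A" "\<And>a. a \<in> A \<Longrightarrow> 0 < p a"
  shows "\<exists>e>0. \<forall>a\<in>A. e * \<bar>q a\<bar> < p a"
  using assms
proof (induction A)
  case empty
  show ?case by (intro exI[of _ 1]) auto
next
  case (insert a A)
  then obtain e where e: "0 < e" "\<forall>a\<in>A. e * \<bar>q a\<bar> < p a" by auto
  define e' where "e' = p a / (\<bar>q a\<bar> + 1)"
  have e': "0 < e'" using insert.prems[of a] by (auto simp: e'_def intro!: divide_pos_pos)
  have "e' * \<bar>q a\<bar> < e' * (\<bar>q a\<bar> + 1)" using e' by (intro mult_strict_left_mono) auto
  also have "\<dots> = p a" using abs_ge_zero[of "q a"] by (simp add: e'_def)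
  finally have a: "e' * \<bar>q a\<bar> < p a" .
  have "min e e' * \<bar>q b\<bar> \<le> e * \<bar>q b\<bar>" "min e e' * \<bar>q b\<bar> \<le> e' * \<bar>q b\<bar>" for b
    by (intro mult_right_mono; simp)+
  then show ?case using e e' a by (intro exI[of _ "min e e'"]) (auto intro: le_less_trans)
qed

text \<open>A segment ending at \<open>x\<close> can be prolonged inside the cell of
  \<open>x\<close>: forms that vanish at \<open>x\<close> vanish at \<open>y\<close> as well, and
  the others tolerate a small step.\<close>

lemma arr_cell_extend:
  assumes "finite H" "y \<in> arr_cell H x"
  obtains e where "0 < e" "(1 + e) *\<^sub>R x + (- e) *\<^sub>R y \<in> arr_cell H x"
proof -
  obtain e where e: "0 < e" "\<forall>a\<in>{a \<in> H. aval a x \<noteq> 0}. e * \<bar>aval a x - aval a y\<bar> < \<bar>aval a x\<bar>"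
    using finite_small_step[of "{a \<in> H. aval a x \<noteq> 0}" "\<lambda>a. \<bar>aval a x\<bar>" "\<lambda>a. aval a x - aval a y"] assms(1)
    by auto
  have "(1 + e) *\<^sub>R x + (- e) *\<^sub>R y \<in> arr_cell H x"
    unfolding arr_cell_def
  proof (safe)
    fix a b assume ab: "(a, b) \<in> H"
    have eq: "aval (a, b) ((1 + e) *\<^sub>R x + (- e) *\<^sub>R y) = aval (a, b) x + e * (aval (a, b) x - aval (a, b) y)"
      by (subst aval_combine) (auto simp: algebra_simps)
    have small: "\<bar>e * (aval (a, b) x - aval (a, b) y)\<bar> < \<bar>aval (a, b) x\<bar>" if "aval (a, b) x \<noteq> 0"
      using e(1) e(2)[rule_format, of "(a, b)"] that ab by (simp add: abs_mult)
    have zero: "aval (a, b) y = 0" if "aval (a, b) x = 0" using arr_cellD[OF assms(2) ab] that by simp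
    show "0 \<le> aval (a, b) ((1 + e) *\<^sub>R x + (- e) *\<^sub>R y)" if "0 \<le> aval (a, b) x"
      unfolding eq using small zero that by (cases "aval (a, b) x = 0") auto
    show "aval (a, b) ((1 + e) *\<^sub>R x + (- e) *\<^sub>R y) \<le> 0" if "aval (a, b) x \<le> 0"
      unfolding eq using small zero that by (cases "aval (a, b) x = 0") auto
  qed
  then show thesis using that e(1) by blast
qed

lemma polyhedron_arr_cell:
  assumes "finite H"
  shows "polyhedron (arr_cell H w)"
proof -
  let ?C = "\<lambda>a. {x. (0 \<le> aval a w \<longrightarrow> 0 \<le> aval a x) \<and> (aval a w \<le> 0 \<longrightarrow> aval a x \<le> 0)}"
  have "polyhedron (?C a)" for a :: "'a \<times> real"
  proof -
    have "{x. 0 \<le> aval a x} = {x. fst a \<bullet> x \<ge> - snd a}" "{x. aval a x \<le> 0} = {x. fst a \<bullet> x \<le> - snd a}"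
      by (auto simp: aval_def)
    then have ge: "polyhedron {x. 0 \<le> aval a x}" and le: "polyhedron {x. aval a x \<le> 0}"
      using polyhedron_halfspace_ge polyhedron_halfspace_le by metis+
    have "?C a = (if 0 \<le> aval a w then {x. 0 \<le> aval a x} else UNIV) \<inter>
                 (if aval a w \<le> 0 then {x. aval a x \<le> 0} else UNIV)" by auto
    then show ?thesis using ge le by (auto intro!: polyhedron_Int)
  qed
  moreover have "arr_cell H w = \<Inter> (?C ` H)" by (auto simp: arr_cell_def)
  ultimately show ?thesis using assms by (auto intro!: polyhedron_Inter)
qed

text \<open>A face is the cell of any point \<open>x\<close> in its relative interior. For one
  inclusion, a segment from the cell of \<open>x\<close> to \<open>x\<close> is prolonged, and the
  face property captures its endpoints; for the other, a segment from a point of \<open>F\<close> is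
  prolonged beyond \<open>x\<close> within \<open>F\<close>, and signs are compared at its
  ends.\<close>

lemma face_of_arr_cell:
  assumes H: "finite H" and F: "F face_of arr_cell H w" "F \<noteq> {}"
  obtains x where "x \<in> arr_cell H w" "F = arr_cell H x"
proof -
  have cF: "convex F" using F(1) face_of_imp_convex by blast
  then obtain x where x: "x \<in> rel_interior F" using F(2) rel_interior_eq_empty by blast
  have FP: "F \<subseteq> arr_cell H w" using F(1) face_of_imp_subset by blast
  have xF: "x \<in> F" using x rel_interior_subset by blast
  have xw: "x \<in> arr_cell H w" using xF FP by blast
  have "arr_cell H x \<subseteq> F"
  proof
    fix y assume y: "y \<in> arr_cell H x"
    obtain e where e: "0 < e" "(1 + e) *\<^sub>R x + (- e) *\<^sub>R y \<in> arr_cell H x" using arr_cell_extend[OF H y] .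
    let ?z = "(1 + e) *\<^sub>R x + (- e) *\<^sub>R y"
    show "y \<in> F"
    proof (cases "y = x")
      case True
      then show ?thesis using xF by simp
    next
      case False
      have eq: "x = (1 - 1 / (1 + e)) *\<^sub>R y + (1 / (1 + e)) *\<^sub>R ?z"
      proof -
        have "(1 / (1 + e)) *\<^sub>R ?z = x - (e / (1 + e)) *\<^sub>R y"
          using e(1) by (simp add: scaleR_right_diff_distrib)
        moreover have "1 - 1 / (1 + e) = e / (1 + e)" using e(1) by (simp add: field_simps)
        ultimately show ?thesis by simp
      qed
      have "?z \<noteq> y"
      proof
        assume "?z = y"
        then have "(1 + e) *\<^sub>R x = (1 + e) *\<^sub>R y" by (simp add: scaleR_left_distrib algebra_simps)
        then show False using e(1) False by simp
      qed
      then have "x \<in> open_segment y ?z"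
        unfolding in_segment using eq e(1) by (intro conjI exI[of _ "1 / (1 + e)"]) auto
      moreover have "y \<in> arr_cell H w" "?z \<in> arr_cell H w" using arr_cell_subset[OF xw] y e(2) by blast+
      ultimately show ?thesis using F(1) xF unfolding face_of_def by blast
    qed
  qed
  moreover have "F \<subseteq> arr_cell H x"
  proof
    fix y assume y: "y \<in> F"
    then obtain e where e: "e > 1" "(1 - e) *\<^sub>R y + e *\<^sub>R x \<in> F"
      using x convex_rel_interior_iff[OF cF F(2), of x] by blast
    let ?z = "(1 - e) *\<^sub>R y + e *\<^sub>R x"
    have yz: "y \<in> arr_cell H w" "?z \<in> arr_cell H w" using y e(2) FP by blast+
    have z: "aval a ?z = (1 - e) * aval a y + e * aval a x" for a by (rule aval_combine) simp
    show "y \<in> arr_cell H x"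
      unfolding arr_cell_def
    proof (intro CollectI ballI conjI impI)
      fix a assume a: "a \<in> H"
      note cell = arr_cellD[OF yz(1) a] arr_cellD[OF yz(2) a] arr_cellD[OF xw a]
      show "0 \<le> aval a y" if x0: "0 \<le> aval a x"
      proof (cases "0 \<le> aval a w")
        case False
        \<comment> \<open>Here the form is at most \<open>0\<close> on the whole cell, so it
          vanishes at \<open>x\<close>. As \<open>x\<close> lies between \<open>y\<close> and
          \<open>?z\<close>, the signs at these two points are opposite.\<close>
        then have "aval a x = 0" "aval a ?z \<le> 0" using cell x0 by auto
        then have "(1 - e) * aval a y \<le> 0" using z[of a] by simp
        then show ?thesis using e(1) by (simp add: mult_le_0_iff)
      qed (use cell in auto)
      show "aval a y \<le> 0" if x0: "aval a x \<le> 0"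
      proof (cases "aval a w \<le> 0")
        case False
        then have "aval a x = 0" "0 \<le> aval a ?z" using cell x0 by auto
        then have "0 \<le> (1 - e) * aval a y" using z[of a] by simp
        then show ?thesis using e(1) by (simp add: zero_le_mult_iff)
      qed (use cell in auto)
    qed
  qed
  ultimately show thesis using that[OF xw] by blast
qed

text \<open>A form that is negative at \<open>w\<close> is at most \<open>0\<close> on the cell; if
  it is also at least \<open>0\<close> at an inner point of a segment in the cell, it vanishes at
  both ends. The other sign is symmetric.\<close>

lemma arr_cell_Int_face_of:
  assumes "finite H"
  shows "(arr_cell H w \<inter> arr_cell H x) face_of arr_cell H w"
  unfolding face_of_def
proof (intro conjI ballI impI)
  show "convex (arr_cell H w \<inter> arr_cell H x)"
    using polyhedron_arr_cell[OF assms] by (intro convex_Int polyhedron_imp_convex)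
  fix p q z
  assume p: "p \<in> arr_cell H w" and q: "q \<in> arr_cell H w"
    and z: "z \<in> arr_cell H w \<inter> arr_cell H x" and seg: "z \<in> open_segment p q"
  obtain t where t: "0 < t" "t < 1" "z = (1 - t) *\<^sub>R p + t *\<^sub>R q" using seg unfolding in_segment by blast
  have zv: "aval a z = (1 - t) * aval a p + t * aval a q" for a unfolding t(3) by (rule aval_combine) simp
  have both: "(0 \<le> aval a x \<longrightarrow> 0 \<le> aval a p \<and> 0 \<le> aval a q) \<and>
      (aval a x \<le> 0 \<longrightarrow> aval a p \<le> 0 \<and> aval a q \<le> 0)" if a: "a \<in> H" for a
  proof -
    note cell = arr_cellD[OF p a] arr_cellD[OF q a] arr_cellD[OF IntD2[OF z] a]
    have pos: "0 \<le> aval a p \<and> 0 \<le> aval a q" if "0 \<le> aval a z" "aval a p \<le> 0" "aval a q \<le> 0"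
    proof -
      have "(1 - t) * aval a p \<le> 0" "t * aval a q \<le> 0" using t that by (auto simp: mult_le_0_iff)
      then have "(1 - t) * aval a p = 0" "t * aval a q = 0" using zv[of a] that(1) by linarith+
      then show ?thesis using t by auto
    qed
    have neg: "aval a p \<le> 0 \<and> aval a q \<le> 0" if "aval a z \<le> 0" "0 \<le> aval a p" "0 \<le> aval a q"
    proof -
      have "0 \<le> (1 - t) * aval a p" "0 \<le> t * aval a q" using t that by auto
      then have "(1 - t) * aval a p = 0" "t * aval a q = 0" using zv[of a] that(1) by linarith+
      then show ?thesis using t by auto
    qed
    show ?thesis using cell pos neg by (cases "0 \<le> aval a w"; cases "aval a w \<le> 0") auto
  qed
  show "p \<in> arr_cell H w \<inter> arr_cell H x" "q \<in> arr_cell H w \<inter> arr_cell H x"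
    using p q both by (auto simp: arr_cell_def)
qed auto

lemma polyhedral_complex_arr_cells:
  assumes H: "finite H" and V: "\<And>w. w \<in> V \<Longrightarrow> arr_cell H w \<subseteq> V"
  shows "polyhedral_complex (arr_cell H ` V)" "\<Union> (arr_cell H ` V) = V"
proof -
  show "\<Union> (arr_cell H ` V) = V" using V arr_cell_refl by blast
  \<comment> \<open>Finiteness: a cell depends only on the sign pattern of its base point.\<close>
  let ?pat = "\<lambda>w. ({a \<in> H. 0 \<le> aval a w}, {a \<in> H. aval a w \<le> 0})"
  let ?C = "\<lambda>(P, N). {x. (\<forall>a\<in>P. 0 \<le> aval a x) \<and> (\<forall>a\<in>N. aval a x \<le> 0)}"
  have "arr_cell H w = ?C (?pat w)" for w by (auto simp: arr_cell_def)
  then have "arr_cell H ` V = ?C ` (?pat ` V)" unfolding image_image by (rule image_cong[OF refl])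
  also have "\<dots> \<subseteq> ?C ` (Pow H \<times> Pow H)" by (intro image_mono) auto
  finally have "arr_cell H ` V \<subseteq> ?C ` (Pow H \<times> Pow H)" .
  then have fin: "finite (arr_cell H ` V)" by (rule finite_subset) (use H in auto)
  show "polyhedral_complex (arr_cell H ` V)"
    unfolding polyhedral_complex_def
  proof (intro conjI ballI allI impI)
    show "finite (arr_cell H ` V)" by (rule fin)
    fix P assume "P \<in> arr_cell H ` V"
    then obtain w where w: "w \<in> V" "P = arr_cell H w" by blast
    show "polyhedron P" using polyhedron_arr_cell[OF H] w by simp
    show "P \<noteq> {}" using arr_cell_refl w by blast
    show "F \<in> arr_cell H ` V" if F: "F face_of P \<and> F \<noteq> {}" for F
    proof -
      obtain x where "x \<in> arr_cell H w" "F = arr_cell H x"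
        using face_of_arr_cell[OF H, of F w] F w(2) by blast
      then show ?thesis using V[OF w(1)] by blast
    qed
    fix Q assume "Q \<in> arr_cell H ` V"
    then obtain x where x: "Q = arr_cell H x" by blast
    show "(P \<inter> Q) face_of P" unfolding w(2) x by (rule arr_cell_Int_face_of[OF H])
    show "(P \<inter> Q) face_of Q" unfolding w(2) x Int_commute[of "arr_cell H w"] by (rule arr_cell_Int_face_of[OF H])
  qed
qed

section \<open>The variety is a union of arrangement cells\<close>

lemma nonneg_of_segment:
  fixes A B :: real
  assumes "\<And>t. 0 < t \<Longrightarrow> t \<le> 1 \<Longrightarrow> 0 \<le> (1 - t) * A + t * B"
  shows "0 \<le> A"
proof (rule tendsto_lowerbound)
  show "((\<lambda>t. (1 - t) * A + t * B) \<longlongrightarrow> A) (at_right 0)" by (auto intro!: tendsto_eq_intros)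
  show "\<forall>\<^sub>F t in at_right 0. 0 \<le> (1 - t) * A + t * B"
    using assms eventually_at_right_real[of 0 1] by (auto elim!: eventually_mono)
qed simp

lemma (in trop_lin) lead_fundamental:
  assumes B: "indep B" and g: "g \<in> V" "lead \<theta> \<tau> g u" "tsupp g \<subseteq> insert u B"
    and f: "f \<in> V" "u \<in> tsupp f" "tsupp f \<subseteq> insert u B"
  shows "lead \<theta> \<tau> f u"
proof -
  have ug: "u \<in> tsupp g" using g(2) by (simp add: lead_def)
  obtain c where c: "tsupp f = tsupp g" "\<And>v. v \<in> tsupp g \<Longrightarrow> the (f v) = c + the (g v)"
    using fundamental_unique[OF f g(1) ug g(3) B] by blast
  show ?thesis using g(2) unfolding lead_def c(1) by (auto simp: c(2))
qed

context laurent_ideal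
begin

section \<open>Groebner cells and the walls between them\<close>

context
  fixes v :: "real ^ 'n" and D :: nat
  assumes inj: "inj (\<lambda>u :: int ^ 'n. expdot u v)"
    and D: "\<And>w w' e. init_exps v w D = init_exps v w' D \<Longrightarrow> D \<le> e \<Longrightarrow> init_exps v w e = init_exps v w' e"
begin

lemma indep_standard: "indep (exps_le e - init_exps v w e)"
  using inj inj_on_subset by (intro indep_nonleads) blast

definition fundamental :: "nat \<Rightarrow> real ^ 'n \<Rightarrow> int ^ 'n \<Rightarrow> (int ^ 'n) tpoly \<Rightarrow> bool" where
  "fundamental e w u f \<longleftrightarrow> f \<in> I \<and> u \<in> tsupp f \<and> tsupp f \<subseteq> insert u (exps_le e - init_exps v w e)"

lemma lead_of_fundamental:
  assumes "u \<in> init_exps v w e" "fundamental e w u f"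
  shows "lead (\<lambda>u. expdot u w) (\<lambda>u. expdot u v) f u"
proof -
  obtain g where "g \<in> I" "lead (\<lambda>u. expdot u w) (\<lambda>u. expdot u v) g u"
    "tsupp g \<subseteq> insert u (exps_le e - init_exps v w e)"
    using fundamental_lead[OF finite_exps_le assms(1)] by blast
  then show ?thesis using lead_fundamental[OF indep_standard] assms(2) unfolding fundamental_def by blast
qed

lemma fundamental_exists: "u \<in> init_exps v w e \<Longrightarrow> \<exists>f. fundamental e w u f"
  using fundamental_lead[OF finite_exps_le, of u] unfolding fundamental_def lead_def by metis

text \<open>The segment from \<open>w\<close> to \<open>w0\<close> stays, except possibly at \<open>w\<close>, in the Groebner cell of \<open>w0\<close>.\<close>

lemma groebner_cell_closed:
  assumes F: "\<And>u. u \<in> init_exps v w0 D \<Longrightarrow> fundamental D w0 u (F u)"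
    and closed: "\<And>u b. \<lbrakk>u \<in> init_exps v w0 D; b \<in> tsupp (F u)\<rbrakk> \<Longrightarrow>
                   the (F u u) + expdot u w \<le> the (F u b) + expdot b w"
    and e: "D \<le> e" and u: "u \<in> init_exps v w0 e" and f: "fundamental e w0 u f" and b: "b \<in> tsupp f"
  shows "the (f u) + expdot u w \<le> the (f b) + expdot b w"
proof -
  define A where "A x = the (f b) + expdot b x - (the (f u) + expdot u x)" for x
  have "0 \<le> (1 - t) * A w + t * A w0" if t: "0 < t" "t \<le> 1" for t
  proof -
    define x where "x = (1 - t) *\<^sub>R w + t *\<^sub>R w0"
    have ex: "expdot s x = (1 - t) * expdot s w + t * expdot s w0" for s
      by (simp add: x_def expdot_inner inner_add_right)
    \<comment> \<open>Weak inequalities at \<open>w\<close> and the lead at \<open>w0\<close> mix to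
      a lead at \<open>x\<close>, because \<open>t > 0\<close>. Equal cardinality turns this
      inclusion into an equality, which passes from degree \<open>D\<close> to degree
      \<open>e\<close>.\<close>
    have "init_exps v w0 D \<subseteq> init_exps v x D"
    proof
      fix s assume s: "s \<in> init_exps v w0 D"
      have ld: "lead (\<lambda>u. expdot u w0) (\<lambda>u. expdot u v) (F s) s" by (rule lead_of_fundamental[OF s F[OF s]])
      have "lead (\<lambda>u. expdot u x) (\<lambda>u. expdot u v) (F s) s"
        unfolding lead_def
      proof (intro conjI ballI impI)
        show "s \<in> tsupp (F s)" using ld by (simp add: lead_def)
        fix c assume c: "c \<in> tsupp (F s)" "c \<noteq> s"
        define P Q where "P = the (F s c) + expdot c w - (the (F s s) + expdot s w)"
          and "Q = the (F s c) + expdot c w0 - (the (F s s) + expdot s w0)"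
        have P: "0 \<le> P" using closed[OF s c(1)] by (simp add: P_def)
        have Q: "0 < Q \<or> Q = 0 \<and> expdot s v < expdot c v" using ld c unfolding lead_def Q_def by force
        have "the (F s c) + expdot c x - (the (F s s) + expdot s x) = (1 - t) * P + t * Q"
          by (simp add: ex P_def Q_def algebra_simps)
        moreover have "0 \<le> (1 - t) * P" using P t by simp
        moreover have "0 < t * Q \<or> t * Q = 0 \<and> expdot s v < expdot c v" using Q t by auto
        ultimately show "the (F s s) + expdot s x < the (F s c) + expdot c x \<or>
           the (F s s) + expdot s x = the (F s c) + expdot c x \<and> expdot s v < expdot c v" by linarith
      qed
      moreover have "tsupp (F s) \<subseteq> exps_le D"
        using F[OF s] s leads_subset[of _ _ "exps_le D"] unfolding fundamental_def by blast
      ultimately show "s \<in> init_exps v x D" using F[OF s] unfolding leads_def fundamental_def by blast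
    qed
    then have "init_exps v w0 D = init_exps v x D"
      using card_init_exps_eq[OF inj, of w0 D x] finite_subset[OF leads_subset finite_exps_le]
      by (intro card_subset_eq) auto
    then have eq: "init_exps v w0 e = init_exps v x e" using D e by blast
    then have "lead (\<lambda>u. expdot u x) (\<lambda>u. expdot u v) f u"
      using lead_of_fundamental[of u x e f] u f unfolding fundamental_def by simp
    then have "0 \<le> A x" using lead_imp_le b unfolding A_def by fastforce
    then show ?thesis by (simp add: A_def ex algebra_simps)
  qed
  then have "0 \<le> A w" by (rule nonneg_of_segment)
  then show ?thesis by (simp add: A_def)
qed

text \<open>Chosen from the set \<open>K\<close> and not from a weight, so that finitely many sets
  of initial exponents give finitely many walls.\<close>

definition circuit :: "(int ^ 'n) set \<Rightarrow> int ^ 'n \<Rightarrow> (int ^ 'n) tpoly" where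
  "circuit K u = (SOME f. f \<in> I \<and> u \<in> tsupp f \<and> tsupp f \<subseteq> insert u (exps_le D - K))"

lemma fundamental_circuit:
  assumes "u \<in> init_exps v w D"
  shows "fundamental D w u (circuit (init_exps v w D) u)"
  using someI_ex[OF fundamental_exists[OF assms, unfolded fundamental_def]]
  unfolding fundamental_def circuit_def .

definition wall :: "(int ^ 'n) tpoly \<Rightarrow> int ^ 'n \<Rightarrow> int ^ 'n \<Rightarrow> (real ^ 'n) \<times> real" where
  "wall f u b = (rvec b - rvec u, the (f b) - the (f u))"

lemma aval_wall: "aval (wall f u b) w = the (f b) + expdot b w - (the (f u) + expdot u w)"
  by (simp add: wall_def aval_def expdot_inner inner_diff_left)

definition walls :: "((real ^ 'n) \<times> real) set" where
  "walls = (\<Union>K\<in>range (\<lambda>w. init_exps v w D). \<Union>u\<in>K. wall (circuit K u) u ` tsupp (circuit K u))"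

lemma finite_walls: "finite walls"
proof -
  have "finite (range (\<lambda>w. init_exps v w D))"
    by (rule finite_subset[of _ "Pow (exps_le D)"]) (use leads_subset in auto)
  moreover have "finite (\<Union>u\<in>init_exps v w D. wall (circuit (init_exps v w D) u) u ` tsupp (circuit (init_exps v w D) u))" for w
  proof (intro finite_UN_I finite_imageI)
    show "finite (init_exps v w D)" by (rule finite_subset[OF leads_subset finite_exps_le])
    show "finite (tsupp (circuit (init_exps v w D) u))" if "u \<in> init_exps v w D" for u
      using fundamental_circuit[OF that] finite_supp by (simp add: fundamental_def)
  qed
  ultimately show ?thesis unfolding walls_def by blast
qed

lemma wall_in_walls:
  "u \<in> init_exps v w D \<Longrightarrow> b \<in> tsupp (circuit (init_exps v w D) u) \<Longrightarrow> wall (circuit (init_exps v w D) u) u b \<in> walls"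
  unfolding walls_def by blast

text \<open>A monomial initial form at \<open>x\<close> shows up, after a shift into polynomials, in
  a fundamental circuit \<open>F z\<close> of the basis of \<open>w\<close>. At \<open>w\<close>
  this circuit has a tie, so the difference of the two tied terms vanishes at \<open>w\<close> and
  is positive at \<open>x\<close>. It must be nonnegative on the cell, but prolonging the segment
  from \<open>x\<close> beyond \<open>w\<close> makes it negative.\<close>

lemma arr_cell_walls_subset_variety:
  assumes w: "w \<in> trop_variety I"
  shows "arr_cell walls w \<subseteq> trop_variety I"
proof
  fix x assume x: "x \<in> arr_cell walls w"
  let ?K = "init_exps v w"
  have ge: "0 \<le> aval (wall (circuit (?K D) u) u b) w" if "u \<in> ?K D" "b \<in> tsupp (circuit (?K D) u)" for u b
    using lead_imp_le[OF lead_of_fundamental[OF that(1) fundamental_circuit[OF that(1)]] that(2)]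
    by (simp add: aval_wall)
  \<comment> \<open>Walls come from degree \<open>D\<close> alone, yet the signs there fix the weak
    inequalities for the fundamental circuits of every degree \<open>e \<ge> D\<close>.\<close>
  have cone: "the (f u) + expdot u y \<le> the (f b) + expdot b y"
    if y: "y \<in> arr_cell walls w" and e: "D \<le> e" and u: "u \<in> ?K e" "fundamental e w u f" "b \<in> tsupp f" for y e u f b
  proof (rule groebner_cell_closed[OF fundamental_circuit _ e u])
    fix s c assume s: "s \<in> ?K D" "c \<in> tsupp (circuit (?K D) s)"
    show "the (circuit (?K D) s s) + expdot s y \<le> the (circuit (?K D) s c) + expdot c y"
      using arr_cellD(1)[OF y wall_in_walls[OF s] ge[OF s]] by (simp add: aval_wall)
  qed
  show "x \<in> trop_variety I"
  proof (rule ccontr)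
    assume "x \<notin> trop_variety I"
    then obtain g0 z0 where g0: "g0 \<in> I" "umin (\<lambda>u. expdot u x) g0 z0" by (rule not_trop_variety)
    obtain s e0 where s: "(\<lambda>u. u + s) ` tsupp g0 \<subseteq> exps_le e0"
      using shift_into_exps_le[OF finite_supp[OF g0(1)]] by blast
    define e g z where "e = max D e0" and "g = tshift s g0" and "z = z0 + s"
    have e: "D \<le> e" by (simp add: e_def)
    have gI: "g \<in> I" unfolding g_def by (rule shift[OF g0(1)])
    have zg: "umin (\<lambda>u. expdot u x) g z" unfolding g_def z_def by (rule umin_tshift[OF g0(2)])
    have "tsupp g \<subseteq> exps_le e" using s exps_le_mono[of e0 e] by (auto simp: g_def tsupp_tshift e_def)
    then have gs: "tsupp g \<subseteq> (exps_le e - ?K e) \<union> ?K e" by blast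
    define F where "F u = (SOME f. fundamental e w u f)" for u
    have F: "fundamental e w u (F u)" if "u \<in> ?K e" for u
      unfolding F_def using fundamental_exists[OF that] by (rule someI_ex)
    have disj: "(exps_le e - ?K e) \<inter> ?K e = {}" by blast
    have F1: "F u \<in> I \<and> u \<in> tsupp (F u) \<and> tsupp (F u) \<subseteq> insert u (exps_le e - ?K e)" if "u \<in> ?K e" for u
      using F[OF that] unfolding fundamental_def .
    have F2: "the (F u u) + expdot u x \<le> the (F u b) + expdot b x" if "u \<in> ?K e" "b \<in> tsupp (F u)" for u b
      by (rule cone[OF x e that(1) F[OF that(1)] that(2)])
    note z = umin_fundamental[OF indep_standard disj F1 F2 gI gs zg]
    have "\<not> umin (\<lambda>u. expdot u w) (F z) z"
      using trop_variety_no_umin[OF w] F[OF z(1)] unfolding fundamental_def by blast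
    moreover have zF: "z \<in> tsupp (F z)" using F1[OF z(1)] by blast
    ultimately have "\<exists>b\<in>tsupp (F z). b \<noteq> z \<and> the (F z b) + expdot b w \<le> the (F z z) + expdot z w"
      unfolding umin_def by (simp add: not_less Bex_def)
    then obtain b where b: "b \<in> tsupp (F z)" "b \<noteq> z" "the (F z b) + expdot b w \<le> the (F z z) + expdot z w"
      by blast
    let ?a = "wall (F z) z b"
    have w0: "aval ?a w = 0"
      using cone[OF arr_cell_refl e z(1) F[OF z(1)] b(1)] b(3) unfolding aval_wall by linarith
    have "the (F z z) + expdot z x < the (F z b) + expdot b x"
      using z(2) b(1,2) unfolding umin_def by blast
    then have x0: "0 < aval ?a x" unfolding aval_wall by linarith
    obtain \<epsilon> where \<epsilon>: "0 < \<epsilon>" "(1 + \<epsilon>) *\<^sub>R w + (- \<epsilon>) *\<^sub>R x \<in> arr_cell walls w"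
      using arr_cell_extend[OF finite_walls x] .
    have "0 \<le> aval ?a ((1 + \<epsilon>) *\<^sub>R w + (- \<epsilon>) *\<^sub>R x)"
      using cone[OF \<epsilon>(2) e z(1) F[OF z(1)] b(1)] unfolding aval_wall by linarith
    also have "\<dots> = - \<epsilon> * aval ?a x" by (subst aval_combine) (auto simp: w0)
    also have "\<dots> < 0" using \<epsilon>(1) x0 by simp
    finally show False by simp
  qed
qed

end

lemma trop_variety_arrangement:
  obtains H where "finite H" "\<And>w. w \<in> trop_variety I \<Longrightarrow> arr_cell H w \<subseteq> trop_variety I"
proof -
  obtain v :: "real ^ 'n" where inj: "inj (\<lambda>u :: int ^ 'n. expdot u v)" by (rule injective_functional)
  obtain D where D: "\<And>w w' e. init_exps v w D = init_exps v w' D \<Longrightarrow> D \<le> e \<Longrightarrow> init_exps v w e = init_exps v w' e"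
    using init_exps_determined[OF inj] by blast
  show thesis
    using that[OF finite_walls[OF inj D] arr_cell_walls_subset_variety[OF inj D]] by blast
qed

end

section \<open>Projections onto independent coordinates\<close>

definition coord_exps :: "'n set \<Rightarrow> (int ^ 'n) set" where
  "coord_exps A = {u. \<forall>i. i \<notin> A \<longrightarrow> u $ i = 0}"

definition normal_at :: "'m::ab_group_add \<Rightarrow> 'm tpoly \<Rightarrow> 'm tpoly" where
  "normal_at z f = tscale (- the (f z)) (tshift (- z) f)"

lemma tsupp_normal_at: "b \<in> tsupp (normal_at z f) \<longleftrightarrow> b + z \<in> tsupp f"
  by (simp add: normal_at_def mem_tsupp_tshift)

lemma the_normal_at: "b + z \<in> tsupp f \<Longrightarrow> the (normal_at z f b) = the (f (b + z)) - the (f z)"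
  by (simp add: normal_at_def the_tscale mem_tsupp_tshift) (simp add: tshift_def)

text \<open>A unique minimum, moved to \<open>0\<close> with value \<open>0\<close>, persists with a
  positive gap near the given weight; compactness yields finitely many relations and one
  gap.\<close>

lemma (in laurent_ideal) compact_good_family:
  assumes W: "compact W" and disj: "W \<inter> trop_variety I = {}"
  obtains G \<delta> where "finite G" "G \<subseteq> I" "0 < \<delta>"
    "\<And>w. w \<in> W \<Longrightarrow> \<exists>g\<in>G. 0 \<in> tsupp g \<and> the (g 0) = 0 \<and> (\<forall>b\<in>tsupp g. b \<noteq> 0 \<longrightarrow> \<delta> < the (g b) + expdot b w)"
proof -
  define J where "J = {(g, \<delta> :: real). g \<in> I \<and> 0 \<in> tsupp g \<and> the (g 0) = 0 \<and> 0 < \<delta>}"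
  define U where "U j = {w. \<forall>b\<in>tsupp (fst j) - {0}. snd j < the (fst j b) + expdot b w}" for j :: "(int ^ 'n) tpoly \<times> real"
  have op: "open (U j)" if "j \<in> J" for j
  proof -
    have "finite (tsupp (fst j) - {0})" using that finite_supp by (auto simp: J_def)
    moreover have "open {w. snd j < the (fst j b) + expdot b w}" for b
      unfolding expdot_inner by (intro open_Collect_less continuous_intros)
    moreover have "U j = (\<Inter>b\<in>tsupp (fst j) - {0}. {w. snd j < the (fst j b) + expdot b w})" by (auto simp: U_def)
    ultimately show ?thesis by (auto intro!: open_INT)
  qed
  have cover: "W \<subseteq> (\<Union>j\<in>J. U j)"
  proof
    fix w assume "w \<in> W"
    then have "w \<notin> trop_variety I" using disj by blast
    then obtain f z where f: "f \<in> I" "umin (\<lambda>u. expdot u w) f z" by (rule not_trop_variety)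
    define g where "g = normal_at z f"
    have z: "z \<in> tsupp f" using f(2) by (simp add: umin_def)
    have gI: "g \<in> I" unfolding g_def normal_at_def by (rule scale_shift[OF f(1)])
    have g0: "0 \<in> tsupp g" "the (g 0) = 0" using z by (simp_all add: g_def tsupp_normal_at the_normal_at)
    have pos: "0 < the (g b) + expdot b w" if "b \<in> tsupp g - {0}" for b
    proof -
      have b: "b + z \<in> tsupp f" "b + z \<noteq> z" using that by (auto simp: g_def tsupp_normal_at)
      then have "the (f z) + expdot z w < the (f (b + z)) + expdot (b + z) w" using f(2) unfolding umin_def by blast
      then show ?thesis using b by (simp add: g_def the_normal_at expdot_add)
    qed
    obtain \<delta> where "0 < \<delta>" "\<forall>b\<in>tsupp g - {0}. \<delta> * \<bar>1\<bar> < the (g b) + expdot b w"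
      using finite_small_step[of "tsupp g - {0}" "\<lambda>b. the (g b) + expdot b w" "\<lambda>_. 1"] pos finite_supp[OF gI] by auto
    then have "(g, \<delta>) \<in> J" "w \<in> U (g, \<delta>)" using gI g0 by (auto simp: J_def U_def)
    then show "w \<in> (\<Union>j\<in>J. U j)" by blast
  qed
  obtain C where C: "C \<subseteq> J" "finite C" "W \<subseteq> (\<Union>j\<in>C. U j)"
    using compactE_image[OF W op cover] by blast
  \<comment> \<open>The inserted \<open>1\<close> serves an empty cover.\<close>
  define \<delta> where "\<delta> = Min (insert 1 (snd ` C))"
  have \<delta>: "0 < \<delta>" "\<And>j. j \<in> C \<Longrightarrow> \<delta> \<le> snd j"
    using C(1,2) by (auto simp: \<delta>_def J_def)
  show thesis
  proof (rule that[of "fst ` C" \<delta>])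
    show "finite (fst ` C)" "0 < \<delta>" using C(2) \<delta>(1) by auto
    show "fst ` C \<subseteq> I" using C(1) by (auto simp: J_def)
    fix w assume "w \<in> W"
    then obtain j where j: "j \<in> C" "w \<in> U j" using C(3) by blast
    have "0 \<in> tsupp (fst j)" "the (fst j 0) = 0" using j(1) C(1) by (auto simp: J_def)
    moreover have "\<delta> < the (fst j b) + expdot b w" if "b \<in> tsupp (fst j)" "b \<noteq> 0" for b
    proof -
      have "snd j < the (fst j b) + expdot b w" using j(2) that by (simp add: U_def)
      then show ?thesis using \<delta>(2)[OF j(1)] by linarith
    qed
    ultimately show "\<exists>g\<in>fst ` C. 0 \<in> tsupp g \<and> the (g 0) = 0 \<and> (\<forall>b\<in>tsupp g. b \<noteq> 0 \<longrightarrow> \<delta> < the (g b) + expdot b w)"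
      using j(1) by blast
  qed
qed

text \<open>Here \<open>2 N + 1\<close> counts the integers in \<open>[-N, N]\<close>,
  \<open>\<beta>\<close> is the margin lost at each end, and \<open>q\<close> will be the
  cross-section of the tube. By Bernoulli's inequality the boundary layer is of lower order than the
  cube.\<close>

lemma boundary_count:
  fixes q \<beta> :: real
  assumes "0 \<le> \<beta>" "0 \<le> q"
  obtains N :: nat where "\<beta> \<le> real N"
    "q * ((2 * real N + 1) ^ d - (2 * real N + 1 - 2 * \<beta>) ^ d) < (2 * real N + 1) ^ d"
proof -
  obtain N :: nat where N: "real N > \<beta> + q * real d * (2 * \<beta>)" using reals_Archimedean2 by blast
  define a where "a = 2 * real N + 1"
  have nn: "0 \<le> q * real d * (2 * \<beta>)" using assms by simp
  then have a: "a > 0" "2 * \<beta> \<le> a" "q * real d * (2 * \<beta>) < a" "\<beta> \<le> real N"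
    using N assms unfolding a_def by linarith+
  have "1 + real d * (- (2 * \<beta> / a)) \<le> (1 + - (2 * \<beta> / a)) ^ d"
    using a by (intro Bernoulli_inequality) simp
  then have "a ^ d * (1 - real d * (2 * \<beta>) / a) \<le> a ^ d * (1 - 2 * \<beta> / a) ^ d"
    using a by (intro mult_left_mono) auto
  also have "\<dots> = (a - 2 * \<beta>) ^ d" using a by (simp add: right_diff_distrib flip: power_mult_distrib)
  finally have "a ^ d - (a - 2 * \<beta>) ^ d \<le> a ^ d * (real d * (2 * \<beta>) / a)" by (simp add: right_diff_distrib)
  then have "q * (a ^ d - (a - 2 * \<beta>) ^ d) \<le> q * (a ^ d * (real d * (2 * \<beta>) / a))"
    using assms(2) by (rule mult_left_mono)
  also have "\<dots> = a ^ d * ((q * real d * (2 * \<beta>)) / a)" by simp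
  also have "\<dots> < a ^ d * 1" using a by (intro mult_strict_left_mono) auto
  finally show thesis using that[of N] a(4) by (simp add: a_def)
qed

lemma prod_if_mem:
  fixes A :: "'n::finite set"
  shows "(\<Prod>i\<in>UNIV. if i \<in> A then x else y :: nat) = x ^ card A * y ^ card (- A)"
  by (simp add: prod.If_cases Compl_eq_Diff_UNIV)

lemma card_int_box:
  fixes A :: "'n::finite set"
  shows "card {u :: int ^ 'n. \<forall>i. u $ i \<in> (if i \<in> A then S else T)} = card S ^ card A * card T ^ card (- A)"
  by (subst card_vec_box) (simp add: if_distrib prod_if_mem)

context laurent_ideal
begin

text \<open>Beyond \<open>\<bar>u\<^sub>i\<bar> > X0\<close> the extreme rows of the relations in direction \<open>i\<close> push inwards; inside,
  the linearisation of the concave weight at \<open>u\<close> is a point of the compact set covered by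
  \<open>compact_good_family\<close>. So a tube around the independent coordinate lattice consists of loops,
  up to its boundary, and cannot contain that lattice independently.\<close>

lemma independent_projection_onto_generic:
  fixes A :: "'n set" and f :: "'n \<Rightarrow> (int ^ 'n) tpoly" and w0 :: "real ^ 'n"
  assumes indA: "indep (coord_exps A)"
    and f: "\<And>i. i \<notin> A \<Longrightarrow> f i \<in> I \<and> f i \<noteq> tzero \<and> tsupp (f i) \<subseteq> coord_exps (insert i A)"
    and gen: "\<And>i u v. \<lbrakk>i \<notin> A; u \<in> tsupp (f i); v \<in> tsupp (f i); u \<noteq> v; u - v \<in> coord_exps A\<rbrakk> \<Longrightarrow>
                the (f i u) + expdot u w0 \<noteq> the (f i v) + expdot v w0"
  shows "\<exists>w\<in>trop_variety I. \<forall>i\<in>A. w $ i = w0 $ i"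
proof (rule ccontr)
  assume neg: "\<not> ?thesis"
  define adot where "adot b = (\<Sum>i\<in>A. real_of_int (b $ i) * w0 $ i)" for b :: "int ^ 'n"
  have adot_add: "adot (b + c) = adot b + adot c" for b c
    by (simp add: adot_def algebra_simps sum.distrib)
  have expdot_split: "expdot b w = (\<Sum>i\<in>A. real_of_int (b $ i) * w $ i) + (\<Sum>i\<in>-A. real_of_int (b $ i) * w $ i)" for b w
    unfolding expdot_def by (subst sum.union_disjoint[symmetric]) (auto simp: Compl_partition)
  have adot_coord: "expdot b w0 = adot b" if "b \<in> coord_exps A" for b
  proof -
    have "(\<Sum>i\<in>-A. real_of_int (b $ i) * w0 $ i) = 0" using that by (intro sum.neutral) (auto simp: coord_exps_def)
    then show ?thesis unfolding expdot_split adot_def by simp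
  qed
  \<comment> \<open>Exponents in the extreme row of \<open>f i\<close> in direction \<open>s\<close>
    differ only in coordinates from \<open>A\<close>, so the genericity of \<open>w0\<close> gives
    this row a unique minimum. That exponent is moved to \<open>0\<close>.\<close>
  have wall: "\<exists>g\<in>I. 0 \<in> tsupp g \<and> the (g 0) = 0 \<and> tsupp g \<subseteq> coord_exps (insert i A) \<and>
      (\<forall>b\<in>tsupp g. s * b $ i \<le> 0) \<and> (\<forall>b\<in>tsupp g. b \<noteq> 0 \<longrightarrow> b $ i = 0 \<longrightarrow> 0 < the (g b) + adot b)"
    if i: "i \<notin> A" for i and s :: int
  proof -
    have fin: "finite (tsupp (f i))" and ne: "tsupp (f i) \<noteq> {}"
      using f[OF i] finite_supp tsupp_empty_iff by auto
    define M where "M = Max ((\<lambda>u. s * u $ i) ` tsupp (f i))"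
    define R where "R = {u \<in> tsupp (f i). s * u $ i = M}"
    have "M \<in> (\<lambda>u. s * u $ i) ` tsupp (f i)" unfolding M_def using fin ne by (intro Max_in) auto
    then have R: "finite R" "R \<noteq> {}" using fin by (auto simp: R_def)
    obtain z where z: "z \<in> R" "\<And>v. v \<in> R \<Longrightarrow> the (f i z) + expdot z w0 \<le> the (f i v) + expdot v w0"
      using finite_real_min[OF R, of "\<lambda>v. the (f i v) + expdot v w0"] by metis
    have zf: "z \<in> tsupp (f i)" "s * z $ i = M" using z(1) by (auto simp: R_def)
    define g where "g = normal_at z (f i)"
    have gI: "g \<in> I" unfolding g_def normal_at_def using scale_shift f[OF i] by blast
    have supp: "b \<in> tsupp g \<longleftrightarrow> b + z \<in> tsupp (f i)" for b by (simp add: g_def tsupp_normal_at)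
    have cset: "b \<in> coord_exps (insert i A)" if "b \<in> tsupp g" for b
    proof -
      have "b + z \<in> coord_exps (insert i A)" "z \<in> coord_exps (insert i A)" using that supp zf f[OF i] by auto
      then show ?thesis by (auto simp: coord_exps_def)
    qed
    have row: "s * b $ i \<le> 0" if "b \<in> tsupp g" for b
    proof -
      have "s * (b + z) $ i \<in> (\<lambda>u. s * u $ i) ` tsupp (f i)" by (rule imageI) (use that supp in simp)
      then have "s * (b + z) $ i \<le> M" unfolding M_def using fin by (intro Max_ge) auto
      then show ?thesis using zf(2) by (simp add: distrib_left)
    qed
    have pos: "0 < the (g b) + adot b" if b: "b \<in> tsupp g" "b \<noteq> 0" "b $ i = 0" for b
    proof -
      have bA: "b \<in> coord_exps A" using cset[OF b(1)] b(3) by (auto simp: coord_exps_def)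
      have bz: "b + z \<in> tsupp (f i)" using b(1) supp by simp
      have "b + z \<in> R" using bz b(3) zf(2) by (simp add: R_def)
      then have "the (f i z) + expdot z w0 \<le> the (f i (b + z)) + expdot (b + z) w0" by (rule z(2))
      moreover have "the (f i (b + z)) + expdot (b + z) w0 \<noteq> the (f i z) + expdot z w0"
        using gen[OF i bz zf(1)] b(2) bA by simp
      ultimately show ?thesis using bz adot_coord[OF bA] by (simp add: g_def the_normal_at expdot_add)
    qed
    have "0 \<in> tsupp g" "the (g 0) = 0" using zf by (simp_all add: g_def tsupp_normal_at the_normal_at)
    then show ?thesis using gI cset row pos by (intro bexI[of _ g]) auto
  qed
  define good where "good i s h \<longleftrightarrow> h \<in> I \<and> 0 \<in> tsupp h \<and> the (h 0) = 0 \<and> tsupp h \<subseteq> coord_exps (insert i A) \<and>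
      (\<forall>b\<in>tsupp h. s * b $ i \<le> 0) \<and> (\<forall>b\<in>tsupp h. b \<noteq> 0 \<longrightarrow> b $ i = 0 \<longrightarrow> 0 < the (h b) + adot b)"
    for i and s :: int and h
  define g where "g i s = (SOME h. good i s h)" for i s
  have good: "good i s (g i s)" if "i \<notin> A" for i s
  proof -
    have "\<exists>h. good i s h" using wall[OF that, of s] unfolding good_def Bex_def .
    then show ?thesis unfolding g_def by (rule someI_ex)
  qed
  note g = good[unfolded good_def]
  define G1 where "G1 = (\<lambda>(i, s). g i s) ` ((- A) \<times> {-1, 1})"
  have G1: "finite G1" "\<And>h. h \<in> G1 \<Longrightarrow> finite (tsupp h)"
    using g finite_supp by (auto simp: G1_def)
  define C where "C = (\<Sum>h\<in>G1. \<Sum>b\<in>tsupp h. \<bar>the (h b) + adot b\<bar>)"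
  have C: "\<bar>the (h b) + adot b\<bar> \<le> C" if "h \<in> G1" "b \<in> tsupp h" for h b
  proof -
    have "\<bar>the (h b) + adot b\<bar> \<le> (\<Sum>b\<in>tsupp h. \<bar>the (h b) + adot b\<bar>)"
      using that G1 by (intro member_le_sum) auto
    also have "\<dots> \<le> C" unfolding C_def using that G1 by (intro member_le_sum) (auto intro: sum_nonneg)
    finally show ?thesis .
  qed
  have C0: "0 \<le> C" unfolding C_def by (intro sum_nonneg) auto
  \<comment> \<open>The extra \<open>1\<close> pays for the summand
    \<open>\<epsilon> \<le> 1\<close> that is lost in the estimate for steep points.\<close>
  define \<rho> where "\<rho> = C + 1"
  define W where "W = {w :: real ^ 'n. \<forall>i. w $ i \<in> (if i \<in> A then {w0 $ i} else {-\<rho>..\<rho>})}"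
  have "W = cbox (\<chi> i. if i \<in> A then w0 $ i else -\<rho>) (\<chi> i. if i \<in> A then w0 $ i else \<rho>)"
    by (auto simp: W_def mem_box_cart split: if_splits)
  then have W: "compact W" by simp
  have "w $ i = w0 $ i" if "w \<in> W" "i \<in> A" for w i
    using that(1)[unfolded W_def, THEN CollectD, rule_format, of i] that(2) by simp
  then have "W \<inter> trop_variety I = {}" using neg by blast
  then obtain G2 \<delta> where G2: "finite G2" "G2 \<subseteq> I" "0 < \<delta>"
    "\<And>w. w \<in> W \<Longrightarrow> \<exists>g\<in>G2. 0 \<in> tsupp g \<and> the (g 0) = 0 \<and> (\<forall>b\<in>tsupp g. b \<noteq> 0 \<longrightarrow> \<delta> < the (g b) + expdot b w)"
    using compact_good_family[OF W] by metis
  define B where "B = (\<Union>h\<in>G1 \<union> G2. tsupp h)"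
  have finB: "finite B" unfolding B_def using G1 G2 finite_supp by auto
  define \<beta> where "\<beta> = 1 + (\<Sum>b\<in>B. \<Sum>i\<in>UNIV. \<bar>b $ i\<bar>)"
  have \<beta>: "\<bar>b $ i\<bar> \<le> \<beta>" if "b \<in> B" for b i
  proof -
    have "\<bar>b $ i\<bar> \<le> (\<Sum>i\<in>UNIV. \<bar>b $ i\<bar>)" by (rule member_le_sum) auto
    also have "\<dots> \<le> (\<Sum>b\<in>B. \<Sum>i\<in>UNIV. \<bar>b $ i\<bar>)" using finB that by (intro member_le_sum) (auto intro: sum_nonneg)
    finally show ?thesis by (simp add: \<beta>_def)
  qed
  have \<beta>1: "1 \<le> \<beta>" unfolding \<beta>_def by (simp add: sum_nonneg)
  define n where "n = real CARD('n)"
  have n: "1 \<le> n" unfolding n_def by (simp add: Suc_leI)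
  \<comment> \<open>The second bound keeps the quadratic error of the linearisation below the gap
    \<open>\<delta>\<close>; the third gives \<open>\<beta> \<le> X0\<close>, so that an inward step
    from beyond \<open>X0\<close> does not cross the origin.\<close>
  define \<epsilon> where "\<epsilon> = min 1 (min (\<delta> / (2 * n * (real_of_int \<beta>)\<^sup>2)) (\<rho> / (2 * real_of_int \<beta>)))"
  have nb: "0 < 2 * n * (real_of_int \<beta>)\<^sup>2" "0 < 2 * real_of_int \<beta>" using n \<beta>1 by auto
  have \<epsilon>: "0 < \<epsilon>" "\<epsilon> \<le> 1" using nb G2(3) C0 by (auto simp: \<epsilon>_def \<rho>_def)
  have \<epsilon>\<delta>: "\<epsilon> * (n * (real_of_int \<beta>)\<^sup>2) < \<delta>"
  proof -
    have "\<epsilon> \<le> \<delta> / (2 * n * (real_of_int \<beta>)\<^sup>2)" by (simp add: \<epsilon>_def)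
    then have "\<epsilon> * (2 * n * (real_of_int \<beta>)\<^sup>2) \<le> \<delta>" using nb(1) by (simp add: pos_le_divide_eq)
    then show ?thesis using G2(3) by (simp add: algebra_simps)
  qed
  define X0 where "X0 = \<rho> / (2 * \<epsilon>)"
  have X0: "2 * \<epsilon> * X0 = \<rho>" using \<epsilon> by (simp add: X0_def)
  have X0\<beta>: "real_of_int \<beta> \<le> X0"
  proof -
    have "\<epsilon> \<le> \<rho> / (2 * real_of_int \<beta>)" by (simp add: \<epsilon>_def)
    then have "\<epsilon> * (2 * real_of_int \<beta>) \<le> \<rho>" using nb(2) by (simp add: pos_le_divide_eq)
    then show ?thesis using \<epsilon> by (simp add: X0_def pos_le_divide_eq algebra_simps)
  qed
  \<comment> \<open>Relations at points within \<open>X0\<close> reach at most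
    \<open>\<beta>\<close> further, and relations at points beyond \<open>X0\<close> move inwards.
    Hence no witness leaves the tube of half-width \<open>X1\<close>.\<close>
  define X1 where "X1 = \<lceil>X0\<rceil> + \<beta>"
  define \<theta> where "\<theta> u = adot u - \<epsilon> * (\<Sum>i\<in>-A. (real_of_int (u $ i))\<^sup>2)" for u :: "int ^ 'n"
  have \<theta>_diff: "\<theta> (u + b) - \<theta> u = adot b - \<epsilon> * (\<Sum>i\<in>-A. 2 * real_of_int (u $ i) * real_of_int (b $ i) + (real_of_int (b $ i))\<^sup>2)" for u b
  proof -
    have "(\<Sum>i\<in>-A. (real_of_int ((u + b) $ i))\<^sup>2) = (\<Sum>i\<in>-A. (real_of_int (u $ i))\<^sup>2) +
        (\<Sum>i\<in>-A. 2 * real_of_int (u $ i) * real_of_int (b $ i) + (real_of_int (b $ i))\<^sup>2)"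
      unfolding sum.distrib[symmetric] by (intro sum.cong) (auto simp: power2_sum)
    then show ?thesis by (simp add: \<theta>_def adot_add algebra_simps)
  qed
  define tube where "tube = {u :: int ^ 'n. \<forall>i. i \<notin> A \<longrightarrow> \<bar>u $ i\<bar> \<le> X1}"
  have umin_shift: "umin \<theta> (tshift u h) u"
    if "0 \<in> tsupp h" "the (h 0) = 0" "\<And>b. b \<in> tsupp h \<Longrightarrow> b \<noteq> 0 \<Longrightarrow> 0 < the (h b) + (\<theta> (u + b) - \<theta> u)" for u h
    unfolding umin_def
  proof (intro conjI ballI impI)
    show "u \<in> tsupp (tshift u h)" using that(1) by (simp add: mem_tsupp_tshift)
    fix v assume v: "v \<in> tsupp (tshift u h)" "v \<noteq> u"
    have "0 < the (h (v - u)) + (\<theta> (u + (v - u)) - \<theta> u)" using v by (intro that(3)) (auto simp: mem_tsupp_tshift)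
    then show "the (tshift u h u) + \<theta> u < the (tshift u h v) + \<theta> v" using that(2) by (simp add: tshift_def)
  qed
  have loop: "\<exists>r\<in>I. umin \<theta> r u \<and> (\<forall>x\<in>tsupp r. x \<in> tube \<and> (\<forall>i. \<bar>x $ i - u $ i\<bar> \<le> \<beta>))" if u: "u \<in> tube" for u
  proof (cases "\<exists>i. i \<notin> A \<and> X0 < \<bar>real_of_int (u $ i)\<bar>")
    case True
    then obtain i where i: "i \<notin> A" "X0 < \<bar>real_of_int (u $ i)\<bar>" by blast
    define s where "s = sgn (u $ i)"
    have "X0 > 0" using X0\<beta> \<beta>1 by linarith
    then have ui: "u $ i \<noteq> 0" using i(2) by auto
    then have s: "s \<in> {-1, 1}" "u $ i = s * \<bar>u $ i\<bar>" "s * s = 1" by (auto simp: s_def sgn_if)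
    define h where "h = g i s"
    note gi = g[OF i(1), of s, folded h_def]
    note hI = gi[THEN conjunct1] and h0 = gi[THEN conjunct2, THEN conjunct1]
      and h00 = gi[THEN conjunct2, THEN conjunct2, THEN conjunct1]
      and hA = gi[THEN conjunct2, THEN conjunct2, THEN conjunct2, THEN conjunct1]
      and hrow = gi[THEN conjunct2, THEN conjunct2, THEN conjunct2, THEN conjunct2, THEN conjunct1, rule_format]
      and hpos = gi[THEN conjunct2, THEN conjunct2, THEN conjunct2, THEN conjunct2, THEN conjunct2, rule_format]
    have hG: "h \<in> G1" using i(1) s(1) by (auto simp: h_def G1_def)
    have hB: "b \<in> B" if "b \<in> tsupp h" for b using that hG by (auto simp: B_def)
    have hk: "b $ k = 0" if "b \<in> tsupp h" "k \<notin> A" "k \<noteq> i" for b k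
    proof -
      have "b \<in> coord_exps (insert i A)" using hA that(1) by blast
      then show ?thesis using that by (simp add: coord_exps_def)
    qed
    have big: "\<beta> < \<bar>u $ i\<bar>" using i(2) X0\<beta> by linarith
    have umin: "umin \<theta> (tshift u h) u"
    proof (rule umin_shift)
      show "0 \<in> tsupp h" "the (h 0) = 0" by (fact h0, fact h00)
      fix b assume b: "b \<in> tsupp h" "b \<noteq> 0"
      have "(\<Sum>k\<in>-A. 2 * real_of_int (u $ k) * real_of_int (b $ k) + (real_of_int (b $ k))\<^sup>2) =
          (\<Sum>k\<in>{i}. 2 * real_of_int (u $ k) * real_of_int (b $ k) + (real_of_int (b $ k))\<^sup>2)"
        using hk[OF b(1)] i(1) by (intro sum.mono_neutral_right) auto
      then have diff: "\<theta> (u + b) - \<theta> u = adot b - \<epsilon> * (2 * real_of_int (u $ i) * real_of_int (b $ i) + (real_of_int (b $ i))\<^sup>2)"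
        by (simp add: \<theta>_diff)
      show "0 < the (h b) + (\<theta> (u + b) - \<theta> u)"
      proof (cases "b $ i = 0")
        case True
        then show ?thesis using hpos[OF b] by (simp add: diff)
      next
        case False
        define j where "j = real_of_int \<bar>b $ i\<bar>"
        define y where "y = real_of_int \<bar>u $ i\<bar>"
        have "s * b $ i \<le> 0" by (rule hrow[OF b(1)])
        then have bi: "b $ i = - s * \<bar>b $ i\<bar>" using s(1) by auto
        have ub: "u $ i * b $ i = - (\<bar>u $ i\<bar> * \<bar>b $ i\<bar>)"
        proof -
          have "u $ i * b $ i = (s * \<bar>u $ i\<bar>) * (- s * \<bar>b $ i\<bar>)" using s(2) bi by metis
          also have "\<dots> = - (s * s) * (\<bar>u $ i\<bar> * \<bar>b $ i\<bar>)" by (simp add: algebra_simps)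
          finally show ?thesis using s(3) by simp
        qed
        have ub': "real_of_int (u $ i) * real_of_int (b $ i) = - (y * j)"
          using arg_cong[OF ub, of real_of_int] by (simp add: y_def j_def)
        have j: "1 \<le> j" "j \<le> real_of_int \<beta>" using False \<beta>[OF hB[OF b(1)], of i] by (auto simp: j_def)
        have y: "X0 < y" using i(2) by (simp add: y_def)
        \<comment> \<open>The gain \<open>2 y j - j^2\<close> of an inward step is smallest for the
          shortest step \<open>j = 1\<close>.\<close>
        have "0 \<le> (j - 1) * (2 * y - j - 1)" using j y X0\<beta> by (intro mult_nonneg_nonneg) linarith+
        then have "2 * y - 1 \<le> 2 * y * j - j\<^sup>2" by (simp add: algebra_simps power2_eq_square)
        then have "\<epsilon> * (2 * y - 1) \<le> \<epsilon> * (2 * y * j - j\<^sup>2)" using \<epsilon> by (intro mult_left_mono) auto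
        moreover have "\<rho> < 2 * \<epsilon> * y" using X0 y \<epsilon> mult_strict_left_mono[of X0 y "2 * \<epsilon>"] by simp
        ultimately have "C < \<epsilon> * (2 * y * j - j\<^sup>2)" using \<epsilon> by (simp add: \<rho>_def algebra_simps)
        moreover have "2 * real_of_int (u $ i) * real_of_int (b $ i) + (real_of_int (b $ i))\<^sup>2 = - (2 * y * j - j\<^sup>2)"
        proof -
          have "(real_of_int (b $ i))\<^sup>2 = j\<^sup>2" by (simp add: j_def)
          then show ?thesis using ub' by linarith
        qed
        moreover have "- C \<le> the (h b) + adot b" using C[OF hG b(1)] by linarith
        ultimately show ?thesis unfolding diff by (simp add: right_diff_distrib)
      qed
    qed
    have rest: "x \<in> tube \<and> (\<forall>k. \<bar>x $ k - u $ k\<bar> \<le> \<beta>)" if x: "x \<in> tsupp (tshift u h)" for x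
    proof -
      define b where "b = x - u"
      have b: "b \<in> tsupp h" "x = u + b" using x by (auto simp: b_def mem_tsupp_tshift)
      have "\<bar>x $ k\<bar> \<le> X1" if k: "k \<notin> A" for k
      proof (cases "k = i")
        case True
        have "s * b $ i \<le> 0" by (rule hrow[OF b(1)])
        moreover have "\<bar>b $ i\<bar> \<le> \<bar>u $ i\<bar>" using \<beta>[OF hB[OF b(1)], of i] big by linarith
        ultimately have "\<bar>u $ i + b $ i\<bar> \<le> \<bar>u $ i\<bar>" using s(1,2) by auto
        also have "\<dots> \<le> X1" using u i(1) by (simp add: tube_def)
        finally show ?thesis using True b(2) by simp
      next
        case False
        then have "b $ k = 0" using hk[OF b(1) k] by simp
        then show ?thesis using u k b(2) by (simp add: tube_def)
      qed
      then show ?thesis using \<beta>[OF hB[OF b(1)]] b(2) by (simp add: tube_def)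
    qed
    have "tshift u h \<in> I" by (rule shift[OF hI])
    then show ?thesis using umin rest by blast
  next
    case False
    then have small: "\<bar>real_of_int (u $ i)\<bar> \<le> X0" if "i \<notin> A" for i using that by force
    \<comment> \<open>The slope of the weight at \<open>u\<close>; \<open>X0\<close> was chosen so
      that it stays within \<open>\<rho>\<close>, that is, in the compact set
      \<open>W\<close>.\<close>
    define w where "w = (\<chi> i. if i \<in> A then w0 $ i else - 2 * \<epsilon> * real_of_int (u $ i))"
    have "\<bar>2 * \<epsilon> * real_of_int (u $ i)\<bar> \<le> \<rho>" if "i \<notin> A" for i
    proof -
      have "2 * \<epsilon> * \<bar>real_of_int (u $ i)\<bar> \<le> 2 * \<epsilon> * X0" using small[OF that] \<epsilon> by (intro mult_left_mono) auto
      then show ?thesis using X0 \<epsilon> by (simp add: abs_mult)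
    qed
    then have "w \<in> W" by (auto simp: W_def w_def abs_le_iff)
    then have "\<exists>g\<in>G2. 0 \<in> tsupp g \<and> the (g 0) = 0 \<and> (\<forall>b\<in>tsupp g. b \<noteq> 0 \<longrightarrow> \<delta> < the (g b) + expdot b w)"
      by (rule G2(4))
    then obtain h where hG: "h \<in> G2"
      and hw: "0 \<in> tsupp h \<and> the (h 0) = 0 \<and> (\<forall>b\<in>tsupp h. b \<noteq> 0 \<longrightarrow> \<delta> < the (h b) + expdot b w)"
      by (rule bexE)
    note h = hG hw[THEN conjunct1] hw[THEN conjunct2, THEN conjunct1] hw[THEN conjunct2, THEN conjunct2, rule_format]
    have hB: "b \<in> B" if "b \<in> tsupp h" for b using that h(1) by (auto simp: B_def)
    have umin: "umin \<theta> (tshift u h) u"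
    proof (rule umin_shift[OF h(2,3)])
      fix b assume b: "b \<in> tsupp h" "b \<noteq> 0"
      have "expdot b w = adot b - \<epsilon> * (\<Sum>i\<in>-A. 2 * real_of_int (u $ i) * real_of_int (b $ i))"
        unfolding expdot_split adot_def sum_distrib_left sum_negf[symmetric] diff_conv_add_uminus
        by (intro arg_cong2[where f = "(+)"] sum.cong) (auto simp: w_def)
      moreover have "(\<Sum>i\<in>-A. (real_of_int (b $ i))\<^sup>2) \<le> n * (real_of_int \<beta>)\<^sup>2"
      proof -
        have "(\<Sum>i\<in>-A. (real_of_int (b $ i))\<^sup>2) \<le> (\<Sum>i\<in>-A. (real_of_int \<beta>)\<^sup>2)"
        proof (rule sum_mono)
          fix i
          have "\<bar>real_of_int (b $ i)\<bar> \<le> \<bar>real_of_int \<beta>\<bar>" using \<beta>[OF hB[OF b(1)], of i] by linarith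
          then show "(real_of_int (b $ i))\<^sup>2 \<le> (real_of_int \<beta>)\<^sup>2" by (simp add: abs_le_square_iff)
        qed
        also have "\<dots> = real (card (- A)) * (real_of_int \<beta>)\<^sup>2" by simp
        also have "\<dots> \<le> n * (real_of_int \<beta>)\<^sup>2" unfolding n_def
          by (intro mult_right_mono) (auto intro: card_mono)
        finally show ?thesis .
      qed
      then have "\<epsilon> * (\<Sum>i\<in>-A. (real_of_int (b $ i))\<^sup>2) \<le> \<epsilon> * (n * (real_of_int \<beta>)\<^sup>2)"
        using \<epsilon> by (intro mult_left_mono) auto
      ultimately show "0 < the (h b) + (\<theta> (u + b) - \<theta> u)"
        unfolding \<theta>_diff sum.distrib distrib_left using h(4)[OF b] \<epsilon>\<delta> by linarith
    qed
    have rest: "x \<in> tube \<and> (\<forall>k. \<bar>x $ k - u $ k\<bar> \<le> \<beta>)" if x: "x \<in> tsupp (tshift u h)" for x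
    proof -
      define b where "b = x - u"
      have b: "b \<in> tsupp h" "x = u + b" using x by (auto simp: b_def mem_tsupp_tshift)
      note bb = \<beta>[OF hB[OF b(1)]]
      have "\<bar>x $ k\<bar> \<le> X1" if k: "k \<notin> A" for k
      proof -
        have "\<bar>u $ k\<bar> \<le> \<lceil>X0\<rceil>" using small[OF k] by linarith
        then show ?thesis using bb[of k] b(2) by (simp add: X1_def)
      qed
      then show ?thesis using bb b(2) by (simp add: tube_def)
    qed
    have "tshift u h \<in> I" using h(1) G2(2) shift by blast
    then show ?thesis using umin rest by blast
  qed
  define q where "q = card {-X1..X1} ^ card (- A)"
  obtain N :: nat where N: "real_of_int \<beta> \<le> real N"
    "real q * ((2 * real N + 1) ^ card A - (2 * real N + 1 - 2 * real_of_int \<beta>) ^ card A) < (2 * real N + 1) ^ card A"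
    using boundary_count[of "real_of_int \<beta>" "real q" "card A"] \<beta>1 by auto
  define S where "S = {u :: int ^ 'n. \<forall>i. u $ i \<in> (if i \<in> A then {-int N..int N} else {-X1..X1})}"
  \<comment> \<open>In the directions of \<open>A\<close> a distance \<open>\<beta>\<close> from the
    ends is kept, so that the relation exhibiting a point as a loop stays in \<open>S\<close>. In
    the other directions the tube already contains it.\<close>
  define S0 where "S0 = {u :: int ^ 'n. \<forall>i. u $ i \<in> (if i \<in> A then {-(int N - \<beta>)..int N - \<beta>} else {-X1..X1})}"
  define T where "T = {u :: int ^ 'n. \<forall>i. u $ i \<in> (if i \<in> A then {-int N..int N} else {0})}"
  have X1: "0 \<le> X1" using X0\<beta> \<beta>1 unfolding X1_def by linarith
  have finS: "finite S" unfolding S_def by (rule finite_vec_box) simp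
  have TS: "T \<subseteq> S" using X1 by (auto simp: T_def S_def split: if_splits)
  have indT: "indep T" by (rule indep_mono[OF indA]) (auto simp: T_def coord_exps_def split: if_splits)
  have S0S: "S0 \<subseteq> S"
  proof
    fix u assume u: "u \<in> S0"
    have "u $ i \<in> (if i \<in> A then {-int N..int N} else {-X1..X1})" for i
      using u[unfolded S0_def, THEN CollectD, rule_format, of i] \<beta>1 by (auto split: if_splits)
    then show "u \<in> S" by (simp add: S_def)
  qed
  have "card T \<le> card (S - S0)"
  proof (rule card_indep_le_diff_umin[OF finS indT TS, of _ \<theta>])
    fix u assume u: "u \<in> S0"
    have uA: "\<bar>u $ i\<bar> \<le> int N - \<beta>" if "i \<in> A" for i
      using u[unfolded S0_def, THEN CollectD, rule_format, of i] that by auto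
    have "\<bar>u $ i\<bar> \<le> X1" if "i \<notin> A" for i
      using u[unfolded S0_def, THEN CollectD, rule_format, of i] that by auto
    then have "u \<in> tube" by (simp add: tube_def)
    then obtain r where r: "r \<in> I" "umin \<theta> r u" "\<And>x. x \<in> tsupp r \<Longrightarrow> x \<in> tube \<and> (\<forall>i. \<bar>x $ i - u $ i\<bar> \<le> \<beta>)"
      using loop by blast
    have "tsupp r \<subseteq> S"
    proof
      fix x assume x: "x \<in> tsupp r"
      have "x $ i \<in> (if i \<in> A then {-int N..int N} else {-X1..X1})" for i
      proof (cases "i \<in> A")
        case True
        have "\<bar>x $ i - u $ i\<bar> \<le> \<beta>" using r(3)[OF x] by blast
        then have "\<bar>x $ i\<bar> \<le> int N" using uA[OF True] by linarith
        then show ?thesis using True by (simp add: abs_le_iff)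
      next
        case False
        then show ?thesis using r(3)[OF x] by (auto simp: tube_def abs_le_iff)
      qed
      then show "x \<in> S" by (simp add: S_def)
    qed
    then show "\<exists>f\<in>I. tsupp f \<subseteq> S \<and> umin \<theta> f u" using r by blast
  qed
  also have "card (S - S0) = card S - card S0" using S0S finS finite_subset by (intro card_Diff_subset) auto
  finally have "real (card T) \<le> real (card S) - real (card S0)"
    using card_mono[OF finS S0S] by linarith
  moreover have "real (card T) = (2 * real N + 1) ^ card A"
    unfolding T_def card_int_box by (simp add: algebra_simps)
  moreover have "real (card S) = real q * (2 * real N + 1) ^ card A"
    unfolding S_def card_int_box q_def by (simp add: algebra_simps)
  moreover have "real (card S0) = real q * (2 * real N + 1 - 2 * real_of_int \<beta>) ^ card A"
  proof -
    have "\<beta> \<le> int N" using N(1) by linarith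
    then have "real (card {-(int N - \<beta>)..int N - \<beta>}) = 2 * real N + 1 - 2 * real_of_int \<beta>" by simp
    then show ?thesis unfolding S0_def card_int_box q_def by (simp add: mult.commute)
  qed
  ultimately show False using N(2) by (simp add: right_diff_distrib)
qed

end

section \<open>Dimension of the variety\<close>

text \<open>Take a point of \<open>P\<close> on the fewest hyperplanes. A small step towards any
  \<open>q\<close> in \<open>P\<close> creates no new incidences, so by minimality it destroys none,
  and every form vanishing at that point vanishes at \<open>q\<close>.\<close>

lemma convex_in_one_hyperplane:
  fixes P :: "'a::euclidean_space set"
  assumes P: "convex P" "P \<noteq> {}" and H: "finite H" and cover: "\<And>w. w \<in> P \<Longrightarrow> \<exists>a\<in>H. aval a w = 0"
  obtains a where "a \<in> H" "\<And>w. w \<in> P \<Longrightarrow> aval a w = 0"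
proof -
  let ?Z = "\<lambda>w. {a \<in> H. aval a w = 0}"
  obtain p where p: "p \<in> P" "\<And>w. w \<in> P \<Longrightarrow> card (?Z p) \<le> card (?Z w)"
    using ex_has_least_nat[of "\<lambda>w. w \<in> P" _ "\<lambda>w. card (?Z w)"] P(2) by blast
  obtain a where a: "a \<in> H" "aval a p = 0" using cover[OF p(1)] by blast
  have "aval a q = 0" if q: "q \<in> P" for q
  proof (rule ccontr)
    assume aq: "aval a q \<noteq> 0"
    obtain e where e: "0 < e" "\<forall>b\<in>{b \<in> H. aval b p \<noteq> 0}. e * \<bar>aval b q - aval b p\<bar> < \<bar>aval b p\<bar>"
      using finite_small_step[of "{b \<in> H. aval b p \<noteq> 0}" "\<lambda>b. \<bar>aval b p\<bar>" "\<lambda>b. aval b q - aval b p"] H by auto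
    define t where "t = min e 1"
    have t: "0 < t" "t \<le> 1" "t \<le> e" using e(1) by (auto simp: t_def)
    define x where "x = (1 - t) *\<^sub>R p + t *\<^sub>R q"
    have xP: "x \<in> P" unfolding x_def using P(1) p(1) q t by (intro convexD) auto
    have ax: "aval b x = aval b p + t * (aval b q - aval b p)" for b
      unfolding x_def by (subst aval_combine) (auto simp: algebra_simps)
    have "?Z x \<subset> ?Z p"
    proof (rule psubsetI)
      show "?Z x \<subseteq> ?Z p"
      proof (safe, rule ccontr)
        fix b c assume b: "(b, c) \<in> H" "aval (b, c) x = 0" "aval (b, c) p \<noteq> 0"
        have "t * \<bar>aval (b, c) q - aval (b, c) p\<bar> \<le> e * \<bar>aval (b, c) q - aval (b, c) p\<bar>"
          using t by (intro mult_right_mono) auto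
        also have "\<dots> < \<bar>aval (b, c) p\<bar>" using e(2)[rule_format, of "(b, c)"] b by simp
        finally have "\<bar>t * (aval (b, c) q - aval (b, c) p)\<bar> < \<bar>aval (b, c) p\<bar>" using t by (simp add: abs_mult)
        then show False using ax[of "(b, c)"] b(2) by linarith
      qed
      have "aval a x \<noteq> 0" using ax[of a] a(2) aq t by simp
      then show "?Z x \<noteq> ?Z p" using a by blast
    qed
    then have "card (?Z x) < card (?Z p)" using H by (intro psubset_card_mono) auto
    then show False using p(2)[OF xP] by simp
  qed
  then show thesis using that a(1) by blast
qed

definition cspace :: "'n set \<Rightarrow> (real ^ 'n) set" where
  "cspace A = {x. \<forall>i. i \<notin> A \<longrightarrow> x $ i = 0}"

lemma subspace_cspace: "subspace (cspace A)"
  by (auto simp: cspace_def subspace_def)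

lemma dim_cspace: "dim (cspace A) = card A"
  unfolding cspace_def using dim_substandard_cart[of A, where 'a = real] by (simp only: dim_vec_eq)

definition cproj :: "'n set \<Rightarrow> real ^ 'n \<Rightarrow> real ^ 'n" where
  "cproj A x = (\<chi> i. if i \<in> A then x $ i else 0)"

lemma linear_cproj: "linear (cproj A)"
  by (rule linearI) (auto simp: cproj_def vec_eq_iff)

lemma cproj_in_cspace: "cproj A x \<in> cspace A"
  by (simp add: cproj_def cspace_def)

lemma inner_cspace: "c \<in> cspace A \<Longrightarrow> c \<bullet> x = c \<bullet> cproj A x"
  by (auto simp: inner_vec_def cproj_def cspace_def intro!: sum.cong)

text \<open>A maximal coordinate set on which no nonzero vector is orthogonal to \<open>W\<close> separates the points of \<open>W\<close>.\<close>

lemma coordinates_transversal: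
  fixes W :: "(real ^ 'n) set"
  assumes W: "subspace W" and k: "k \<le> dim W"
  obtains A :: "'n set" where "card A = k" "\<And>c. c \<in> cspace A \<Longrightarrow> (\<And>x. x \<in> W \<Longrightarrow> c \<bullet> x = 0) \<Longrightarrow> c = 0"
proof -
  define Q where "Q A \<longleftrightarrow> (\<forall>c\<in>cspace A. (\<forall>x\<in>W. c \<bullet> x = 0) \<longrightarrow> c = 0)" for A :: "'n set"
  have "Q {}" by (auto simp: Q_def cspace_def vec_eq_iff)
  moreover have "\<forall>A. Q A \<longrightarrow> card A < Suc CARD('n)" by (simp add: card_mono less_Suc_eq_le)
  ultimately obtain A where A: "Q A" "\<And>A'. Q A' \<Longrightarrow> card A' \<le> card A"
    using ex_has_greatest_nat[of Q "{}" card "Suc CARD('n)"] by blast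
  \<comment> \<open>Suppose \<open>x\<close> in \<open>W\<close> vanishes on \<open>A\<close> but
    not at \<open>j\<close>. By maximality some nonzero \<open>c\<close> on
    \<open>insert j A\<close> is orthogonal to \<open>W\<close>. Its product with \<open>x\<close>
    is the single term at \<open>j\<close>, so \<open>c\<close> is already supported on
    \<open>A\<close>, which is excluded.\<close>
  have "inj_on (cproj A) W"
  proof -
    have "x = 0" if x: "x \<in> W" "cproj A x = 0" for x
    proof (rule ccontr)
      assume "x \<noteq> 0"
      then obtain j where j: "x $ j \<noteq> 0" by (auto simp: vec_eq_iff)
      have xA: "x $ i = 0" if "i \<in> A" for i
        using x(2) that by (auto simp: cproj_def vec_eq_iff split: if_splits)
      have jA: "j \<notin> A" using j xA by blast
      have "\<not> Q (insert j A)" using A(2)[of "insert j A"] jA by (auto simp: card_insert_if)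
      then obtain c where c: "c \<in> cspace (insert j A)" "\<forall>x\<in>W. c \<bullet> x = 0" "c \<noteq> 0" unfolding Q_def by blast
      have "c \<bullet> x = (\<Sum>i\<in>UNIV. if i = j then c $ j * x $ j else 0)"
        unfolding inner_vec_def using c(1) xA by (intro sum.cong) (auto simp: cspace_def)
      then have "c $ j * x $ j = 0" using c(2) x(1) by simp
      then have "c \<in> cspace A" using j c(1) by (auto simp: cspace_def)
      then show False using A(1) c(2,3) unfolding Q_def by blast
    qed
    then show ?thesis using W by (simp add: linear_injective_on_subspace_0[OF linear_cproj])
  qed
  then have "dim W = dim (cproj A ` W)"
    using dim_image_eq[OF linear_cproj] W by (metis span_eq_iff)
  also have "\<dots> \<le> dim (cspace A)" by (rule dim_subset) (use cproj_in_cspace in blast)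
  finally have "k \<le> card A" using k by (simp add: dim_cspace)
  then obtain A' where A': "A' \<subseteq> A" "card A' = k" using obtain_subset_with_card_n by metis
  then have "cspace A' \<subseteq> cspace A" by (auto simp: cspace_def)
  then show thesis using that[OF A'(2)] A(1) unfolding Q_def by blast
qed

text \<open>The projection of \<open>W\<close> to the coordinates in \<open>A\<close> is too small
  to fill \<open>cspace A\<close>. A vector of \<open>cspace A\<close> orthogonal to the projection
  is orthogonal to \<open>W\<close>, since it sees no other coordinates.\<close>

lemma orthogonal_in_cspace:
  fixes W :: "(real ^ 'n) set" and A :: "'n set"
  assumes W: "subspace W" and d: "dim W < card A"
  obtains c where "c \<in> cspace A" "c \<noteq> 0" "\<And>x. x \<in> W \<Longrightarrow> c \<bullet> x = 0"
proof -
  let ?S = "cproj A ` W"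
  let ?O = "{y \<in> cspace A. \<forall>x\<in>?S. orthogonal x y}"
  have "subspace ?S" using linear_subspace_image[OF linear_cproj W] .
  then have "dim ?O + dim ?S = dim (cspace A)"
    by (rule dim_subspace_orthogonal_to_vectors[OF _ subspace_cspace]) (use cproj_in_cspace in blast)
  moreover have "dim ?S \<le> dim W" by (rule dim_image_le[OF linear_cproj])
  ultimately have "dim ?O \<noteq> 0" using d dim_cspace[of A] by linarith
  then have "\<not> ?O \<subseteq> {0}" unfolding dim_eq_0 .
  then obtain c where c: "c \<in> cspace A" "\<forall>x\<in>?S. orthogonal x c" "c \<noteq> 0" by blast
  have "c \<bullet> x = 0" if "x \<in> W" for x
    using c(2) that inner_cspace[OF c(1), of x] by (auto simp: orthogonal_def inner_commute)
  then show thesis using that c by blast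
qed

lemma aff_dim_directions:
  assumes "p \<in> P"
  shows "aff_dim P = int (dim (span ((\<lambda>x. x - p) ` P)))"
  using aff_dim_eq_dim_subtract[of p P] assms hull_inc[of p P affine] by (simp add: dim_span)

section \<open>Upper and lower bounds for the dimension of the cells\<close>

context laurent_ideal
begin

text \<open>By convexity one tie of the relation holds throughout \<open>P\<close>. Its normal is a
  nonzero vector supported on \<open>A\<close> and orthogonal to all directions of \<open>P\<close>,
  which the choice of \<open>A\<close> forbids.\<close>

lemma aff_dim_le_of_dependent:
  assumes P: "convex P" "P \<subseteq> trop_variety I"
    and dep: "\<And>A. card A = Suc d \<Longrightarrow> \<not> indep (coord_exps A)"
  shows "aff_dim P \<le> int d"
proof (rule ccontr)
  assume neg: "\<not> ?thesis"
  then have "P \<noteq> {}" by auto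
  then obtain p where p: "p \<in> P" by blast
  define W where "W = span ((\<lambda>x. x - p) ` P)"
  have "Suc d \<le> dim W" using neg aff_dim_directions[OF p] by (simp add: W_def)
  then obtain A :: "'n set" where A: "card A = Suc d"
    "\<And>c. c \<in> cspace A \<Longrightarrow> (\<And>x. x \<in> W \<Longrightarrow> c \<bullet> x = 0) \<Longrightarrow> c = 0"
    using coordinates_transversal[of W "Suc d"] unfolding W_def by (metis subspace_span)
  obtain f where f: "f \<in> I" "tsupp f \<subseteq> coord_exps A" "f \<noteq> tzero"
    using dep[OF A(1)] unfolding indep_def by blast
  define H where "H = (\<lambda>(u, b). (rvec b - rvec u, the (f b) - the (f u))) ` {(u, b) \<in> tsupp f \<times> tsupp f. u \<noteq> b}"
  have "finite ({(u, b) \<in> tsupp f \<times> tsupp f. u \<noteq> b})"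
    by (rule finite_subset[of _ "tsupp f \<times> tsupp f"]) (use finite_supp[OF f(1)] in auto)
  then have finH: "finite H" unfolding H_def by (rule finite_imageI)
  have "\<exists>a\<in>H. aval a w = 0" if "w \<in> P" for w
  proof -
    have "min_attained_twice f w" using that P(2) f(1,3) unfolding trop_variety_def by blast
    then obtain u b where ub: "u \<noteq> b" "u \<in> tsupp f" "b \<in> tsupp f" "the (f u) + expdot u w = the (f b) + expdot b w"
      unfolding min_attained_twice_def by blast
    have "aval (rvec b - rvec u, the (f b) - the (f u)) w = 0"
      using ub(4) by (simp add: aval_def expdot_inner inner_diff_left)
    moreover have "(rvec b - rvec u, the (f b) - the (f u)) \<in> H" unfolding H_def using ub by auto
    ultimately show ?thesis by blast
  qed
  then obtain a where a: "a \<in> H" "\<And>w. w \<in> P \<Longrightarrow> aval a w = 0"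
    using convex_in_one_hyperplane[OF P(1) \<open>P \<noteq> {}\<close> finH] by blast
  obtain u b where ub: "u \<in> tsupp f" "b \<in> tsupp f" "u \<noteq> b" "fst a = rvec (b - u)"
    using a(1) unfolding H_def by (auto simp: rvec_diff)
  have "u \<in> coord_exps A" "b \<in> coord_exps A" using f(2) ub by auto
  then have "fst a \<in> cspace A" unfolding ub(4) by (auto simp: cspace_def coord_exps_def rvec_def)
  moreover have "fst a \<bullet> x = 0" if "x \<in> W" for x
    using that unfolding W_def
  proof (induction rule: span_induct)
    case base
    have "subspace {x. fst a \<bullet> x = 0}" by (rule subspace_hyperplane)
    then show ?case .
  next
    case (step x)
    then obtain y where "y \<in> P" "x = y - p" by blast
    then show ?case using a(2)[OF p] a(2)[of y] by (simp add: aval_def inner_diff_right)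
  qed
  ultimately have "fst a = 0" by (rule A(2))
  then show False using ub(3,4) by simp
qed

text \<open>If all cells were too small, each would project into a hyperplane of the coordinates in
  \<open>A\<close>. A point \<open>w0\<close> off these hyperplanes would have no point of the
  variety above it.\<close>

lemma aff_dim_ge_of_independent:
  fixes A :: "'n set"
  assumes C: "finite C" "\<Union>C = trop_variety I"
    and ind: "indep (coord_exps A)" and dep: "\<And>i. i \<notin> A \<Longrightarrow> \<not> indep (coord_exps (insert i A))"
  shows "\<exists>P\<in>C. int (card A) \<le> aff_dim P"
proof (rule ccontr)
  assume neg: "\<not> ?thesis"
  define f where "f i = (SOME f. f \<in> I \<and> f \<noteq> tzero \<and> tsupp f \<subseteq> coord_exps (insert i A))" for i
  have f: "f i \<in> I \<and> f i \<noteq> tzero \<and> tsupp (f i) \<subseteq> coord_exps (insert i A)" if "i \<notin> A" for i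
  proof -
    have "\<exists>f. f \<in> I \<and> f \<noteq> tzero \<and> tsupp f \<subseteq> coord_exps (insert i A)"
      using dep[OF that] unfolding indep_def by blast
    then show ?thesis unfolding f_def by (rule someI_ex)
  qed
  have "\<exists>a. fst a \<in> cspace A \<and> fst a \<noteq> 0 \<and> (\<forall>x\<in>P. aval a x = 0)" if P: "P \<in> C" "P \<noteq> {}" for P
  proof -
    obtain p where p: "p \<in> P" using P(2) by blast
    have "dim (span ((\<lambda>x. x - p) ` P)) < card A" using neg P(1) aff_dim_directions[OF p] by force
    then obtain c where c: "c \<in> cspace A" "c \<noteq> 0" "\<And>x. x \<in> span ((\<lambda>x. x - p) ` P) \<Longrightarrow> c \<bullet> x = 0"
      using orthogonal_in_cspace[OF subspace_span] by metis
    have "aval (c, - (c \<bullet> p)) x = 0" if "x \<in> P" for x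
      using c(3)[of "x - p"] that by (simp add: aval_def inner_diff_right span_base)
    then show ?thesis using c(1,2) by (intro exI[of _ "(c, - (c \<bullet> p))"]) auto
  qed
  then obtain h where h: "\<And>P. P \<in> C \<Longrightarrow> P \<noteq> {} \<Longrightarrow> fst (h P) \<in> cspace A \<and> fst (h P) \<noteq> 0 \<and> (\<forall>x\<in>P. aval (h P) x = 0)"
    by metis
  \<comment> \<open>\<open>H1\<close> confines the projected cells, and \<open>H2\<close> collects
    the ties that would spoil the genericity required for the projection argument.\<close>
  define H1 where "H1 = h ` {P \<in> C. P \<noteq> {}}"
  define H2 where "H2 = (\<Union>i\<in>-A. (\<lambda>(u, b). (rvec b - rvec u, the (f i b) - the (f i u))) `
      {(u, b) \<in> tsupp (f i) \<times> tsupp (f i). u \<noteq> b \<and> b - u \<in> coord_exps A})"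
  have "finite {(u, b) \<in> tsupp (f i) \<times> tsupp (f i). u \<noteq> b \<and> b - u \<in> coord_exps A}" if "i \<notin> A" for i
    by (rule finite_subset[of _ "tsupp (f i) \<times> tsupp (f i)"]) (use finite_supp f[OF that] in auto)
  then have finH: "finite (H1 \<union> H2)" unfolding H1_def H2_def using C(1) by auto
  have "\<exists>w0. \<forall>a\<in>H1 \<union> H2. aval a w0 \<noteq> 0"
  proof (rule ccontr)
    assume "\<not> ?thesis"
    then obtain a where a: "a \<in> H1 \<union> H2" "\<And>w. aval a w = 0"
      using convex_in_one_hyperplane[of UNIV "H1 \<union> H2"] finH by auto
    have "snd a = 0" using a(2)[of 0] by (simp add: aval_def)
    then have "fst a = 0" using a(2)[of "fst a"] by (simp add: aval_def)
    moreover have "fst a \<noteq> 0"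
    proof (cases "a \<in> H1")
      case True
      then show ?thesis using h by (auto simp: H1_def)
    next
      case False
      then have "a \<in> H2" using a(1) by blast
      then obtain u b where "u \<noteq> b" "fst a = rvec (b - u)" unfolding H2_def by (auto simp: rvec_diff)
      then show ?thesis by simp
    qed
    ultimately show False by blast
  qed
  then obtain w0 where w0: "\<And>a. a \<in> H1 \<union> H2 \<Longrightarrow> aval a w0 \<noteq> 0" by blast
  have gen: "the (f i u) + expdot u w0 \<noteq> the (f i v) + expdot v w0"
    if i: "i \<notin> A" "u \<in> tsupp (f i)" "v \<in> tsupp (f i)" "u \<noteq> v" "u - v \<in> coord_exps A" for i u v
  proof -
    have "(rvec u - rvec v, the (f i u) - the (f i v)) \<in> H2"
      unfolding H2_def using i by (intro UN_I[of i]) (auto intro!: image_eqI[of _ _ "(v, u)"])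
    then have "aval (rvec u - rvec v, the (f i u) - the (f i v)) w0 \<noteq> 0" using w0 by blast
    then show ?thesis by (simp add: aval_def expdot_inner inner_diff_left)
  qed
  obtain w where w: "w \<in> trop_variety I" "\<forall>i\<in>A. w $ i = w0 $ i"
    using independent_projection_onto_generic[OF ind f gen] by blast
  then obtain P where P: "P \<in> C" "w \<in> P" using C(2) by blast
  then have ne: "P \<noteq> {}" by blast
  note hP = h[OF P(1) ne]
  have "cproj A w = cproj A w0" using w(2) by (simp add: cproj_def vec_eq_iff)
  then have "fst (h P) \<bullet> w = fst (h P) \<bullet> w0" using inner_cspace[of "fst (h P)" A] hP by metis
  moreover have "aval (h P) w = 0" using hP P(2) by blast
  ultimately have "aval (h P) w0 = 0" by (simp add: aval_def)
  moreover have "h P \<in> H1" using P(1) ne by (simp add: H1_def)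
  ultimately show False using w0 by blast
qed

end

section \<open>The Hilbert function\<close>

lemma tsupp_tadd: "tsupp (tadd f g) = tsupp f \<union> tsupp g"
proof -
  have "tmin a b = None \<longleftrightarrow> a = None \<and> b = None" for a b by (cases a; cases b) auto
  then show ?thesis by (auto simp: tsupp_def tadd_def)
qed

text \<open>Distributivity in the case met when a multiplier is split into monomials.\<close>

lemma tmult_tadd_disjoint:
  assumes fin: "finite (tsupp p)" "finite (tsupp q)" "finite (tsupp F)" and disj: "tsupp p \<inter> tsupp q = {}"
  shows "tmult (tadd p q) F = tadd (tmult p F) (tmult q F)"
proof
  fix u
  define S where "S r = {(v, w). v \<in> tsupp r \<and> w \<in> tsupp F \<and> v + w = u}" for r
  define R where "R r = (\<lambda>(v, w). the (r v) + the (F w)) ` S r" for r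
  have finS: "finite (S r)" if "finite (tsupp r)" for r
    by (rule finite_subset[of _ "tsupp r \<times> tsupp F"]) (use that fin(3) in \<open>auto simp: S_def\<close>)
  have S: "S (tadd p q) = S p \<union> S q" by (auto simp: S_def tsupp_tadd)
  have "tadd p q v = p v" if "v \<in> tsupp p" for v
  proof -
    have "v \<notin> tsupp q" using that disj by blast
    then show ?thesis by (cases "p v") (simp_all add: tadd_def tsupp_def)
  qed
  moreover have "tadd p q v = q v" if "v \<in> tsupp q" for v
  proof -
    have "v \<notin> tsupp p" using that disj by blast
    then show ?thesis by (simp add: tadd_def tsupp_def)
  qed
  ultimately have R: "R (tadd p q) = R p \<union> R q"
    unfolding R_def S image_Un by (intro arg_cong2[where f = "(\<union>)"] image_cong) (auto simp: S_def)
  have val: "tmult r F u = (if S r = {} then None else Some (Min (R r)))" for r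
    by (simp add: tmult_def Let_def S_def R_def)
  show "tmult (tadd p q) F u = tadd (tmult p F) (tmult q F) u"
  proof (cases "S p = {} \<or> S q = {}")
    case True
    moreover have "R r = {}" if "S r = {}" for r using that by (simp add: R_def)
    ultimately show ?thesis unfolding tadd_def[of "tmult p F"] val R S by auto
  next
    case False
    then have "Min (R p \<union> R q) = min (Min (R p)) (Min (R q))"
      using finS fin unfolding R_def by (intro Min_Un) auto
    then show ?thesis using False unfolding tadd_def[of "tmult p F"] val R S by simp
  qed
qed

text \<open>The degree \<open>k\<close> part, dehomogenized by setting \<open>x_0\<close> to the
  tropical one, which is the real number \<open>0\<close>.\<close>

definition hcomp :: "int \<Rightarrow> (int \<times> (int ^ 'n)) tpoly \<Rightarrow> (int ^ 'n) tpoly" where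
  "hcomp k F = (\<lambda>u. F (k - total_deg u, u))"

lemma tsupp_tzero [simp]: "tsupp tzero = {}"
  by (simp add: tsupp_def tzero_def)

lemma hcomp_tzero [simp]: "hcomp k tzero = tzero"
  by (simp add: hcomp_def tzero_def)

lemma hcomp_scale_shift: "hcomp k (tscale c (tshift (a, s) F)) = tscale c (tshift s (hcomp (k - a - total_deg s) F))"
  by (rule ext) (simp add: hcomp_def tscale_def tshift_def total_deg_diff algebra_simps)

lemma hcomp_homogenize: "hcomp k (homogenize f) = (if k = Max (total_deg ` tsupp f) then f else tzero)"
  by (auto simp: hcomp_def homogenize_def tzero_def Let_def)

lemma homogenize_eq: "homogenize f (a, u) = (if a = Max (total_deg ` tsupp f) - total_deg u then f u else None)"
  by (simp add: homogenize_def Let_def)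

context laurent_ideal
begin

abbreviation hom_ideal :: "(int \<times> (int ^ 'n)) tpoly set" where
  "hom_ideal \<equiv> homogenization_ideal (I \<inter> tpolys poly_exps)"

text \<open>The homogenization ideal is given as an intersection. This explicit ideal contains the
  generators and so bounds it from above.\<close>

definition comp_ideal :: "(int \<times> (int ^ 'n)) tpoly set" where
  "comp_ideal = {F \<in> tpolys hpoly_exps. \<forall>k. hcomp k F \<in> I}"

lemma tadd_I: "f \<in> I \<Longrightarrow> g \<in> I \<Longrightarrow> tadd f g \<in> I"
  using semiring by (simp add: semiring_ideal_def)

lemma tzero_I: "tzero \<in> I"
  using semiring by (simp add: semiring_ideal_def)

lemma comp_ideal_tadd:
  assumes "F \<in> comp_ideal" "G \<in> comp_ideal"
  shows "tadd F G \<in> comp_ideal"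
proof -
  have "hcomp k (tadd F G) = tadd (hcomp k F) (hcomp k G)" for k by (simp add: hcomp_def tadd_def)
  then show ?thesis using assms tadd_I by (auto simp: comp_ideal_def tpolys_def tsupp_tadd)
qed

lemma tzero_comp_ideal: "tzero \<in> comp_ideal"
  using tzero_I by (simp add: comp_ideal_def tpolys_def)

lemma comp_ideal_scale_shift:
  assumes F: "F \<in> comp_ideal" and x: "x \<in> hpoly_exps"
  shows "tscale c (tshift x F) \<in> comp_ideal"
proof -
  obtain a s where as: "x = (a, s)" by (cases x)
  have "hcomp k (tscale c (tshift x F)) \<in> I" for k
    unfolding as hcomp_scale_shift using F by (intro scale_shift) (simp add: comp_ideal_def)
  moreover have "tscale c (tshift x F) \<in> tpolys hpoly_exps"
    using F x by (auto simp: comp_ideal_def tpolys_def tsupp_tshift hpoly_exps_def)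
  ultimately show ?thesis by (simp add: comp_ideal_def)
qed

lemma comp_ideal_tmult:
  assumes F: "F \<in> comp_ideal"
  shows "p \<in> tpolys hpoly_exps \<Longrightarrow> tmult p F \<in> comp_ideal"
proof (induction "card (tsupp p)" arbitrary: p)
  case 0
  then have "tsupp p = {}" by (simp add: tpolys_def)
  then have "tmult p F = tzero" by (simp add: tmult_def tzero_def)
  then show ?case by (simp add: tzero_comp_ideal)
next
  case (Suc n)
  have fin: "finite (tsupp p)" "tsupp p \<subseteq> hpoly_exps" using Suc.prems by (auto simp: tpolys_def)
  have "tsupp p \<noteq> {}" using Suc.hyps(2) by auto
  then obtain x where x: "x \<in> tsupp p" by blast
  define q where "q = (\<lambda>y. if y = x then None else p y)"
  define m where "m = (\<lambda>y. if y = x then Some (the (p x)) else None)"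
  have q: "tsupp q = tsupp p - {x}" and m: "tsupp m = {x}" by (auto simp: q_def m_def tsupp_def split: if_splits)
  have "p = tadd q m"
  proof
    fix y show "p y = tadd q m y"
      using x by (cases "y = x"; cases "p y") (auto simp: q_def m_def tadd_def tsupp_def)
  qed
  moreover have "tmult (tadd q m) F = tadd (tmult q F) (tmult m F)"
    using fin F q m by (intro tmult_tadd_disjoint) (auto simp: comp_ideal_def tpolys_def)
  moreover have "tmult q F \<in> comp_ideal"
    using Suc.hyps(2) fin q x by (intro Suc.hyps(1)) (auto simp: tpolys_def)
  moreover have "tmult m F \<in> comp_ideal"
    unfolding m_def tmult_monomial using F x fin by (intro comp_ideal_scale_shift) auto
  ultimately show ?case using comp_ideal_tadd by simp
qed

lemma homogenize_comp_ideal: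
  assumes f: "f \<in> I" "f \<in> tpolys poly_exps"
  shows "homogenize f \<in> comp_ideal"
proof -
  have fin: "finite (tsupp f)" using f by (simp add: tpolys_def)
  let ?D = "Max (total_deg ` tsupp f)"
  have supp: "tsupp (homogenize f) = (\<lambda>u. (?D - total_deg u, u)) ` tsupp f"
    by (auto simp: tsupp_def homogenize_eq image_iff split: if_splits)
  have "total_deg u \<le> ?D" if "u \<in> tsupp f" for u using fin that by (intro Max_ge) auto
  then have "tsupp (homogenize f) \<subseteq> hpoly_exps"
    unfolding supp using f(2) by (auto simp: hpoly_exps_def tpolys_def poly_exps_def)
  then show ?thesis using f(1) fin tzero_I supp by (auto simp: comp_ideal_def tpolys_def hcomp_homogenize)
qed

lemma hom_ideal_subset: "hom_ideal \<subseteq> comp_ideal"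
proof -
  have "semiring_ideal hpoly_exps comp_ideal"
    unfolding semiring_ideal_def using comp_ideal_tadd comp_ideal_tmult tzero_comp_ideal
    by (auto simp: comp_ideal_def)
  moreover have "homogenize ` (I \<inter> tpolys poly_exps) \<subseteq> comp_ideal" using homogenize_comp_ideal by auto
  ultimately show ?thesis unfolding homogenization_ideal_def ideal_generated_def by (intro Inter_lower) simp
qed

definition hlift :: "nat \<Rightarrow> int ^ 'n \<Rightarrow> int \<times> (int ^ 'n)" where
  "hlift e u = (int e - total_deg u, u)"

lemma hmonomials_eq: "hmonomials e = hlift e ` exps_le e"
  by (auto simp: hmonomials_def hpoly_exps_def exps_le_def hlift_def image_iff)

text \<open>The homogenization of \<open>f\<close> has the least possible degree; a power of
  \<open>x_0\<close> raises it to degree \<open>e\<close>.\<close>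

lemma lift_in_hom_ideal:
  assumes f: "f \<in> I" "f \<noteq> tzero" "tsupp f \<subseteq> exps_le e"
  obtains F where "F \<in> hom_ideal" "F \<noteq> tzero" "tsupp F = hlift e ` tsupp f"
proof -
  let ?D = "Max (total_deg ` tsupp f)"
  have fin: "finite (tsupp f)" using finite_supp f(1) by blast
  have ne: "tsupp f \<noteq> {}" using f(2) by (simp add: tsupp_empty_iff)
  have De: "?D \<le> int e" using fin ne f(3) by (auto simp: exps_le_def)
  let ?x = "(int e - ?D, 0 :: int ^ 'n)"
  let ?m = "\<lambda>y. if y = ?x then Some 0 else (None :: trop)"
  define F where "F = tscale 0 (tshift ?x (homogenize f))"
  have fp: "f \<in> tpolys poly_exps" using fin f(3) by (auto simp: tpolys_def poly_exps_def exps_le_def)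
  have "tsupp ?m = {?x}" by (auto simp: tsupp_def split: if_splits)
  then have "?m \<in> tpolys hpoly_exps" using De by (simp add: tpolys_def hpoly_exps_def)
  then have "tmult ?m (homogenize f) \<in> J" if "semiring_ideal hpoly_exps J" "homogenize ` (I \<inter> tpolys poly_exps) \<subseteq> J" for J
    using that f(1) fp unfolding semiring_ideal_def by blast
  then have "F \<in> hom_ideal"
    unfolding F_def tmult_monomial homogenization_ideal_def ideal_generated_def by blast
  moreover have supp: "tsupp F = hlift e ` tsupp f"
    unfolding F_def by (auto simp: mem_tsupp_tshift hlift_def image_iff) (auto simp: tsupp_def homogenize_eq split: if_splits)
  moreover have "F \<noteq> tzero" using ne supp by (auto simp flip: tsupp_empty_iff)
  ultimately show thesis using that by blast
qed

text \<open>Relations in degree \<open>e\<close> correspond to elements of \<open>I\<close>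
  supported in \<open>exps_le e\<close>: lifting gives one direction and \<open>hcomp\<close> the
  other. The Hilbert function is therefore a rank, attained by the exponents that do not lead at any
  chosen weight.\<close>

lemma hilbert_fun_hom_ideal:
  assumes inj: "inj (\<lambda>u :: int ^ 'n. expdot u v)"
  shows "hilbert_fun hom_ideal e = card (exps_le e - init_exps v w e)"
proof -
  let ?B = "exps_le e - init_exps v w e"
  let ?good = "\<lambda>S. S \<subseteq> hmonomials e \<and> \<not> (\<exists>f\<in>hom_ideal. f \<noteq> tzero \<and> tsupp f \<subseteq> S)"
  have injh: "inj_on (hlift e) X" for X by (auto simp: inj_on_def hlift_def)
  have indB: "indep ?B" using inj inj_on_subset by (intro indep_nonleads) blast
  have le: "card S \<le> card ?B" if S: "?good S" for S
  proof -
    obtain T where T: "T \<subseteq> exps_le e" "S = hlift e ` T" using S unfolding hmonomials_eq by (auto simp: subset_image_iff)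
    have "indep T"
      unfolding indep_def
    proof (intro ballI impI, rule ccontr)
      fix f assume f: "f \<in> I" "tsupp f \<subseteq> T" "f \<noteq> tzero"
      obtain F where "F \<in> hom_ideal" "F \<noteq> tzero" "tsupp F = hlift e ` tsupp f"
        using lift_in_hom_ideal[OF f(1,3) order_trans[OF f(2) T(1)]] by blast
      moreover from this(3) have "tsupp F \<subseteq> S" using f(2) T(2) by auto
      ultimately show False using S by blast
    qed
    then have "card T \<le> card ?B" using T(1) by (intro card_indep_le_nonleads) auto
    then show ?thesis using T(2) card_image[OF injh] by simp
  qed
  have good: "?good (hlift e ` ?B)"
  proof (intro conjI notI)
    show "hlift e ` ?B \<subseteq> hmonomials e" unfolding hmonomials_eq by blast
    assume "\<exists>f\<in>hom_ideal. f \<noteq> tzero \<and> tsupp f \<subseteq> hlift e ` ?B"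
    then obtain F where F: "F \<in> hom_ideal" "F \<noteq> tzero" "tsupp F \<subseteq> hlift e ` ?B" by blast
    have hI: "hcomp (int e) F \<in> I" using F(1) hom_ideal_subset by (auto simp: comp_ideal_def)
    have supp: "u \<in> tsupp (hcomp (int e) F) \<longleftrightarrow> hlift e u \<in> tsupp F" for u
      by (simp add: hcomp_def tsupp_def hlift_def)
    have "tsupp (hcomp (int e) F) \<subseteq> ?B" using F(3) supp by (auto simp: hlift_def)
    then have z: "tsupp (hcomp (int e) F) = {}" using indB hI unfolding indep_def by (simp add: tsupp_empty_iff)
    have "tsupp F \<noteq> {}" using F(2) by (simp add: tsupp_empty_iff)
    then obtain x where x: "x \<in> tsupp F" by blast
    then obtain u where "x = hlift e u" using F(3) by blast
    then show False using z supp[of u] x by simp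
  qed
  have "Max {card S | S. ?good S} = card ?B"
  proof (rule Max_eqI)
    have "{card S | S. ?good S} \<subseteq> {..card ?B}" using le by auto
    then show "finite {card S | S. ?good S}" by (rule finite_subset) simp
    show "y \<le> card ?B" if "y \<in> {card S | S. ?good S}" for y using that le by blast
    have "card ?B = card (hlift e ` ?B)" using card_image[OF injh] by simp
    then show "card ?B \<in> {card S | S. ?good S}"
      by (intro CollectI exI[of _ "hlift e ` ?B"]) (rule conjI[OF _ good])
  qed
  then show ?thesis by (simp add: hilbert_fun_def)
qed

end

section \<open>Growth of the Hilbert function\<close>

lemma abs_poly_le:
  fixes p :: "real poly" and x :: real
  assumes x: "1 \<le> x" and d: "degree p \<le> d"
  shows "\<bar>poly p x\<bar> \<le> (\<Sum>i\<le>degree p. \<bar>coeff p i\<bar>) * x ^ d"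
proof -
  have "\<bar>poly p x\<bar> \<le> (\<Sum>i\<le>degree p. \<bar>coeff p i * x ^ i\<bar>)" unfolding poly_altdef by (rule sum_abs)
  also have "\<dots> \<le> (\<Sum>i\<le>degree p. \<bar>coeff p i\<bar> * x ^ d)"
  proof (rule sum_mono)
    fix i assume "i \<in> {..degree p}"
    then have "x ^ i \<le> x ^ d" using x d by (intro power_increasing) auto
    then show "\<bar>coeff p i * x ^ i\<bar> \<le> \<bar>coeff p i\<bar> * x ^ d" using x by (simp add: abs_mult mult_left_mono)
  qed
  finally show ?thesis by (simp add: sum_distrib_right)
qed

lemma poly_not_bounded_by_lower_power:
  fixes p :: "real poly"
  assumes deg: "degree p = Suc k"
  shows "\<not> (\<forall>\<^sub>F e in sequentially. \<bar>poly p (real e)\<bar> \<le> M * real e ^ k)"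
proof
  assume ev: "\<forall>\<^sub>F e in sequentially. \<bar>poly p (real e)\<bar> \<le> M * real e ^ k"
  define l where "l = lead_coeff p"
  define r where "r = p - monom l (Suc k)"
  have "p \<noteq> 0" using deg by auto
  then have l: "l \<noteq> 0" by (simp add: l_def)
  have "degree r \<le> k"
  proof (rule degree_le, intro allI impI)
    fix i assume "k < i"
    then show "coeff r i = 0" using deg by (cases "i = Suc k") (auto simp: r_def l_def coeff_eq_0)
  qed
  define K where "K = (\<Sum>i\<le>degree r. \<bar>coeff r i\<bar>)"
  have "\<forall>\<^sub>F e in sequentially. real e > (M + K) / \<bar>l\<bar> \<and> e \<ge> 1"
    by (intro eventually_conj eventually_ge_at_top)
       (use filterlim_real_sequentially in \<open>simp add: filterlim_at_top_dense\<close>)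
  with ev have "\<forall>\<^sub>F e in sequentially. False"
  proof eventually_elim
    case (elim e)
    then have e: "1 \<le> real e" "M + K < \<bar>l\<bar> * real e" using l by (auto simp: pos_divide_less_eq mult.commute)
    have "poly p (real e) = l * real e ^ Suc k + poly r (real e)" by (simp add: r_def poly_monom)
    then have "\<bar>l * real e ^ Suc k\<bar> \<le> \<bar>poly p (real e)\<bar> + \<bar>poly r (real e)\<bar>" by linarith
    then have "\<bar>l\<bar> * real e ^ Suc k \<le> \<bar>poly p (real e)\<bar> + \<bar>poly r (real e)\<bar>" by (simp add: abs_mult)
    also have "\<dots> \<le> M * real e ^ k + K * real e ^ k"
      unfolding K_def using elim(1) abs_poly_le[OF e(1) \<open>degree r \<le> k\<close>] by (intro add_mono) auto
    also have "\<dots> = (M + K) * real e ^ k" by (simp add: distrib_right)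
    also have "\<dots> < (\<bar>l\<bar> * real e) * real e ^ k" using e by (intro mult_strict_right_mono) auto
    finally show False by simp
  qed
  then show False by simp
qed

text \<open>The supports of \<open>V\<close>, regarded as constant-coefficient vectors; leading exponents then
  depend on supports only.\<close>

definition (in trop_lin) trivialized :: "'m tpoly set" where
  "trivialized = {(\<lambda>u. if u \<in> tsupp f then Some c else None) | f c. f \<in> V}"

text \<open>Elimination keeps every exponent lying in exactly one of the two supports. At a common
  exponent both vectors have the same constant, so either outcome is admissible.\<close>

lemma (in trop_lin) trop_lin_trivialized: "trop_lin trivialized"
proof
  have supp: "tsupp (\<lambda>u. if u \<in> tsupp f then Some c else None) = tsupp f" for f :: "'m tpoly" and c :: real
    by (auto simp: tsupp_def)
  show "finite (tsupp g)" if "g \<in> trivialized" for g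
    using that finite_supp supp by (auto simp: trivialized_def)
  show "tscale c g \<in> trivialized" if g: "g \<in> trivialized" for g c
  proof -
    obtain f a where f: "f \<in> V" "g = (\<lambda>u. if u \<in> tsupp f then Some a else None)"
      using g unfolding trivialized_def by blast
    then have "tscale c g = (\<lambda>u. if u \<in> tsupp f then Some (c + a) else None)" by (auto simp: tscale_def)
    then show ?thesis using f(1) by (auto simp: trivialized_def)
  qed
  show "\<exists>h\<in>trivialized. h u = None \<and> (\<forall>v. tle (tmin (f v) (g v)) (h v) \<and> (f v \<noteq> g v \<longrightarrow> h v = tmin (f v) (g v)))"
    if fg: "f \<in> trivialized" "g \<in> trivialized" "f u = g u" "f u \<noteq> None" for f g u
  proof -
    obtain f' a where f': "f' \<in> V" "f = (\<lambda>u. if u \<in> tsupp f' then Some a else None)"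
      using fg(1) unfolding trivialized_def by blast
    obtain g' b where g': "g' \<in> V" "g = (\<lambda>u. if u \<in> tsupp g' then Some b else None)"
      using fg(2) unfolding trivialized_def by blast
    have u: "u \<in> tsupp f'" "u \<in> tsupp g'" "b = a" using fg(3,4) f'(2) g'(2) by (auto split: if_splits)
    obtain h' c where h': "h' \<in> V" and el: "elimination f' g' u c h'"
      using eliminate[OF f'(1) g'(1) u(1,2)] by blast
    note h = eliminationD[OF el]
    define h where "h = (\<lambda>u. if u \<in> tsupp h' then Some a else None)"
    have "h \<in> trivialized" using h' by (auto simp: trivialized_def h_def)
    moreover have "h u = None" using h(1) by (simp add: h_def)
    moreover have "tle (tmin (f v) (g v)) (h v) \<and> (f v \<noteq> g v \<longrightarrow> h v = tmin (f v) (g v))" for v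
    proof -
      have "v \<in> tsupp f' \<or> v \<in> tsupp g'" if "v \<in> tsupp h'" using h(2) that by blast
      moreover have "v \<in> tsupp h'" if "v \<in> tsupp f'" "v \<notin> tsupp g'" using h(5)[OF that(1)] that(2) by blast
      moreover have "v \<in> tsupp h'" if "v \<in> tsupp g'" "v \<notin> tsupp f'" using h(6)[OF that(1)] that(2) by blast
      ultimately show ?thesis
        unfolding f'(2) g'(2) h_def u(3)
        by (cases "v \<in> tsupp f'"; cases "v \<in> tsupp g'"; cases "v \<in> tsupp h'") auto
    qed
    ultimately show ?thesis by blast
  qed
qed

lemma card_int_atLeast0: "card {0..int j} = j + 1"
  by (simp add: nat_add_distrib)

section \<open>The Hilbert polynomial and independent coordinate sublattices\<close>

context laurent_ideal
begin

lemma hilbert_fun_ge_indep: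
  assumes "indep T" "T \<subseteq> exps_le e"
  shows "card T \<le> hilbert_fun hom_ideal e"
proof -
  obtain v :: "real ^ 'n" where v: "inj (\<lambda>u :: int ^ 'n. expdot u v)" by (rule injective_functional)
  show ?thesis
    unfolding hilbert_fun_hom_ideal[OF v, of e 0]
    by (rule card_indep_le_nonleads[OF finite_exps_le assms])
qed

text \<open>The simplex \<open>exps_le e\<close> contains a cube in the coordinates of
  \<open>A\<close> whose coordinates run up to \<open>e div Suc d\<close>, so that their sum over
  \<open>d + 1\<close> directions is at most \<open>e\<close>. If it were independent, the Hilbert
  function would grow like a power of exponent \<open>d + 1\<close>.\<close>

lemma dependent_above_dim:
  assumes dim: "laurent_ideal_dim I d" and A: "card A = Suc d"
  shows "\<not> indep (coord_exps A)"
proof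
  assume ind: "indep (coord_exps A)"
  obtain p :: "real poly" where p: "degree p = d"
    "\<forall>\<^sub>F e in sequentially. real (hilbert_fun hom_ideal e) = poly p (real e)"
    using dim unfolding laurent_ideal_dim_def hom_ideal_dim_def by blast
  define K where "K = (\<Sum>i\<le>degree p. \<bar>coeff p i\<bar>)"
  define m where "m = real (Suc d)"
  have low: "(real e / m) ^ Suc d \<le> real (hilbert_fun hom_ideal e)" for e
  proof -
    define T where "T = {u :: int ^ 'n. \<forall>i. u $ i \<in> (if i \<in> A then {0..int (e div Suc d)} else {0})}"
    have T1: "u $ i \<in> (if i \<in> A then {0..int (e div Suc d)} else {0})" if "u \<in> T" for u i
      using that by (simp add: T_def)
    have "T \<subseteq> exps_le e"
    proof
      fix u assume u: "u \<in> T"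
      have nn: "0 \<le> u $ i" for i using T1[OF u, of i] by (auto split: if_splits)
      have zero: "u $ i = 0" if "i \<notin> A" for i using T1[OF u, of i] that by simp
      have bound: "u $ i \<le> int (e div Suc d)" if "i \<in> A" for i using T1[OF u, of i] that by simp
      have "total_deg u = (\<Sum>i\<in>A. u $ i)"
        unfolding total_deg_def using zero by (intro sum.mono_neutral_right) auto
      also have "\<dots> \<le> (\<Sum>i\<in>A. int (e div Suc d))"
        using bound by (rule sum_mono)
      also have "\<dots> = int (Suc d * (e div Suc d))" using A by (simp add: distrib_right)
      also have "\<dots> \<le> int e" by (simp only: of_nat_le_iff) (metis div_times_less_eq_dividend mult.commute)
      finally show "u \<in> exps_le e" using nn by (simp add: exps_le_def)
    qed
    moreover have "indep T"
      by (rule indep_mono[OF ind]) (use T1 in \<open>force simp: coord_exps_def split: if_splits\<close>)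
    ultimately have "card T \<le> hilbert_fun hom_ideal e" by (intro hilbert_fun_ge_indep)
    moreover have "card T = (e div Suc d + 1) ^ Suc d"
      unfolding T_def card_int_box A card_int_atLeast0 by simp
    moreover have "real e / m \<le> real (e div Suc d + 1)"
    proof -
      have "e < Suc d * (e div Suc d + 1)"
        by (metis Suc_eq_plus1 dividend_less_times_div zero_less_Suc mult_Suc_right add.commute)
      then have "real e \<le> m * real (e div Suc d + 1)" unfolding m_def by (metis less_imp_le of_nat_le_iff of_nat_mult)
      then show ?thesis by (simp add: m_def pos_divide_le_eq mult.commute)
    qed
    then have "(real e / m) ^ Suc d \<le> real (e div Suc d + 1) ^ Suc d" by (intro power_mono) (auto simp: m_def)
    ultimately show ?thesis by (metis of_nat_le_iff of_nat_power order_trans)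
  qed
  have "\<forall>\<^sub>F e in sequentially. real e > K * m ^ Suc d \<and> e \<ge> 1"
    by (intro eventually_conj eventually_ge_at_top)
       (use filterlim_real_sequentially in \<open>simp add: filterlim_at_top_dense\<close>)
  with p(2) have "\<forall>\<^sub>F e in sequentially. False"
  proof eventually_elim
    case (elim e)
    have e1: "1 \<le> real e" using elim by simp
    have m0: "0 < m ^ Suc d" by (simp add: m_def)
    have "(real e / m) ^ Suc d \<le> K * real e ^ d"
      using low[of e] elim(1) abs_poly_le[OF e1, of p d] p(1) unfolding K_def by linarith
    then have "real e ^ Suc d \<le> (K * real e ^ d) * m ^ Suc d"
      using m0 by (simp only: power_divide pos_divide_le_eq)
    then have "real e ^ d * real e \<le> real e ^ d * (K * m ^ Suc d)" by (simp add: algebra_simps)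
    moreover have "0 < real e ^ d" using e1 by simp
    ultimately have "real e \<le> K * m ^ Suc d" by (metis mult_le_cancel_left_pos)
    then show False using elim(2) by simp
  qed
  then show False by simp
qed

lemma dependent_nonneg:
  fixes A :: "'n set"
  assumes "\<not> indep (coord_exps A)"
  obtains f where "f \<in> I" "f \<noteq> tzero" "\<And>u i. u \<in> tsupp f \<Longrightarrow> 0 \<le> u $ i" "tsupp f \<subseteq> coord_exps A"
proof -
  obtain f where f: "f \<in> I" "tsupp f \<subseteq> coord_exps A" "f \<noteq> tzero" using assms unfolding indep_def by blast
  obtain s e where s: "(\<lambda>u. u + s) ` tsupp f \<subseteq> exps_le e"
    using shift_into_exps_le[OF finite_supp[OF f(1)]] by blast
  \<comment> \<open>Only the coordinates in \<open>A\<close> are shifted, so that the support stays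
    in \<open>coord_exps A\<close>.\<close>
  define t :: "int ^ 'n" where "t = (\<chi> i. if i \<in> A then s $ i else 0)"
  have supp: "tsupp (tshift t f) = (\<lambda>u. u + t) ` tsupp f" by (rule tsupp_tshift)
  show thesis
  proof (rule that[of "tshift t f"])
    show "tshift t f \<in> I" by (rule shift[OF f(1)])
    have "tsupp (tshift t f) \<noteq> {}" unfolding supp using f(3) by (simp add: tsupp_empty_iff)
    then show "tshift t f \<noteq> tzero" by (simp add: tsupp_empty_iff)
    show "tsupp (tshift t f) \<subseteq> coord_exps A" unfolding supp using f(2) by (auto simp: coord_exps_def t_def)
    fix x i assume "x \<in> tsupp (tshift t f)"
    then obtain u where u: "u \<in> tsupp f" "x = u + t" unfolding supp by blast
    have "u + s \<in> exps_le e" using s u(1) by blast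
    then have "0 \<le> (u + s) $ i" by (rule exps_le_component)
    moreover have "u $ i = 0" if "i \<notin> A" using f(2) u(1) that by (auto simp: coord_exps_def)
    ultimately show "0 \<le> x $ i" unfolding u(2) t_def by (cases "i \<in> A") auto
  qed
qed

text \<open>Each \<open>A\<close> of size \<open>d\<close> provides a leading monomial in its
  coordinates. An exponent with \<open>d\<close> coordinates beyond all these monomials is divisible
  by one of them and leads, so the rest lies in boxes with fewer than \<open>d\<close> long sides.
  For \<open>d = 0\<close> there are no such boxes, and the bound is \<open>0\<close>.\<close>

lemma hilbert_fun_le_of_dependent:
  assumes dep: "\<And>A :: 'n set. card A = d \<Longrightarrow> \<not> indep (coord_exps A)"
  obtains K :: nat where "\<And>e. hilbert_fun hom_ideal e \<le> card {A :: 'n set. card A < d} * ((e + 1) ^ (d - 1) * K)"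
proof -
  obtain v :: "real ^ 'n" where v: "inj (\<lambda>u :: int ^ 'n. expdot u v)" by (rule injective_functional)
  interpret T: trop_lin trivialized by (rule trop_lin_trivialized)
  \<comment> \<open>The sign makes leading exponents have top degree, so that a translate of a
    relation with lead in \<open>exps_le e\<close> does not exceed degree \<open>e\<close>. Constant
    coefficients prevent the original valuation from overriding the degree.\<close>
  let ?\<theta> = "\<lambda>u :: int ^ 'n. - real_of_int (total_deg u)" and ?\<tau> = "\<lambda>u :: int ^ 'n. expdot u v"
  have "\<exists>m f. f \<in> I \<and> m \<in> tsupp f \<and> (\<forall>u\<in>tsupp f. \<forall>i. 0 \<le> u $ i) \<and> tsupp f \<subseteq> coord_exps A \<and>
      (\<forall>u\<in>tsupp f. u \<noteq> m \<longrightarrow> total_deg u < total_deg m \<or> total_deg u = total_deg m \<and> ?\<tau> m < ?\<tau> u)"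
    if A: "card A = d" for A :: "'n set"
  proof -
    obtain f where f: "f \<in> I" "f \<noteq> tzero" "\<And>u i. u \<in> tsupp f \<Longrightarrow> 0 \<le> u $ i" "tsupp f \<subseteq> coord_exps A"
      using dependent_nonneg[OF dep[OF A]] by blast
    define g where "g = (\<lambda>u. if u \<in> tsupp f then Some (0 :: real) else None)"
    have supp: "tsupp g = tsupp f" by (auto simp: g_def tsupp_def)
    then have "g \<noteq> tzero" using f(2) by (metis tsupp_empty_iff)
    moreover have "finite (tsupp g)" using supp finite_supp[OF f(1)] by simp
    moreover have "inj_on ?\<tau> (tsupp g)" using v inj_on_subset by blast
    ultimately obtain m where m: "lead ?\<theta> ?\<tau> g m" using lead_exists by metis
    have mf: "m \<in> tsupp f" using m supp by (simp add: lead_def)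
    have "total_deg u < total_deg m \<or> total_deg u = total_deg m \<and> ?\<tau> m < ?\<tau> u" if "u \<in> tsupp f" "u \<noteq> m" for u
      using m that mf unfolding lead_def supp by (auto simp: g_def)
    then show ?thesis using f mf by blast
  qed
  then obtain m f where mf: "\<And>A :: 'n set. card A = d \<Longrightarrow> f A \<in> I \<and> m A \<in> tsupp (f A) \<and>
      (\<forall>u\<in>tsupp (f A). \<forall>i. 0 \<le> u $ i) \<and> tsupp (f A) \<subseteq> coord_exps A \<and>
      (\<forall>u\<in>tsupp (f A). u \<noteq> m A \<longrightarrow> total_deg u < total_deg (m A) \<or> total_deg u = total_deg (m A) \<and> ?\<tau> (m A) < ?\<tau> u)"
    by metis
  define k where "k = nat (\<Sum>A\<in>{A :: 'n set. card A = d}. \<Sum>i\<in>UNIV. \<bar>m A $ i\<bar>)"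
  have k: "m A $ i \<le> int k" if "card A = d" for A i
  proof -
    have "m A $ i \<le> \<bar>m A $ i\<bar>" by simp
    also have "\<dots> \<le> (\<Sum>i\<in>UNIV. \<bar>m A $ i\<bar>)" by (rule member_le_sum) auto
    also have "\<dots> \<le> (\<Sum>A\<in>{A :: 'n set. card A = d}. \<Sum>i\<in>UNIV. \<bar>m A $ i\<bar>)"
      using that by (intro member_le_sum) (auto intro: sum_nonneg)
    finally show ?thesis by (simp add: k_def)
  qed
  define box where "box e A = {u :: int ^ 'n. \<forall>i. u $ i \<in> (if i \<in> A then {0..int e} else {0..int k})}" for e :: nat and A :: "'n set"
  have cover: "exps_le e - T.leads ?\<theta> ?\<tau> (exps_le e) \<subseteq> (\<Union>A\<in>{A. card A < d}. box e A)" for e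
  proof
    fix u assume u: "u \<in> exps_le e - T.leads ?\<theta> ?\<tau> (exps_le e)"
    have ue: "u \<in> exps_le e" using u by blast
    define A' where "A' = {i. int k < u $ i}"
    have "u \<in> box e A'" using exps_le_component[OF ue] by (auto simp: box_def A'_def)
    moreover have "card A' < d"
    proof (rule ccontr)
      assume "\<not> ?thesis"
      then obtain A where A: "A \<subseteq> A'" "card A = d" using obtain_subset_with_card_n by (metis not_less)
      note fA = mf[OF A(2)]
      have mu: "m A $ i \<le> u $ i" for i
      proof (cases "i \<in> A")
        case True
        then show ?thesis using k[OF A(2), of i] A(1) by (auto simp: A'_def)
      next
        case False
        then have "m A $ i = 0" using fA by (auto simp: coord_exps_def)
        then show ?thesis using exps_le_component[OF ue] by simp
      qed
      define h where "h = tshift (u - m A) (f A)"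
      define g where "g = (\<lambda>x. if x \<in> tsupp h then Some (0 :: real) else None)"
      have "h \<in> I" unfolding h_def using fA shift by blast
      then have gT: "g \<in> trivialized" unfolding g_def trivialized_def by blast
      have gs: "tsupp g = (\<lambda>x. x + (u - m A)) ` tsupp (f A)"
        unfolding tsupp_tshift[symmetric] h_def[symmetric] by (auto simp: g_def tsupp_def)
      have deg: "total_deg x \<le> total_deg (m A)" if "x \<in> tsupp (f A)" for x using fA that by fastforce
      have "tsupp g \<subseteq> exps_le e"
      proof
        fix y assume "y \<in> tsupp g"
        then obtain x where x: "x \<in> tsupp (f A)" "y = x + (u - m A)" using gs by blast
        have "0 \<le> y $ i" for i using fA x mu[of i] by auto
        moreover have "total_deg y \<le> int e"
          using deg[OF x(1)] ue unfolding x(2) exps_le_def by (simp add: total_deg_add total_deg_diff)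
        ultimately show "y \<in> exps_le e" by (simp add: exps_le_def)
      qed
      moreover have "lead ?\<theta> ?\<tau> g u"
        unfolding lead_def
      proof (intro conjI ballI impI)
        show ug: "u \<in> tsupp g" unfolding gs using fA by (intro image_eqI[of _ _ "m A"]) auto
        fix y assume y: "y \<in> tsupp g" "y \<noteq> u"
        then obtain x where x: "x \<in> tsupp (f A)" "y = x + (u - m A)" using gs by blast
        have "x \<noteq> m A" using x(2) y(2) by auto
        then have "total_deg x < total_deg (m A) \<or> total_deg x = total_deg (m A) \<and> ?\<tau> (m A) < ?\<tau> x" using fA x(1) by blast
        moreover have "the (g u) = 0" "the (g y) = 0" using ug y(1) by (auto simp: g_def tsupp_def split: if_splits)
        ultimately show "the (g u) + ?\<theta> u < the (g y) + ?\<theta> y \<or> the (g u) + ?\<theta> u = the (g y) + ?\<theta> y \<and> ?\<tau> u < ?\<tau> y"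
          unfolding x(2) by (auto simp: total_deg_add total_deg_diff expdot_add expdot_diff)
      qed
      ultimately have "u \<in> T.leads ?\<theta> ?\<tau> (exps_le e)" using gT unfolding T.leads_def by blast
      then show False using u by blast
    qed
    ultimately show "u \<in> (\<Union>A\<in>{A. card A < d}. box e A)" by blast
  qed
  have finbox: "finite (box e A)" for e A unfolding box_def by (rule finite_vec_box) auto
  \<comment> \<open>Both systems have the same supports, hence the same independent sets, so a basis
    for the ideal can be measured by the leads of the trivialized system.\<close>
  have indT: "T.indep S" if "indep S" for S
    unfolding T.indep_def
  proof (intro ballI impI)
    fix g assume g: "g \<in> trivialized" "tsupp g \<subseteq> S"
    then obtain f c where f: "f \<in> I" "g = (\<lambda>u. if u \<in> tsupp f then Some c else None)"
      by (auto simp: trivialized_def)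
    have supp: "tsupp g = tsupp f" unfolding f(2) by (auto simp: tsupp_def)
    then have "f = tzero" using that f(1) g(2) unfolding indep_def by blast
    then show "g = tzero" using supp by (metis tsupp_empty_iff)
  qed
  show thesis
  proof (rule that[of "(k + 1) ^ CARD('n)"])
    fix e
    let ?B = "exps_le e - init_exps v 0 e"
    have "indep ?B" using v inj_on_subset by (intro indep_nonleads) blast
    then have "card ?B \<le> card (exps_le e - T.leads ?\<theta> ?\<tau> (exps_le e))"
      by (intro T.card_indep_le_nonleads indT) auto
    also have "\<dots> \<le> card (\<Union>A\<in>{A. card A < d}. box e A)" using cover finbox by (intro card_mono) auto
    also have "\<dots> \<le> (\<Sum>A\<in>{A :: 'n set. card A < d}. card (box e A))" by (rule card_UN_le) simp
    also have "\<dots> \<le> (\<Sum>A\<in>{A :: 'n set. card A < d}. (e + 1) ^ (d - 1) * (k + 1) ^ CARD('n))"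
    proof (rule sum_mono)
      fix A :: "'n set" assume "A \<in> {A. card A < d}"
      then have "card A \<le> d - 1" by simp
      moreover have "card (- A) \<le> CARD('n)" by (rule card_mono) auto
      ultimately show "card (box e A) \<le> (e + 1) ^ (d - 1) * (k + 1) ^ CARD('n)"
        unfolding box_def card_int_box card_int_atLeast0 by (intro mult_le_mono power_increasing) auto
    qed
    also have "\<dots> = card {A :: 'n set. card A < d} * ((e + 1) ^ (d - 1) * (k + 1) ^ CARD('n))" by simp
    finally show "hilbert_fun hom_ideal e \<le> card {A :: 'n set. card A < d} * ((e + 1) ^ (d - 1) * (k + 1) ^ CARD('n))"
      using hilbert_fun_hom_ideal[OF v, of e 0] by simp
  qed
qed

lemma independent_at_dim:
  assumes dim: "laurent_ideal_dim I d"
  obtains A :: "'n set" where "card A = d" "indep (coord_exps A)"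
proof (rule ccontr)
  assume neg: "\<not> thesis"
  obtain p :: "real poly" where p: "p \<noteq> 0" "degree p = d"
    "\<forall>\<^sub>F e in sequentially. real (hilbert_fun hom_ideal e) = poly p (real e)"
    using dim unfolding laurent_ideal_dim_def hom_ideal_dim_def by blast
  note witness = that
  have "\<not> indep (coord_exps A)" if "card A = d" for A :: "'n set" using neg witness that by blast
  then obtain K :: nat where K: "\<And>e. hilbert_fun hom_ideal e \<le> card {A :: 'n set. card A < d} * ((e + 1) ^ (d - 1) * K)"
    using hilbert_fun_le_of_dependent[of d] by blast
  show False
  proof (cases d)
    case 0
    \<comment> \<open>No set has negative cardinality, so the bound makes the Hilbert function
      vanish, whereas its polynomial is nonzero.\<close>
    then have "\<forall>\<^sub>F e in sequentially. poly p (real e) = 0" using p(3) K by (auto elim: eventually_mono)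
    then obtain e :: nat where "poly p (real e) = 0" using eventually_happens sequentially_bot by blast
    moreover obtain a where "p = [:a:]" using p(2) 0 degree_eq_zeroE by blast
    ultimately show False using p(1) by simp
  next
    case (Suc k)
    define c where "c = card {A :: 'n set. card A < d}"
    have "\<forall>\<^sub>F e in sequentially. \<bar>poly p (real e)\<bar> \<le> (real c * real K * 2 ^ k) * real e ^ k"
      using p(3) eventually_ge_at_top[of 1]
    proof eventually_elim
      case (elim e)
      have "poly p (real e) = real (hilbert_fun hom_ideal e)" using elim by simp
      also have "\<dots> \<le> real (c * ((e + 1) ^ k * K))" using K[of e] Suc unfolding c_def by (simp only: of_nat_le_iff diff_Suc_1)
      also have "\<dots> = (real c * real K) * (real e + 1) ^ k" by (simp add: add.commute)
      also have "\<dots> \<le> (real c * real K) * (2 * real e) ^ k" using elim by (intro mult_left_mono power_mono) auto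
      finally have "poly p (real e) \<le> (real c * real K * 2 ^ k) * real e ^ k" by (simp add: power_mult_distrib)
      moreover have "0 \<le> poly p (real e)" using elim by (metis of_nat_0_le_iff)
      ultimately show ?case by simp
    qed
    then show False using poly_not_bounded_by_lower_power[of p k] p(2) Suc by blast
  qed
qed

end

theorem theorem4p3:
  fixes I :: "(int ^ 'n) tpoly set" and d :: nat
  assumes "tropical_ideal laurent_exps I"
    and "laurent_ideal_dim I d"
  shows "\<exists>C :: (real ^ 'n) set set. polyhedral_complex C \<and> \<Union>C = trop_variety I \<and>
           (\<forall>P\<in>C. aff_dim P \<le> int d) \<and> (\<exists>P\<in>C. aff_dim P = int d)"
proof -
  interpret laurent_ideal I by unfold_locales (rule assms(1))
  obtain H where H: "finite H" "\<And>w. w \<in> trop_variety I \<Longrightarrow> arr_cell H w \<subseteq> trop_variety I"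
    using trop_variety_arrangement by blast
  define C where "C = arr_cell H ` trop_variety I"
  have C: "polyhedral_complex C" "\<Union>C = trop_variety I"
    unfolding C_def by (rule polyhedral_complex_arr_cells(1)[OF H], assumption)
      (rule polyhedral_complex_arr_cells(2)[OF H], assumption)
  have dep: "\<not> indep (coord_exps A)" if "card A = Suc d" for A :: "'n set"
    by (rule dependent_above_dim[OF assms(2) that])
  have upper: "aff_dim P \<le> int d" if "P \<in> C" for P
  proof (rule aff_dim_le_of_dependent)
    show "convex P" using C(1) that polyhedron_imp_convex unfolding polyhedral_complex_def by blast
    show "P \<subseteq> trop_variety I" using C(2) that by blast
  qed (rule dep)
  obtain A :: "'n set" where A: "card A = d" "indep (coord_exps A)"
    using independent_at_dim[OF assms(2)] by blast
  have "\<exists>P\<in>C. int (card A) \<le> aff_dim P"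
  proof (rule aff_dim_ge_of_independent[OF _ C(2) A(2)])
    show "finite C" using C(1) by (simp add: polyhedral_complex_def)
    show "\<not> indep (coord_exps (insert i A))" if "i \<notin> A" for i using A(1) that by (intro dep) simp
  qed
  then have "\<exists>P\<in>C. aff_dim P = int d" using upper A(1) by (metis order_antisym)
  then show ?thesis using C upper by blast
qed

end
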